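(* Let $k\in\mathbb{N}$ and let $\mathsf{D}_1,\mathsf{D}_2$ be finite, coherent, interface-respecting DP-cores with identity cleaning and witness actions, such that $P_1=\mathcal{P}(\mathsf{D}_1)$ is closed under subgraphs; let $P_2=\mathcal{P}(\mathsf{D}_2)$. Then the ISO-BFS-premise search (described in the context) terminates. Moreover, it returns "Inclusion Holds" if and only if there is no graph $G$ of treewidth at most $k$ with $G\in P_1$ and $G\notin P_2$; otherwise it returns a list of canonical triples ending in an inconsistent triple.
   Context: Graphs are triples $(V,E,\rho)$, $V,E$ finite subsets of $\mathbb{N}$, $\rho\subseteq E\times V$, each edge incident to exactly two distinct vertices (parallel edges allowed); graph properties are isomorphism-closed; $P$ is closed under subgraphs if $G\in P$ and $H$ embedding into $G$ (injective vertex/edge maps preserving and reflecting incidence) imply $H\in P$. Instructive decompositions: the $k$-instructive alphabet has $\mathtt{Leaf}$ (arity 0), $\mathtt{IntroVertex}_u,\mathtt{ForgetVertex}_u$ ($u\in[k+1]$), $\mathtt{IntroEdge}_{u,v}$ (distinct $u,v$) of arity 1, $\mathtt{Join}$ of arity 2. $\mathcal{T}_k$: terms legal w.r.t. bags (Leaf: $\emptyset$; IntroVertex$_u$ needs $u\notin$ bag, adds it; ForgetVertex$_u$ needs $u\in$ bag, removes it; IntroEdge$_{u,v}$ needs $u,v\in$ bag; Join needs equal bags). $G(\tau)$: Leaf empty; IntroVertex$_u$ adds a fresh isolated vertex labeled $u$; ForgetVertex$_u$ drops label $u$; IntroEdge$_{u,v}$ adds an edge between the vertices labeled $u,v$; Join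 is the disjoint union with vertices carrying the same bag label identified (edges never identified). Graphs of treewidth $\le k$ are exactly those isomorphic to some $G(\tau)$, $\tau\in\mathcal{T}_k$. DP-cores: $\mathsf{D}[k]$ has witnesses $\mathcal{W}_k\subseteq\{0,1\}^*$, $\mathtt{Final}_k$, finite $\mathtt{Leaf}_k$, transitions $\mathtt{IntroVertex}_u,\mathtt{ForgetVertex}_u,\mathtt{IntroEdge}_{u,v}:\mathcal{W}_k\to$ finite subsets, $\mathtt{Join}:\mathcal{W}_k^2\to$ finite subsets (lifted to sets by union), $\mathtt{Clean}_k$. $\mathrm{Dyn}_k$ computed bottom-up with cleaning after each transition; acceptance = dynamization contains a final witness; $\mathcal{P}(\mathsf{D})=\bigcup_k$ iso-closure of accepted $G(\tau)$. Finite: $\mathcal{W}_k$ finite. Identity cleaning: $\mathtt{Clean}_k=\mathrm{id}$. Coherent: acceptance agrees on decompositions (of any widths) with isomorphic graphs. Labels: each witness $w$ has $\mathrm{Lbl}_k(w)\subseteq[k+1]$, $\mathrm{Lbl}_k(S)=\bigcup_{w\in S}\mathrm{Lbl}_k(w)$. Interface-respecting: $\mathrm{Lbl}_k(\mathtt{Leaf}_k)=\emptyset$, and whenever $\mathrm{Lbl}_k(S),\mathrm{Lbl}_k(S')\subseteq b$: $\mathrm{Lbl}_k(\mathtt{IntroVertex}_u(S))\subseteq b\cup\{u\}$ ($u\notin b$), $\mathrm{Lbl}_k(\mathtt{ForgetVertex}_u(S))\subseteq b\setminus\{u\}$ ($u\in b$), $\mathrm{Lbl}_k(\mathtt{IntroEdge}_{u,v}(S))\subseteq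 b$ ($u,v\in b$), $\mathrm{Lbl}_k(\mathtt{Join}(S,S'))\subseteq b$, $\mathrm{Lbl}_k(\mathtt{Clean}_k(S))\subseteq b$. $\mathcal{F}_k$: injective $f:b\to[k+1]$ with $b\subseteq[k+1]$. A witness action for $\mathsf{D}[k]$ is a partial map $\rho(f,w)\in\mathcal{W}_k$ defined iff $\mathrm{Lbl}_k(w)\subseteq\mathrm{dom}(f)$ (extended pointwise to sets), preserving finality, with $\mathrm{Lbl}_k(\rho(f,w))=f(\mathrm{Lbl}_k(w))$, $\rho(f^{-1},\rho(f,w))=w$, $\rho(f\circ f',w)=\rho(f,\rho(f',w))$ (partial composition), $\rho(f',w)=\rho(f,w)$ when $f'$ extends $f$, and commuting with transitions: $\rho(f,\mathtt{IntroVertex}_u(w))=\mathtt{IntroVertex}_{f(u)}(\rho(f,w))$, similarly ForgetVertex, $\rho(f,\mathtt{IntroEdge}_{u,v}(w))=\mathtt{IntroEdge}_{f(u),f(v)}(\rho(f,w))$, $\rho(f,\mathtt{Join}(w,w'))=\mathtt{Join}(\rho(f,w),\rho(f,w'))$. Triples: $(b,S_1,S_2)$ with $b\subseteq[k+1]$, $S_i\subseteq\mathsf{D}_i[k].\mathcal{W}$ finite; well-formed if $\mathrm{Lbl}_k(S_i)\subseteq b$ for $i=1,2$; it satisfies the premise if $S_1$ contains a final witness of $\mathsf{D}_1[k]$; it is inconsistent if it satisfies the premise and $S_2$ has no final witness of $\mathsf{D}_2[k]$. Product action: for $f:b\to[k+1]$ injective, $f\cdot(b,S_1,S_2)=(f(b),\rho_1(f,S_1),\rho_2(f,S_2))$.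 Fix total orders on the two witness sets and order triples lexicographically by the increasing enumerations of $b$, $S_1$, $S_2$. $\mathrm{CAN}(b,S_1,S_2)=\min\{f\cdot(b,S_1,S_2):f\in\mathcal{F}_k,\ \mathrm{dom}(f)=b\}$. ISO-BFS-premise: Let $Init=\mathrm{CAN}(\emptyset,\mathsf{D}_1[k].\mathtt{Leaf},\mathsf{D}_2[k].\mathtt{Leaf})$, $R$ an empty list, FIFO queue $Y=[Init]$, $Seen=\{Init\}$. While $Y\ne\emptyset$: remove the next triple $t=(b,S_1,S_2)$, append to $R$; if $t$ is inconsistent return $R$; if $t$ satisfies the premise, generate the componentwise successors $(b\cup\{u\},\mathtt{IntroVertex}_u(S_1),\mathtt{IntroVertex}_u(S_2))$ ($u\notin b$), $(b\setminus\{u\},\mathtt{ForgetVertex}_u(S_1),\mathtt{ForgetVertex}_u(S_2))$ ($u\in b$), $(b,\mathtt{IntroEdge}_{u,v}(S_1),\mathtt{IntroEdge}_{u,v}(S_2))$ ($u\ne v\in b$), and for each earlier processed premise-satisfying $(b,S_1',S_2')\in R$ with the same bag and each permutation $\pi$ of $b$, the triples $(b,\mathtt{Join}(S_1,\rho_1(\pi,S_1')),\mathtt{Join}(S_2,\rho_2(\pi,S_2')))$ and $(b,\mathtt{Join}(S_1',\rho_1(\pi,S_1)),\mathtt{Join}(S_2',\rho_2(\pi,S_2)))$; each successor $X$ is replaced by $\mathrm{CAN}(X)$ and, if not in $Seen$, added to $Seen$ and appended to $Y$. When $Y$ is empty return "Inclusion Holds". *)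

theory Defs
  imports Main
begin

section \<open>Multigraphs\<close>

record mgraph =
  verts :: "nat set"
  edges :: "nat set"
  inc :: "(nat \<times> nat) set"

definition graph :: "mgraph \<Rightarrow> bool" where
  "graph G \<longleftrightarrow> finite (verts G) \<and> finite (edges G) \<and> inc G \<subseteq> edges G \<times> verts G \<and>
     (\<forall>e\<in>edges G. card {v. (e, v) \<in> inc G} = 2)"

definition isomorphic :: "mgraph \<Rightarrow> mgraph \<Rightarrow> bool" where
  "isomorphic G H \<longleftrightarrow>
     (\<exists>f g. bij_betw f (verts G) (verts H) \<and> bij_betw g (edges G) (edges H) \<and>
        (\<forall>e\<in>edges G. \<forall>v\<in>verts G. (e, v) \<in> inc G \<longleftrightarrow> (g e, f v) \<in> inc H))"

definition embeds :: "mgraph \<Rightarrow> mgraph \<Rightarrow> bool" where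
  "embeds H G \<longleftrightarrow>
     (\<exists>f g. f ` verts H \<subseteq> verts G \<and> inj_on f (verts H) \<and>
        g ` edges H \<subseteq> edges G \<and> inj_on g (edges H) \<and>
        (\<forall>e\<in>edges H. \<forall>v\<in>verts H. (e, v) \<in> inc H \<longleftrightarrow> (g e, f v) \<in> inc G))"

definition subgraph_closed :: "mgraph set \<Rightarrow> bool" where
  "subgraph_closed P \<longleftrightarrow> (\<forall>G\<in>P. \<forall>H. graph H \<and> embeds H G \<longrightarrow> H \<in> P)"

section \<open>Treewidth\<close>

definition simple_path :: "nat rel \<Rightarrow> nat \<Rightarrow> nat \<Rightarrow> nat list \<Rightarrow> bool" where
  "simple_path F x y p \<longleftrightarrow>
     p \<noteq> [] \<and> hd p = x \<and> last p = y \<and> distinct p \<and> successively (\<lambda>a b. (a, b) \<in> F) p"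

definition tree :: "nat set \<Rightarrow> nat rel \<Rightarrow> bool" where
  "tree N F \<longleftrightarrow> finite N \<and> N \<noteq> {} \<and> F \<subseteq> N \<times> N \<and> sym F \<and> irrefl F \<and>
     (\<forall>x\<in>N. \<forall>y\<in>N. \<exists>!p. simple_path F x y p)"

definition tree_decomposition ::
    "mgraph \<Rightarrow> nat set \<Rightarrow> nat rel \<Rightarrow> (nat \<Rightarrow> nat set) \<Rightarrow> bool" where
  "tree_decomposition G N F \<beta> \<longleftrightarrow>
     tree N F \<and>
     (\<forall>x\<in>N. \<beta> x \<subseteq> verts G) \<and>
     (\<forall>v\<in>verts G. \<exists>x\<in>N. v \<in> \<beta> x) \<and>
     (\<forall>e\<in>edges G. \<exists>x\<in>N. {v. (e, v) \<in> inc G} \<subseteq> \<beta> x) \<and>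
     (\<forall>v\<in>verts G. \<forall>x\<in>N. \<forall>y\<in>N. v \<in> \<beta> x \<and> v \<in> \<beta> y \<longrightarrow>
        (x, y) \<in> (Restr F {z\<in>N. v \<in> \<beta> z})\<^sup>*)"

definition treewidth_at_most :: "nat \<Rightarrow> mgraph \<Rightarrow> bool" where
  "treewidth_at_most k G \<longleftrightarrow>
     (\<exists>N F \<beta>. tree_decomposition G N F \<beta> \<and> (\<forall>x\<in>N. card (\<beta> x) \<le> k + 1))"

section \<open>Instructive tree decompositions\<close>

definition labels :: "nat \<Rightarrow> nat set" where
  "labels k = {1..k + 1}"

datatype itd =
    Leaf
  | IntroVertex nat itd
  | ForgetVertex nat itd
  | IntroEdge nat nat itd
  | Join itd itd

primrec bag :: "itd \<Rightarrow> nat set" where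
  "bag Leaf = {}"
| "bag (IntroVertex u \<tau>) = insert u (bag \<tau>)"
| "bag (ForgetVertex u \<tau>) = bag \<tau> - {u}"
| "bag (IntroEdge u v \<tau>) = bag \<tau>"
| "bag (Join \<sigma> \<tau>) = bag \<sigma>"

primrec legal :: "nat \<Rightarrow> itd \<Rightarrow> bool" where
  "legal k Leaf \<longleftrightarrow> True"
| "legal k (IntroVertex u \<tau>) \<longleftrightarrow> legal k \<tau> \<and> u \<in> labels k \<and> u \<notin> bag \<tau>"
| "legal k (ForgetVertex u \<tau>) \<longleftrightarrow> legal k \<tau> \<and> u \<in> labels k \<and> u \<in> bag \<tau>"
| "legal k (IntroEdge u v \<tau>) \<longleftrightarrow>
     legal k \<tau> \<and> u \<in> labels k \<and> v \<in> labels k \<and> u \<noteq> v \<and> u \<in> bag \<tau> \<and> v \<in> bag \<tau>"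
| "legal k (Join \<sigma> \<tau>) \<longleftrightarrow> legal k \<sigma> \<and> legal k \<tau> \<and> bag \<sigma> = bag \<tau>"

definition fresh :: "nat set \<Rightarrow> nat" where
  "fresh A = (LEAST n. n \<notin> A)"

text \<open>
  A labelled graph is a graph with a partial map from labels to vertices. In a glued graph the
  left operand lives on even numbers and the right one on odd numbers, except that a vertex of
  the right operand labelled \<open>u\<close> is replaced by the vertex of the left operand labelled \<open>u\<close>.
\<close>

definition glue ::
    "mgraph \<times> (nat \<rightharpoonup> nat) \<Rightarrow> mgraph \<times> (nat \<rightharpoonup> nat) \<Rightarrow> mgraph \<times> (nat \<rightharpoonup> nat)" where
  "glue = (\<lambda>(G, \<theta>) (H, \<eta>).
     let ev = (\<lambda>n. 2 * n);
         od = (\<lambda>n. 2 * n + 1);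
         h = (\<lambda>x. if x \<in> ran \<eta> then ev (the (\<theta> (THE u. \<eta> u = Some x))) else od x)
     in (\<lparr>verts = ev ` verts G \<union> h ` verts H,
          edges = ev ` edges G \<union> od ` edges H,
          inc = map_prod ev ev ` inc G \<union> map_prod od h ` inc H\<rparr>,
         map_option ev \<circ> \<theta>))"

primrec labelled_graph :: "itd \<Rightarrow> mgraph \<times> (nat \<rightharpoonup> nat)" where
  "labelled_graph Leaf = (\<lparr>verts = {}, edges = {}, inc = {}\<rparr>, Map.empty)"
| "labelled_graph (IntroVertex u \<tau>) =
     (let (G, \<theta>) = labelled_graph \<tau>; x = fresh (verts G)
      in (G\<lparr>verts := insert x (verts G)\<rparr>, \<theta>(u \<mapsto> x)))"
| "labelled_graph (ForgetVertex u \<tau>) =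
     (let (G, \<theta>) = labelled_graph \<tau> in (G, \<theta>(u := None)))"
| "labelled_graph (IntroEdge u v \<tau>) =
     (let (G, \<theta>) = labelled_graph \<tau>; e = fresh (edges G)
      in (G\<lparr>edges := insert e (edges G),
            inc := inc G \<union> {(e, the (\<theta> u)), (e, the (\<theta> v))}\<rparr>, \<theta>))"
| "labelled_graph (Join \<sigma> \<tau>) = glue (labelled_graph \<sigma>) (labelled_graph \<tau>)"

definition graph_of :: "itd \<Rightarrow> mgraph" where
  "graph_of \<tau> = fst (labelled_graph \<tau>)"

section \<open>DP-cores\<close>

type_synonym witness = "bool list"

record dp_level =
  wit :: "witness set"
  final :: "witness set"
  leaf :: "witness set"
  intro_vertex :: "nat \<Rightarrow> witness \<Rightarrow> witness set"
  forget_vertex :: "nat \<Rightarrow> witness \<Rightarrow> witness set"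
  intro_edge :: "nat \<Rightarrow> nat \<Rightarrow> witness \<Rightarrow> witness set"
  join :: "witness \<Rightarrow> witness \<Rightarrow> witness set"
  clean :: "witness set \<Rightarrow> witness set"

definition fin_sub :: "witness set \<Rightarrow> witness set \<Rightarrow> bool" where
  "fin_sub S W \<longleftrightarrow> finite S \<and> S \<subseteq> W"

definition dp_core :: "(nat \<Rightarrow> 'a dp_level_scheme) \<Rightarrow> bool" where
  "dp_core D \<longleftrightarrow> (\<forall>k. let A = D k; W = wit A in
     final A \<subseteq> W \<and>
     fin_sub (leaf A) W \<and>
     (\<forall>u\<in>labels k. \<forall>w\<in>W. fin_sub (intro_vertex A u w) W \<and> fin_sub (forget_vertex A u w) W) \<and>
     (\<forall>u\<in>labels k. \<forall>v\<in>labels k. \<forall>w\<in>W. u \<noteq> v \<longrightarrow> fin_sub (intro_edge A u v w) W) \<and>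
     (\<forall>w\<in>W. \<forall>w'\<in>W. fin_sub (join A w w') W) \<and>
     (\<forall>S. fin_sub S W \<longrightarrow> fin_sub (clean A S) W))"

definition intro_vertex_set :: "'a dp_level_scheme \<Rightarrow> nat \<Rightarrow> witness set \<Rightarrow> witness set" where
  "intro_vertex_set A u S = (\<Union>w\<in>S. intro_vertex A u w)"

definition forget_vertex_set :: "'a dp_level_scheme \<Rightarrow> nat \<Rightarrow> witness set \<Rightarrow> witness set" where
  "forget_vertex_set A u S = (\<Union>w\<in>S. forget_vertex A u w)"

definition intro_edge_set ::
    "'a dp_level_scheme \<Rightarrow> nat \<Rightarrow> nat \<Rightarrow> witness set \<Rightarrow> witness set" where
  "intro_edge_set A u v S = (\<Union>w\<in>S. intro_edge A u v w)"

definition join_set :: "'a dp_level_scheme \<Rightarrow> witness set \<Rightarrow> witness set \<Rightarrow> witness set" where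
  "join_set A S S' = (\<Union>w\<in>S. \<Union>w'\<in>S'. join A w w')"

primrec dyn :: "'a dp_level_scheme \<Rightarrow> itd \<Rightarrow> witness set" where
  "dyn A Leaf = leaf A"
| "dyn A (IntroVertex u \<tau>) = clean A (intro_vertex_set A u (dyn A \<tau>))"
| "dyn A (ForgetVertex u \<tau>) = clean A (forget_vertex_set A u (dyn A \<tau>))"
| "dyn A (IntroEdge u v \<tau>) = clean A (intro_edge_set A u v (dyn A \<tau>))"
| "dyn A (Join \<sigma> \<tau>) = clean A (join_set A (dyn A \<sigma>) (dyn A \<tau>))"

definition has_final :: "'a dp_level_scheme \<Rightarrow> witness set \<Rightarrow> bool" where
  "has_final A S \<longleftrightarrow> S \<inter> final A \<noteq> {}"

definition accepts :: "'a dp_level_scheme \<Rightarrow> itd \<Rightarrow> bool" where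
  "accepts A \<tau> \<longleftrightarrow> has_final A (dyn A \<tau>)"

definition graph_property :: "(nat \<Rightarrow> 'a dp_level_scheme) \<Rightarrow> mgraph set" where
  "graph_property D =
     {G. graph G \<and> (\<exists>k \<tau>. legal k \<tau> \<and> accepts (D k) \<tau> \<and> isomorphic G (graph_of \<tau>))}"

definition finite_core :: "(nat \<Rightarrow> 'a dp_level_scheme) \<Rightarrow> bool" where
  "finite_core D \<longleftrightarrow> (\<forall>k. finite (wit (D k)))"

definition identity_cleaning :: "(nat \<Rightarrow> 'a dp_level_scheme) \<Rightarrow> bool" where
  "identity_cleaning D \<longleftrightarrow> (\<forall>k S. fin_sub S (wit (D k)) \<longrightarrow> clean (D k) S = S)"

definition coherent :: "(nat \<Rightarrow> 'a dp_level_scheme) \<Rightarrow> bool" where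
  "coherent D \<longleftrightarrow>
     (\<forall>k k' \<tau> \<tau>'. legal k \<tau> \<and> legal k' \<tau>' \<and> isomorphic (graph_of \<tau>) (graph_of \<tau>') \<longrightarrow>
        (accepts (D k) \<tau> \<longleftrightarrow> accepts (D k') \<tau>'))"

section \<open>Witness labels and witness actions\<close>

record sym_level = dp_level +
  lbl :: "witness \<Rightarrow> nat set"
  act :: "(nat \<rightharpoonup> nat) \<Rightarrow> witness \<Rightarrow> witness option"

definition lbl_set :: "'a sym_level_scheme \<Rightarrow> witness set \<Rightarrow> nat set" where
  "lbl_set A S = (\<Union>w\<in>S. lbl A w)"

definition interface_respecting :: "(nat \<Rightarrow> 'a sym_level_scheme) \<Rightarrow> bool" where
  "interface_respecting D \<longleftrightarrow> (\<forall>k. let A = D k in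
     (\<forall>w\<in>wit A. lbl A w \<subseteq> labels k) \<and>
     lbl_set A (leaf A) = {} \<and>
     (\<forall>b S S'. b \<subseteq> labels k \<and> fin_sub S (wit A) \<and> fin_sub S' (wit A) \<and>
         lbl_set A S \<subseteq> b \<and> lbl_set A S' \<subseteq> b \<longrightarrow>
       (\<forall>u\<in>labels k - b. lbl_set A (intro_vertex_set A u S) \<subseteq> b \<union> {u}) \<and>
       (\<forall>u\<in>b. lbl_set A (forget_vertex_set A u S) \<subseteq> b - {u}) \<and>
       (\<forall>u\<in>b. \<forall>v\<in>b. u \<noteq> v \<longrightarrow> lbl_set A (intro_edge_set A u v S) \<subseteq> b) \<and>
       lbl_set A (join_set A S S') \<subseteq> b \<and>
       lbl_set A (clean A S) \<subseteq> b))"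

definition relabelings :: "nat \<Rightarrow> (nat \<rightharpoonup> nat) set" where
  "relabelings k = {f. dom f \<subseteq> labels k \<and> ran f \<subseteq> labels k \<and> inj_on f (dom f)}"

definition map_inv :: "(nat \<rightharpoonup> nat) \<Rightarrow> (nat \<rightharpoonup> nat)" where
  "map_inv f = (\<lambda>y. if y \<in> ran f then Some (THE x. f x = Some y) else None)"

definition act_set ::
    "'a sym_level_scheme \<Rightarrow> (nat \<rightharpoonup> nat) \<Rightarrow> witness set \<Rightarrow> witness set" where
  "act_set A f S = {w'. \<exists>w\<in>S. act A f w = Some w'}"

text \<open>
  The equations for the transitions are required whenever both of their sides are defined.
\<close>

definition witness_action :: "nat \<Rightarrow> 'a sym_level_scheme \<Rightarrow> bool" where
  "witness_action k A \<longleftrightarrow>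
     (\<forall>f\<in>relabelings k. \<forall>w\<in>wit A. act A f w \<noteq> None \<longleftrightarrow> lbl A w \<subseteq> dom f) \<and>
     (\<forall>f\<in>relabelings k. \<forall>w\<in>wit A. \<forall>w'. act A f w = Some w' \<longrightarrow>
        w' \<in> wit A \<and>
        (w' \<in> final A \<longleftrightarrow> w \<in> final A) \<and>
        lbl A w' = (the \<circ> f) ` lbl A w \<and>
        act A (map_inv f) w' = Some w) \<and>
     (\<forall>f\<in>relabelings k. \<forall>f'\<in>relabelings k. \<forall>w\<in>wit A.
        act A (f \<circ>\<^sub>m f') w = Option.bind (act A f' w) (act A f)) \<and>
     (\<forall>f\<in>relabelings k. \<forall>f'\<in>relabelings k. \<forall>w\<in>wit A.
        f \<subseteq>\<^sub>m f' \<and> lbl A w \<subseteq> dom f \<longrightarrow> act A f' w = act A f w) \<and>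
     (\<forall>f\<in>relabelings k. \<forall>w\<in>wit A. \<forall>u\<in>dom f.
        lbl A w \<subseteq> dom f \<and> lbl_set A (intro_vertex A u w) \<subseteq> dom f \<longrightarrow>
        act_set A f (intro_vertex A u w) = intro_vertex A (the (f u)) (the (act A f w))) \<and>
     (\<forall>f\<in>relabelings k. \<forall>w\<in>wit A. \<forall>u\<in>dom f.
        lbl A w \<subseteq> dom f \<and> lbl_set A (forget_vertex A u w) \<subseteq> dom f \<longrightarrow>
        act_set A f (forget_vertex A u w) = forget_vertex A (the (f u)) (the (act A f w))) \<and>
     (\<forall>f\<in>relabelings k. \<forall>w\<in>wit A. \<forall>u\<in>dom f. \<forall>v\<in>dom f.
        u \<noteq> v \<and> lbl A w \<subseteq> dom f \<and> lbl_set A (intro_edge A u v w) \<subseteq> dom f \<longrightarrow>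
        act_set A f (intro_edge A u v w) =
          intro_edge A (the (f u)) (the (f v)) (the (act A f w))) \<and>
     (\<forall>f\<in>relabelings k. \<forall>w\<in>wit A. \<forall>w'\<in>wit A.
        lbl A w \<subseteq> dom f \<and> lbl A w' \<subseteq> dom f \<and> lbl_set A (join A w w') \<subseteq> dom f \<longrightarrow>
        act_set A f (join A w w') = join A (the (act A f w)) (the (act A f w')))"

section \<open>Triples and canonical forms\<close>

type_synonym triple = "nat set \<times> witness set \<times> witness set"

definition well_formed :: "nat \<Rightarrow> sym_level \<Rightarrow> sym_level \<Rightarrow> triple \<Rightarrow> bool" where
  "well_formed k A1 A2 = (\<lambda>(b, S1, S2).
     b \<subseteq> labels k \<and> fin_sub S1 (wit A1) \<and> fin_sub S2 (wit A2) \<and>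
     lbl_set A1 S1 \<subseteq> b \<and> lbl_set A2 S2 \<subseteq> b)"

definition sat_premise :: "sym_level \<Rightarrow> triple \<Rightarrow> bool" where
  "sat_premise A1 = (\<lambda>(b, S1, S2). has_final A1 S1)"

definition inconsistent :: "sym_level \<Rightarrow> sym_level \<Rightarrow> triple \<Rightarrow> bool" where
  "inconsistent A1 A2 = (\<lambda>(b, S1, S2). has_final A1 S1 \<and> \<not> has_final A2 S2)"

definition act_triple :: "sym_level \<Rightarrow> sym_level \<Rightarrow> (nat \<rightharpoonup> nat) \<Rightarrow> triple \<Rightarrow> triple" where
  "act_triple A1 A2 f = (\<lambda>(b, S1, S2). ((the \<circ> f) ` b, act_set A1 f S1, act_set A2 f S2))"

definition enum_by :: "witness rel \<Rightarrow> witness set \<Rightarrow> witness list" where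
  "enum_by r S = (THE xs. set xs = S \<and> distinct xs \<and> sorted_wrt (\<lambda>x y. (x, y) \<in> r) xs)"

definition triple_less :: "witness rel \<Rightarrow> witness rel \<Rightarrow> triple rel" where
  "triple_less r1 r2 =
     inv_image (lexord {(x, y). x < y} <*lex*> lexord (r1 - Id) <*lex*> lexord (r2 - Id))
       (\<lambda>(b, S1, S2). (sorted_list_of_set b, enum_by r1 S1, enum_by r2 S2))"

definition can ::
    "nat \<Rightarrow> sym_level \<Rightarrow> sym_level \<Rightarrow> witness rel \<Rightarrow> witness rel \<Rightarrow> triple \<Rightarrow> triple" where
  "can k A1 A2 r1 r2 t =
     (let T = {act_triple A1 A2 f t | f. f \<in> relabelings k \<and> dom f = fst t}
      in THE x. x \<in> T \<and> (\<forall>y\<in>T. x = y \<or> (x, y) \<in> triple_less r1 r2))"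

definition canonical ::
    "nat \<Rightarrow> sym_level \<Rightarrow> sym_level \<Rightarrow> witness rel \<Rightarrow> witness rel \<Rightarrow> triple \<Rightarrow> bool" where
  "canonical k A1 A2 r1 r2 t \<longleftrightarrow> well_formed k A1 A2 t \<and> can k A1 A2 r1 r2 t = t"

section \<open>The premise-pruned breadth-first search\<close>

definition join_triples ::
    "sym_level \<Rightarrow> sym_level \<Rightarrow> (nat \<rightharpoonup> nat) \<Rightarrow> triple \<Rightarrow> triple \<Rightarrow> triple" where
  "join_triples A1 A2 \<pi> = (\<lambda>(b, S1, S2) (b', S1', S2').
     (b, join_set A1 S1 (act_set A1 \<pi> S1'), join_set A2 S2 (act_set A2 \<pi> S2')))"

definition unary_successors :: "nat \<Rightarrow> sym_level \<Rightarrow> sym_level \<Rightarrow> triple \<Rightarrow> triple set" where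
  "unary_successors k A1 A2 = (\<lambda>(b, S1, S2).
     {(b \<union> {u}, intro_vertex_set A1 u S1, intro_vertex_set A2 u S2) | u. u \<in> labels k - b} \<union>
     {(b - {u}, forget_vertex_set A1 u S1, forget_vertex_set A2 u S2) | u. u \<in> b} \<union>
     {(b, intro_edge_set A1 u v S1, intro_edge_set A2 u v S2) | u v. u \<in> b \<and> v \<in> b \<and> u \<noteq> v})"

definition join_successors ::
    "nat \<Rightarrow> sym_level \<Rightarrow> sym_level \<Rightarrow> triple list \<Rightarrow> triple \<Rightarrow> triple set" where
  "join_successors k A1 A2 R t =
     (\<Union>t'\<in>{t'\<in>set R. sat_premise A1 t' \<and> fst t' = fst t}.
      \<Union>\<pi>\<in>{\<pi>\<in>relabelings k. dom \<pi> = fst t \<and> ran \<pi> = fst t}.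
        {join_triples A1 A2 \<pi> t t', join_triples A1 A2 \<pi> t' t})"

definition enqueue ::
    "(triple \<Rightarrow> triple) \<Rightarrow> triple list \<times> triple set \<Rightarrow> triple \<Rightarrow> triple list \<times> triple set" where
  "enqueue c = (\<lambda>(Y, Seen) X.
     if c X \<in> Seen then (Y, Seen) else (Y @ [c X], insert (c X) Seen))"

datatype outcome = Inclusion_Holds | Trace "triple list"

text \<open>
  A running search consists of the list of processed triples, the queue and the seen triples.
\<close>

datatype config =
    Running "triple list" "triple list" "triple set"
  | Returned outcome

text \<open>
  The order in which the successors of a triple are generated is left open: \<open>Xs\<close> below is an
  arbitrary list of them. The current triple has already been appended to the processed
  triples when join partners are collected, so it is also joined with itself.
\<close>

inductive bfs_step ::
    "nat \<Rightarrow> sym_level \<Rightarrow> sym_level \<Rightarrow> witness rel \<Rightarrow> witness rel \<Rightarrow> config \<Rightarrow> config \<Rightarrow> bool"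
  for k A1 A2 r1 r2 where
  finish: "bfs_step k A1 A2 r1 r2 (Running R [] Seen) (Returned Inclusion_Holds)"
| stop: "inconsistent A1 A2 t \<Longrightarrow>
    bfs_step k A1 A2 r1 r2 (Running R (t # Y) Seen) (Returned (Trace (R @ [t])))"
| prune: "\<not> sat_premise A1 t \<Longrightarrow>
    bfs_step k A1 A2 r1 r2 (Running R (t # Y) Seen) (Running (R @ [t]) Y Seen)"
| expand: "sat_premise A1 t \<Longrightarrow> \<not> inconsistent A1 A2 t \<Longrightarrow>
    set Xs = unary_successors k A1 A2 t \<union> join_successors k A1 A2 (R @ [t]) t \<Longrightarrow>
    foldl (enqueue (can k A1 A2 r1 r2)) (Y, Seen) Xs = (Y', Seen') \<Longrightarrow>
    bfs_step k A1 A2 r1 r2 (Running R (t # Y) Seen) (Running (R @ [t]) Y' Seen')"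

definition bfs_init ::
    "nat \<Rightarrow> sym_level \<Rightarrow> sym_level \<Rightarrow> witness rel \<Rightarrow> witness rel \<Rightarrow> config" where
  "bfs_init k A1 A2 r1 r2 =
     (let t = can k A1 A2 r1 r2 ({}, leaf A1, leaf A2) in Running [] [t] {t})"

definition bfs_returns ::
    "nat \<Rightarrow> sym_level \<Rightarrow> sym_level \<Rightarrow> witness rel \<Rightarrow> witness rel \<Rightarrow> outcome \<Rightarrow> bool" where
  "bfs_returns k A1 A2 r1 r2 out \<longleftrightarrow>
     (bfs_step k A1 A2 r1 r2)\<^sup>*\<^sup>* (bfs_init k A1 A2 r1 r2) (Returned out)"

text \<open>
  Termination: there is no infinite run, and a run can only come to a halt by returning.
\<close>

definition bfs_terminates ::
    "nat \<Rightarrow> sym_level \<Rightarrow> sym_level \<Rightarrow> witness rel \<Rightarrow> witness rel \<Rightarrow> bool" where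
  "bfs_terminates k A1 A2 r1 r2 \<longleftrightarrow>
     \<not> (\<exists>c. c 0 = bfs_init k A1 A2 r1 r2 \<and> (\<forall>i::nat. bfs_step k A1 A2 r1 r2 (c i) (c (Suc i)))) \<and>
     (\<forall>c. (bfs_step k A1 A2 r1 r2)\<^sup>*\<^sup>* (bfs_init k A1 A2 r1 r2) c \<and>
        \<not> (\<exists>c'. bfs_step k A1 A2 r1 r2 c c') \<longrightarrow> (\<exists>out. c = Returned out))"

end

theory Submission
  imports Defs "HOL-Combinatorics.Permutations"
begin

text \<open>
  Associate with a legal term \<open>\<tau>\<close> the triple of its bag and its two dynamizations. A permutation of
  the labels acts on this triple by relabelling \<open>\<tau>\<close>, so the orbit of the triple consists of triples
  of relabelled terms, and so does every canonical form. Hence every triple found by the search is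
  the triple of a legal term; if it is inconsistent, the graph of the term, which has treewidth at
  most \<open>k\<close>, separates the two properties.

  Conversely, a graph of treewidth at most \<open>k\<close> that separates the properties is the graph of a legal
  term, and by coherence that term is accepted by the first core and rejected by the second. Graphs
  of subterms embed into the graph of the term, so by subgraph-closure all subterms satisfy the
  premise and pruning never cuts them off: by induction the canonical form of the triple of each
  subterm is processed. At a join, the canonical forms of both operands have the same bag, and their
  relabellings \<open>p\<close> and \<open>q\<close> differ by the permutation \<open>p \<circ> inv q\<close> of that bag, which the search tries.

  The search terminates because there are only finitely many well-formed triples and each of them is
  processed at most once.
\<close>

section \<open>Tree decompositions glued from bags\<close>

text \<open>Two obstacles shape the proof. A relabelling \<open>f\<close> of a bag does not say what
  to do with labels forgotten deeper in the term, and the equations for transitions are granted only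
  where both sides are defined. Both disappear when \<open>f\<close> is extended to a permutation of
  all of \<open>labels k\<close>: the permutation renames a whole term and has every label in its
  domain. As the witnesses of a dynamization carry only labels of the bag, \<open>f\<close> and its
  extension act alike on them. The other obstacle is treewidth, which is defined by trees with
  unique simple paths. It is recast inductively by \<open>glued_bags\<close>, where rooted trees of
  bags arise from single bags by joining two trees at their roots. A term yields such a tree, with
  the labelled vertices as root bag. Conversely, a term is built for every injective labelling of
  the root bag; the labelling has to be arbitrary because the two operands of a join must agree on
  it. The k + 1 labels suffice because bags have at most k + 1 elements.\<close>

lemma simple_path_Cons:
  "simple_path F a b (c # p) \<longleftrightarrow>
     c = a \<and> (p = [] \<and> a = b \<or> p \<noteq> [] \<and> a \<notin> set p \<and> (a, hd p) \<in> F \<and> simple_path F (hd p) b p)"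
  by (cases p) (auto simp: simple_path_def)

lemma simple_path_imp_rtrancl:
  "simple_path F a b p \<Longrightarrow> (a, b) \<in> F\<^sup>*"
proof (induction p arbitrary: a)
  case Nil
  then show ?case by (simp add: simple_path_def)
next
  case (Cons c p)
  then show ?case
    by (auto simp: simple_path_Cons intro: converse_rtrancl_into_rtrancl)
qed

text \<open>Loop erasure: if the new start \<open>a\<close> already lies on the path, the part
  before that occurrence is dropped.\<close>

lemma rtrancl_imp_simple_path:
  assumes "(a, b) \<in> F\<^sup>*"
  shows "\<exists>p. simple_path F a b p"
  using assms
proof (induction rule: converse_rtrancl_induct)
  case base
  have "simple_path F b b [b]" by (simp add: simple_path_def)
  then show ?case by blast
next
  case (step a c)
  then obtain p where p: "simple_path F c b p" by blast
  show ?case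
  proof (cases "a \<in> set p")
    case True
    then obtain q r where qr: "p = q @ a # r" by (meson split_list)
    have "simple_path F a b (a # r)"
      using p unfolding qr simple_path_def by (auto simp: successively_append_iff)
    then show ?thesis by blast
  next
    case False
    have "p \<noteq> []" "hd p = c" using p by (auto simp: simple_path_def)
    then have "simple_path F a b (a # p)"
      using p False step(1) by (auto simp: simple_path_Cons)
    then show ?thesis by blast
  qed
qed

lemma simple_path_mono:
  "simple_path F a b p \<Longrightarrow> F \<subseteq> F' \<Longrightarrow> simple_path F' a b p"
  unfolding simple_path_def by (auto intro: successively_mono)

lemma simple_path_subset:
  "simple_path F a b p \<Longrightarrow> F \<subseteq> N \<times> N \<Longrightarrow> a \<in> N \<Longrightarrow> set p \<subseteq> N"
proof (induction p arbitrary: a)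
  case (Cons c p)
  then show ?case by (fastforce simp: simple_path_Cons)
qed simp

lemma simple_path_hd_last_in:
  "simple_path F a b p \<Longrightarrow> a \<in> set p" "simple_path F a b p \<Longrightarrow> b \<in> set p"
  unfolding simple_path_def by auto

lemma simple_path_append:
  assumes "simple_path F a x p" "simple_path F y b q" "(x, y) \<in> F" "set p \<inter> set q = {}"
  shows "simple_path F a b (p @ q)"
  using assms unfolding simple_path_def by (auto simp: successively_append_iff)

text \<open>Separates existence of paths from their uniqueness. Existence becomes plain
  reachability, which composes without any care for repeated nodes.\<close>

lemma tree_iff:
  "tree N F \<longleftrightarrow> finite N \<and> N \<noteq> {} \<and> F \<subseteq> N \<times> N \<and> sym F \<and> irrefl F \<and>
     (\<forall>x\<in>N. \<forall>y\<in>N. (x, y) \<in> F\<^sup>*) \<and>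
     (\<forall>x\<in>N. \<forall>y\<in>N. \<forall>p q. simple_path F x y p \<and> simple_path F x y q \<longrightarrow> p = q)"
proof -
  have "(\<exists>!p. simple_path F x y p) \<longleftrightarrow>
      (x, y) \<in> F\<^sup>* \<and> (\<forall>p q. simple_path F x y p \<and> simple_path F x y q \<longrightarrow> p = q)" for x y
    using simple_path_imp_rtrancl[of F x y] rtrancl_imp_simple_path[of x y F] by blast
  then show ?thesis unfolding tree_def by (simp only:) blast
qed

text \<open>Some edge leaves \<open>x\<close>, since \<open>x\<close> reaches another node. Deleting
  this edge leaves two components, one around each of its ends.\<close>

lemma tree_split_edge:
  assumes T: "tree N F" and x: "x \<in> N" and ne: "N \<noteq> {x}"
  obtains y N1 F1 N2 F2 where
    "tree N1 F1" "tree N2 F2" "x \<in> N1" "y \<in> N2" "N1 \<inter> N2 = {}" "N = N1 \<union> N2"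
    "(x, y) \<in> F" "F1 \<subseteq> F" "F2 \<subseteq> F"
proof -
  from T have fin: "finite N" and sub: "F \<subseteq> N \<times> N" and sy: "sym F" and ir: "irrefl F"
    and con: "\<And>a b. a \<in> N \<Longrightarrow> b \<in> N \<Longrightarrow> (a, b) \<in> F\<^sup>*"
    and uni: "\<And>a b p q. a \<in> N \<Longrightarrow> b \<in> N \<Longrightarrow> simple_path F a b p \<Longrightarrow> simple_path F a b q \<Longrightarrow> p = q"
    unfolding tree_iff by blast+
  obtain z where "z \<in> N" "z \<noteq> x" using ne x by blast
  then obtain y where xy: "(x, y) \<in> F" using con[OF x] by (metis converse_rtranclE)
  define F' where "F' = F - {(x, y), (y, x)}"
  have sy': "sym F'" using sy unfolding F'_def sym_def by blast
  have symr: "(b, a) \<in> F'\<^sup>*" if "(a, b) \<in> F'\<^sup>*" for a b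
    using sym_rtrancl[OF sy'] that by (simp add: sym_def)
  define N1 where "N1 = {z. (x, z) \<in> F'\<^sup>*}"
  define N2 where "N2 = {z. (y, z) \<in> F'\<^sup>*}"
  have N: "N = N1 \<union> N2"
  proof
    show "N \<subseteq> N1 \<union> N2"
    proof
      fix z assume "z \<in> N"
      from con[OF x this] show "z \<in> N1 \<union> N2"
      proof (induction rule: rtrancl_induct)
        case base
        show ?case by (simp add: N1_def)
      next
        case (step a b)
        show ?case
        proof (cases "(a, b) \<in> F'")
          case True
          then show ?thesis using step.IH unfolding N1_def N2_def
            by (auto intro: rtrancl_into_rtrancl)
        next
          case False
          then have "b = x \<or> b = y" using step.hyps unfolding F'_def by blast
          then show ?thesis by (auto simp: N1_def N2_def)
        qed
      qed
    qed
    have "F'\<^sup>* \<subseteq> F\<^sup>*" by (intro rtrancl_mono) (simp add: F'_def)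
    moreover have "(a, b) \<in> F\<^sup>* \<Longrightarrow> a \<in> N \<Longrightarrow> b \<in> N" for a b
      by (induction rule: rtrancl_induct) (use sub in auto)
    ultimately show "N1 \<union> N2 \<subseteq> N" using x xy sub unfolding N1_def N2_def by blast
  qed
  have yN: "y \<in> N" using xy sub by blast
  \<comment> \<open>A connection that avoids the deleted edge would give a second simple path from
    \<open>x\<close> to \<open>y\<close> besides \<open>[x, y]\<close>.\<close>
  have disj: "N1 \<inter> N2 = {}"
  proof (rule ccontr)
    assume "N1 \<inter> N2 \<noteq> {}"
    then have "(x, y) \<in> F'\<^sup>*" unfolding N1_def N2_def using symr by (blast intro: rtrancl_trans)
    then obtain p where p: "simple_path F' x y p" using rtrancl_imp_simple_path by blast
    have "simple_path F x y [x, y]" using xy ir by (auto simp: simple_path_def irrefl_def)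
    moreover have "simple_path F x y p" using p by (rule simple_path_mono) (simp add: F'_def)
    ultimately have "p = [x, y]" using uni[OF x yN] by blast
    then show False using p by (simp add: simple_path_def F'_def)
  qed
  \<comment> \<open>Stated for the component of an arbitrary node \<open>c\<close>, so that it
    serves both ends of the deleted edge.\<close>
  have part: "tree M (F' \<inter> M \<times> M)"
    if M: "M = {z. (c, z) \<in> F'\<^sup>*}" and MN: "M \<subseteq> N" for M c
  proof -
    have reach: "(c, z) \<in> (F' \<inter> M \<times> M)\<^sup>*" if "(c, z) \<in> F'\<^sup>*" for z
      using that
    proof (induction rule: rtrancl_induct)
      case (step a b)
      then have "(a, b) \<in> F' \<inter> M \<times> M" unfolding M by (auto intro: rtrancl_into_rtrancl)
      then show ?case using step.IH by (rule rtrancl_into_rtrancl[rotated])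
    qed simp
    have sM: "sym (F' \<inter> M \<times> M)" using sy' unfolding sym_def by blast
    have "(a, b) \<in> (F' \<inter> M \<times> M)\<^sup>*" if "a \<in> M" "b \<in> M" for a b
      using reach[of a] reach[of b] that sym_rtrancl[OF sM] unfolding M
      by (auto simp: sym_def intro: rtrancl_trans)
    moreover have "p = q" if "a \<in> M" "b \<in> M" "simple_path (F' \<inter> M \<times> M) a b p"
        "simple_path (F' \<inter> M \<times> M) a b q" for a b p q
      using uni[of a b p q] that MN simple_path_mono[of "F' \<inter> M \<times> M" a b _ F]
      unfolding F'_def by blast
    moreover have "c \<in> M" by (simp add: M)
    moreover have "irrefl (F' \<inter> M \<times> M)" using ir unfolding F'_def irrefl_def by blast
    ultimately show ?thesis using sM finite_subset[OF MN fin] unfolding tree_iff by blast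
  qed
  show thesis
  proof
    show "tree N1 (F' \<inter> N1 \<times> N1)" using part N1_def N by blast
    show "tree N2 (F' \<inter> N2 \<times> N2)" using part N2_def N by blast
    show "x \<in> N1" "y \<in> N2" by (simp_all add: N1_def N2_def)
  qed (use disj N xy F'_def in auto)
qed

text \<open>
  \<open>glued_bags V C B\<close>: some rooted tree of bags has vertex set \<open>V\<close>, set of bags \<open>C\<close> and root bag \<open>B\<close>.
  Two trees are merged by an edge between their roots, and the connectivity condition on bags
  becomes the condition \<open>V1 \<inter> V2 = B1 \<inter> B2\<close>.
\<close>

inductive glued_bags :: "nat set \<Rightarrow> nat set set \<Rightarrow> nat set \<Rightarrow> bool" where
  single: "glued_bags B {B} B"
| merge: "glued_bags V1 C1 B1 \<Longrightarrow> glued_bags V2 C2 B2 \<Longrightarrow> V1 \<inter> V2 = B1 \<inter> B2 \<Longrightarrow>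
    glued_bags (V1 \<union> V2) (C1 \<union> C2) B1"

lemma glued_bags_Union: "glued_bags V C B \<Longrightarrow> V = \<Union>C \<and> B \<in> C"
  by (induction rule: glued_bags.induct) auto

text \<open>Needed at a join, where the vertices of both operands are renamed into the glued
  graph.\<close>

lemma glued_bags_image:
  "glued_bags V C B \<Longrightarrow> inj_on f V \<Longrightarrow> glued_bags (f ` V) ((`) f ` C) (f ` B)"
proof (induction rule: glued_bags.induct)
  case (single B)
  then show ?case by (auto intro: glued_bags.single)
next
  case (merge V1 C1 B1 V2 C2 B2)
  have "B1 \<subseteq> V1" "B2 \<subseteq> V2" using merge.hyps glued_bags_Union by blast+
  then have "f ` V1 \<inter> f ` V2 = f ` B1 \<inter> f ` B2"
    using merge.hyps(3) merge.prems
    by (metis inj_on_image_Int le_supI1 le_supI2 sup_ge1 sup_ge2)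
  then show ?case
    using glued_bags.merge[of "f ` V1" _ "f ` B1" "f ` V2"] merge.IH merge.prems
    by (simp add: image_Un inj_on_Un)
qed

text \<open>Connectivity is assumed in terms of paths because this form passes to subtrees: a path
  of a subtree is a path of the whole tree. The induction cuts the tree at an edge of the
  root.\<close>

lemma tree_imp_glued_bags:
  assumes "tree N F" and "x \<in> N"
    and "\<And>a b p z. a \<in> N \<Longrightarrow> simple_path F a b p \<Longrightarrow> z \<in> set p \<Longrightarrow> \<beta> a \<inter> \<beta> b \<subseteq> \<beta> z"
  shows "glued_bags (\<Union>(\<beta> ` N)) (\<beta> ` N) (\<beta> x)"
  using assms
proof (induction "card N" arbitrary: N F x rule: less_induct)
  case less
  show ?case
  proof (cases "N = {x}")
    case True
    then show ?thesis by (simp add: glued_bags.single)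
  next
    case False
    then obtain y N1 F1 N2 F2 where
      T: "tree N1 F1" "tree N2 F2" "x \<in> N1" "y \<in> N2" "N1 \<inter> N2 = {}" "N = N1 \<union> N2"
      "(x, y) \<in> F" "F1 \<subseteq> F" "F2 \<subseteq> F"
      using tree_split_edge[OF less.prems(1,2)] by metis
    have fin: "finite N" using less.prems(1) by (simp add: tree_def)
    have "N1 \<subset> N" "N2 \<subset> N" using T(3-6) by blast+
    then have "card N1 < card N" "card N2 < card N" using fin by (auto intro: psubset_card_mono)
    have 1: "glued_bags (\<Union>(\<beta> ` N1)) (\<beta> ` N1) (\<beta> x)"
      by (rule less.hyps[OF \<open>card N1 < card N\<close> T(1,3)])
        (use less.prems(3) T(6,8) simple_path_mono in blast)
    have 2: "glued_bags (\<Union>(\<beta> ` N2)) (\<beta> ` N2) (\<beta> y)"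
      by (rule less.hyps[OF \<open>card N2 < card N\<close> T(2,4)])
        (use less.prems(3) T(6,9) simple_path_mono in blast)
    \<comment> \<open>The path from \<open>a\<close> to \<open>b\<close> runs through
      \<open>x\<close> and \<open>y\<close>, so what the two bags share lies in both root bags. This
      is the side condition of \<open>merge\<close>.\<close>
    have "\<beta> a \<inter> \<beta> b \<subseteq> \<beta> x \<inter> \<beta> y" if ab: "a \<in> N1" "b \<in> N2" for a b
    proof -
      obtain p q where p: "simple_path F1 a x p" and q: "simple_path F2 y b q"
        using T(1-4) ab unfolding tree_def by blast
      have "set p \<subseteq> N1" "set q \<subseteq> N2"
        using simple_path_subset p q T(1,2,4) ab unfolding tree_def by blast+
      then have "simple_path F a b (p @ q)"
        using T(5,7-9) p q by (blast intro: simple_path_append simple_path_mono)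
      then show ?thesis
        using less.prems(3)[of a b "p @ q"] ab T(6) simple_path_hd_last_in[OF p] simple_path_hd_last_in[OF q]
        by (metis Int_greatest UnCI set_append)
    qed
    then have "\<Union>(\<beta> ` N1) \<inter> \<Union>(\<beta> ` N2) = \<beta> x \<inter> \<beta> y" using T(3,4) by blast
    from glued_bags.merge[OF 1 2 this] show ?thesis by (simp add: T(6) image_Un)
  qed
qed

section \<open>From glued bags back to a tree decomposition\<close>

text \<open>The edge between \<open>x\<close> and \<open>y\<close> is the only bridge, so a walk in
  \<open>N2\<close> can leave it only by visiting \<open>x\<close>.\<close>

lemma successively_merge_avoiding:
  assumes "successively (\<lambda>a b. (a, b) \<in> F1 \<union> F2 \<union> {(x, y), (y, x)}) p" "p \<noteq> []" "hd p \<in> N2"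
    "x \<notin> set p" "F1 \<subseteq> N1 \<times> N1" "F2 \<subseteq> N2 \<times> N2" "N1 \<inter> N2 = {}" "x \<in> N1"
  shows "set p \<subseteq> N2 \<and> successively (\<lambda>a b. (a, b) \<in> F2) p"
  using assms
proof (induction p)
  case (Cons a p)
  then show ?case by (cases p) auto
qed simp

text \<open>A path without repetitions crosses the bridge at most once: the crossing uses up
  \<open>x\<close>, and there is no way back without it.\<close>

lemma successively_merge:
  assumes "successively (\<lambda>a b. (a, b) \<in> F1 \<union> F2 \<union> {(x, y), (y, x)}) p" "p \<noteq> []" "hd p \<in> N1"
    "distinct p" "F1 \<subseteq> N1 \<times> N1" "F2 \<subseteq> N2 \<times> N2" "N1 \<inter> N2 = {}" "x \<in> N1" "y \<in> N2"
  shows "set p \<subseteq> N1 \<and> successively (\<lambda>a b. (a, b) \<in> F1) p \<or>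
    (\<exists>q r. p = q @ r \<and> q \<noteq> [] \<and> r \<noteq> [] \<and> set q \<subseteq> N1 \<and> set r \<subseteq> N2 \<and> last q = x \<and> hd r = y \<and>
      successively (\<lambda>a b. (a, b) \<in> F1) q \<and> successively (\<lambda>a b. (a, b) \<in> F2) r)"
  using assms(1-4)
proof (induction p)
  case (Cons a p)
  show ?case
  proof (cases p)
    case Nil
    then show ?thesis using Cons.prems by simp
  next
    case (Cons c p')
    show ?thesis
    proof (cases "c \<in> N1")
      case True
      have ac: "(a, c) \<in> F1" using True Cons.prems Cons assms(6-9) by auto
      from Cons.IH Cons.prems True Cons consider
          "set p \<subseteq> N1" "successively (\<lambda>a b. (a, b) \<in> F1) p"
        | q r where "p = q @ r" "q \<noteq> []" "r \<noteq> []" "set q \<subseteq> N1" "set r \<subseteq> N2" "last q = x" "hd r = y"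
          "successively (\<lambda>a b. (a, b) \<in> F1) q" "successively (\<lambda>a b. (a, b) \<in> F2) r"
        by auto
      then show ?thesis
      proof cases
        case 1
        then show ?thesis using ac Cons Cons.prems(3) by auto
      next
        case 2
        have "hd q = c" using 2 Cons by (metis hd_append2 list.sel(1))
        then have "successively (\<lambda>a b. (a, b) \<in> F1) (a # q)"
          using 2 ac by (simp add: successively_Cons)
        then show ?thesis using 2 Cons.prems(3)
          by (intro disjI2 exI[of _ "a # q"] exI[of _ r]) auto
      qed
    next
      case False
      have ax: "a = x" "c = y" using False Cons.prems Cons assms(5-9) by auto
      have "set p \<subseteq> N2 \<and> successively (\<lambda>a b. (a, b) \<in> F2) p"
        using successively_merge_avoiding[of F1 F2 x y p N2 N1] Cons.prems Cons ax assms by auto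
      then show ?thesis using ax assms(8) Cons
        by (intro disjI2 exI[of _ "[a]"] exI[of _ p]) auto
    qed
  qed
qed simp

lemma tree_merge:
  assumes T1: "tree N1 F1" and T2: "tree N2 F2" and x: "x \<in> N1" and y: "y \<in> N2"
    and disj: "N1 \<inter> N2 = {}"
  shows "tree (N1 \<union> N2) (F1 \<union> F2 \<union> {(x, y), (y, x)})"
proof -
  define F where "F = F1 \<union> F2 \<union> {(x, y), (y, x)}"
  have FF: "F1 \<union> F2 \<union> {(x, y), (y, x)} = F" "F2 \<union> F1 \<union> {(y, x), (x, y)} = F" by (auto simp: F_def)
  note t1 = T1[unfolded tree_iff] and t2 = T2[unfolded tree_iff]
  have F: "F \<subseteq> (N1 \<union> N2) \<times> (N1 \<union> N2)" "sym F" "irrefl F"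
    using t1 t2 x y disj unfolding F_def sym_def irrefl_def by auto
  have mono: "F1\<^sup>* \<subseteq> F\<^sup>*" "F2\<^sup>* \<subseteq> F\<^sup>*" unfolding F_def by (auto intro!: rtrancl_mono)
  have xy: "(x, y) \<in> F\<^sup>*" "(y, x) \<in> F\<^sup>*" by (auto simp: F_def)
  have con: "(a, b) \<in> F\<^sup>*" if "a \<in> N1 \<union> N2" "b \<in> N1 \<union> N2" for a b
  proof -
    have "(a, x) \<in> F\<^sup>* \<and> (x, a) \<in> F\<^sup>*" if "a \<in> N1 \<union> N2" for a
    proof (cases "a \<in> N1")
      case True
      then show ?thesis using t1 x mono by blast
    next
      case False
      then have "(a, y) \<in> F2\<^sup>*" "(y, a) \<in> F2\<^sup>*" using that t2 y by blast+
      then show ?thesis using mono xy by (blast intro: rtrancl_trans)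
    qed
    then show ?thesis using that by (meson rtrancl_trans)
  qed
  \<comment> \<open>Proved for whichever of the two trees contains the start \<open>a\<close>, and
    applied twice with the roles of the trees exchanged. Cutting both paths at the bridge reduces
    uniqueness to that in each tree.\<close>
  have uni: "p = q"
    if T1: "tree M1 E1" and T2: "tree M2 E2" and x: "x \<in> M1" and y: "y \<in> M2"
      and disj: "M1 \<inter> M2 = {}" and E: "E1 \<union> E2 \<union> {(x, y), (y, x)} = F"
      and p: "simple_path F a b p" and q: "simple_path F a b q" and a: "a \<in> M1"
      for M1 M2 E1 E2 x y a b p q
  proof -
    have sub: "E1 \<subseteq> M1 \<times> M1" "E2 \<subseteq> M2 \<times> M2" using T1 T2 by (auto simp: tree_def)
    have dec: "b \<in> M1 \<and> simple_path E1 a b p \<or>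
        b \<in> M2 \<and> (\<exists>q r. p = q @ r \<and> simple_path E1 a x q \<and> simple_path E2 y b r)"
      if p: "simple_path F a b p" for p
    proof -
      have pp: "p \<noteq> []" "hd p = a" "last p = b" "distinct p"
        "successively (\<lambda>a b. (a, b) \<in> F) p"
        using p by (auto simp: simple_path_def)
      have "hd p \<in> M1" using pp a by simp
      from successively_merge[OF pp(5)[folded E] pp(1) this pp(4) sub disj x y] consider
          "set p \<subseteq> M1" "successively (\<lambda>a b. (a, b) \<in> E1) p"
        | q r where "p = q @ r" "q \<noteq> []" "r \<noteq> []" "set q \<subseteq> M1" "set r \<subseteq> M2" "last q = x" "hd r = y"
          "successively (\<lambda>a b. (a, b) \<in> E1) q" "successively (\<lambda>a b. (a, b) \<in> E2) r"
        by blast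
      then show ?thesis
      proof cases
        case 1
        then have "b \<in> M1" using pp(1,3) last_in_set by blast
        then show ?thesis using pp 1 by (simp add: simple_path_def)
      next
        case 2
        have "b \<in> M2" using 2 pp by (metis last_appendR last_in_set subsetD)
        moreover have "simple_path E1 a x q" "simple_path E2 y b r"
          using 2 pp by (auto simp: simple_path_def)
        ultimately show ?thesis using 2 by blast
      qed
    qed
    note u1 = T1[unfolded tree_iff] and u2 = T2[unfolded tree_iff]
    show ?thesis
    proof (cases "b \<in> M1")
      case True
      then have "simple_path E1 a b p" "simple_path E1 a b q" using dec p q disj by blast+
      then show ?thesis using u1 a True by blast
    next
      case False
      then obtain p1 p2 q1 q2 where "b \<in> M2" "p = p1 @ p2" "q = q1 @ q2"
        and *: "simple_path E1 a x p1" "simple_path E2 y b p2" "simple_path E1 a x q1" "simple_path E2 y b q2"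
        using dec[OF p] dec[OF q] by blast
      moreover have "p1 = q1" using u1 a x * by blast
      moreover have "p2 = q2" using u2 y * \<open>b \<in> M2\<close> by blast
      ultimately show ?thesis by simp
    qed
  qed
  have "\<forall>a\<in>N1 \<union> N2. \<forall>b\<in>N1 \<union> N2. \<forall>p q. simple_path F a b p \<and> simple_path F a b q \<longrightarrow> p = q"
    using uni[OF T1 T2 x y disj FF(1)] uni[OF T2 T1 y x _ FF(2)] disj by blast
  moreover have "\<forall>a\<in>N1 \<union> N2. \<forall>b\<in>N1 \<union> N2. (a, b) \<in> F\<^sup>*" using con by blast
  moreover have "finite (N1 \<union> N2)" "N1 \<union> N2 \<noteq> {}" using t1 t2 by simp_all
  ultimately show ?thesis unfolding FF tree_iff using F by simp
qed

text \<open>Nodes are numbers, and the two subtrees of a merge need disjoint node sets. The finite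
  set \<open>Z\<close> of forbidden nodes is carried through the induction to make this
  possible.\<close>

lemma glued_bags_imp_tree:
  assumes "glued_bags V C B" and "finite Z"
  shows "\<exists>N F \<beta> x. tree N F \<and> N \<inter> Z = {} \<and> x \<in> N \<and> \<beta> x = B \<and> \<beta> ` N = C \<and>
    (\<forall>v. \<forall>a\<in>N. \<forall>b\<in>N. v \<in> \<beta> a \<and> v \<in> \<beta> b \<longrightarrow> (a, b) \<in> (Restr F {z\<in>N. v \<in> \<beta> z})\<^sup>*)"
  using assms
proof (induction arbitrary: Z rule: glued_bags.induct)
  case (single B)
  obtain x :: nat where x: "x \<notin> Z" using single ex_new_if_finite infinite_UNIV_nat by blast
  have "simple_path {} a b p \<Longrightarrow> p = [a]" for a b p
    by (cases p; cases "tl p") (auto simp: simple_path_def)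
  then have "tree {x} {}" unfolding tree_iff by (auto simp: sym_def irrefl_def) metis
  then show ?case using x by (intro exI[of _ "{x}"] exI[of _ "{}"] exI[of _ "\<lambda>_. B"] exI[of _ x]) auto
next
  case (merge V1 C1 B1 V2 C2 B2)
  from merge.IH(1)[OF merge.prems] obtain N1 F1 \<beta>1 x where
    1: "tree N1 F1" "N1 \<inter> Z = {}" "x \<in> N1" "\<beta>1 x = B1" "\<beta>1 ` N1 = C1"
    "\<And>v a b. a \<in> N1 \<Longrightarrow> b \<in> N1 \<Longrightarrow> v \<in> \<beta>1 a \<Longrightarrow> v \<in> \<beta>1 b \<Longrightarrow>
      (a, b) \<in> (Restr F1 {z\<in>N1. v \<in> \<beta>1 z})\<^sup>*" by blast
  \<comment> \<open>The second tree must avoid the nodes of the first one as well.\<close>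
  have "finite (Z \<union> N1)" using merge.prems 1(1) by (simp add: tree_def)
  from merge.IH(2)[OF this] obtain N2 F2 \<beta>2 y where
    2: "tree N2 F2" "N2 \<inter> (Z \<union> N1) = {}" "y \<in> N2" "\<beta>2 y = B2" "\<beta>2 ` N2 = C2"
    "\<And>v a b. a \<in> N2 \<Longrightarrow> b \<in> N2 \<Longrightarrow> v \<in> \<beta>2 a \<Longrightarrow> v \<in> \<beta>2 b \<Longrightarrow>
      (a, b) \<in> (Restr F2 {z\<in>N2. v \<in> \<beta>2 z})\<^sup>*" by blast
  define F where "F = F1 \<union> F2 \<union> {(x, y), (y, x)}"
  define N where "N = N1 \<union> N2"
  define \<beta> where "\<beta> = (\<lambda>z. if z \<in> N1 then \<beta>1 z else \<beta>2 z)"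
  have disj: "N1 \<inter> N2 = {}" using 2(2) by blast
  have \<beta>1: "\<beta> z = \<beta>1 z" if "z \<in> N1" for z using that by (simp add: \<beta>_def)
  have \<beta>2: "\<beta> z = \<beta>2 z" if "z \<in> N2" for z using that disj by (auto simp: \<beta>_def)
  have T: "tree N F" unfolding N_def F_def using tree_merge 1 2 disj by blast
  have img: "\<beta> ` N = C1 \<union> C2"
    using 1(5) 2(5) \<beta>1 \<beta>2 by (simp add: N_def image_Un)
  have con: "(a, b) \<in> (Restr F {z\<in>N. v \<in> \<beta> z})\<^sup>*"
    if ab: "a \<in> N" "b \<in> N" "v \<in> \<beta> a" "v \<in> \<beta> b" for v a b
  proof -
    let ?R = "Restr F {z\<in>N. v \<in> \<beta> z}"
    have "Restr F1 {z\<in>N1. v \<in> \<beta>1 z} \<subseteq> ?R" "Restr F2 {z\<in>N2. v \<in> \<beta>2 z} \<subseteq> ?R"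
      using \<beta>1 \<beta>2 by (auto simp: F_def N_def)
    then have mono: "(Restr F1 {z\<in>N1. v \<in> \<beta>1 z})\<^sup>* \<subseteq> ?R\<^sup>*" "(Restr F2 {z\<in>N2. v \<in> \<beta>2 z})\<^sup>* \<subseteq> ?R\<^sup>*"
      by (simp_all add: rtrancl_mono)
    have same: "(c, d) \<in> ?R\<^sup>*"
      if "c \<in> N1 \<and> d \<in> N1 \<or> c \<in> N2 \<and> d \<in> N2" "v \<in> \<beta> c" "v \<in> \<beta> d" for c d
      using that 1(6)[of c d v] 2(6)[of c d v] mono \<beta>1 \<beta>2 by auto
    \<comment> \<open>A vertex that occurs in bags on both sides lies in
      \<open>V1 \<inter> V2 = B1 \<inter> B2\<close>, hence in both root bags, so the bridge
      survives the restriction to the nodes whose bag contains \<open>v\<close>.\<close>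
    have cross: "(x, y) \<in> ?R \<and> (y, x) \<in> ?R \<and> v \<in> \<beta> x \<and> v \<in> \<beta> y"
      if "c \<in> N1" "d \<in> N2" "v \<in> \<beta> c" "v \<in> \<beta> d" for c d
    proof -
      have "v \<in> V1 \<inter> V2"
        using that \<beta>1 \<beta>2 1(5) 2(5) glued_bags_Union merge.hyps(1,2) by blast
      then have "v \<in> B1 \<inter> B2" using merge.hyps(3) by simp
      then have "v \<in> \<beta> x" "v \<in> \<beta> y" using \<beta>1 \<beta>2 1(3,4) 2(3,4) by auto
      then show ?thesis using 1(3) 2(3) by (auto simp: F_def N_def)
    qed
    consider "a \<in> N1 \<and> b \<in> N1 \<or> a \<in> N2 \<and> b \<in> N2" | "a \<in> N1" "b \<in> N2" | "a \<in> N2" "b \<in> N1"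
      using ab N_def by blast
    then show ?thesis
    proof cases
      case 1
      then show ?thesis using same ab by blast
    next
      case 2
      note c = cross[OF 2 ab(3,4)]
      have "(a, x) \<in> ?R\<^sup>*" "(y, b) \<in> ?R\<^sup>*" using same c ab 2 \<open>x \<in> N1\<close> \<open>y \<in> N2\<close> by blast+
      then show ?thesis using c by (meson rtrancl_into_rtrancl rtrancl_trans)
    next
      case 3
      note c = cross[OF 3(2,1) ab(4,3)]
      have "(a, y) \<in> ?R\<^sup>*" "(x, b) \<in> ?R\<^sup>*" using same c ab 3 \<open>x \<in> N1\<close> \<open>y \<in> N2\<close> by blast+
      then show ?thesis using c by (meson rtrancl_into_rtrancl rtrancl_trans)
    qed
  qed
  have "N \<inter> Z = {}" "x \<in> N" "\<beta> x = B1" using 1 2 \<beta>1 by (auto simp: N_def)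
  then show ?case using T img con by blast
qed

lemma treewidth_at_most_iff_glued_bags:
  "treewidth_at_most k G \<longleftrightarrow>
    (\<exists>C B. glued_bags (verts G) C B \<and> (\<forall>c\<in>C. card c \<le> k + 1) \<and>
       (\<forall>e\<in>edges G. \<exists>c\<in>C. {v. (e, v) \<in> inc G} \<subseteq> c))"
proof
  assume "treewidth_at_most k G"
  then obtain N F \<beta> where td: "tree_decomposition G N F \<beta>" and 5: "\<forall>x\<in>N. card (\<beta> x) \<le> k + 1"
    unfolding treewidth_at_most_def by blast
  from td have T: "tree N F" and 1: "\<And>x. x \<in> N \<Longrightarrow> \<beta> x \<subseteq> verts G"
    and 2: "\<forall>v\<in>verts G. \<exists>x\<in>N. v \<in> \<beta> x" and 3: "\<forall>e\<in>edges G. \<exists>x\<in>N. {v. (e, v) \<in> inc G} \<subseteq> \<beta> x"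
    and 4: "\<And>v x y. v \<in> verts G \<Longrightarrow> x \<in> N \<Longrightarrow> y \<in> N \<Longrightarrow> v \<in> \<beta> x \<Longrightarrow> v \<in> \<beta> y \<Longrightarrow>
        (x, y) \<in> (Restr F {z\<in>N. v \<in> \<beta> z})\<^sup>*"
    unfolding tree_decomposition_def by simp_all
  obtain x where x: "x \<in> N" using T by (auto simp: tree_def)
  have "\<beta> a \<inter> \<beta> b \<subseteq> \<beta> z" if a: "a \<in> N" and p: "simple_path F a b p" and z: "z \<in> set p" for a b p z
  proof
    fix v assume v: "v \<in> \<beta> a \<inter> \<beta> b"
    have sub: "F \<subseteq> N \<times> N" using T by (simp add: tree_def)
    have b: "b \<in> N" using simple_path_subset[OF p sub a] simple_path_hd_last_in[OF p] by blast
    obtain q where q: "simple_path (Restr F {z\<in>N. v \<in> \<beta> z}) a b q"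
      using rtrancl_imp_simple_path[OF 4[of v a b]] a b v 1 by blast
    \<comment> \<open>Uniqueness of paths in the tree: the path found inside the nodes whose bag
      contains \<open>v\<close> is the given path \<open>p\<close>.\<close>
    then have "simple_path F a b q" by (rule simple_path_mono) blast
    then have "q = p" using T a b p unfolding tree_iff by blast
    moreover have "set q \<subseteq> {z\<in>N. v \<in> \<beta> z}"
      by (rule simple_path_subset[OF q]) (use a v in auto)
    ultimately show "v \<in> \<beta> z" using z by blast
  qed
  then have "glued_bags (\<Union>(\<beta> ` N)) (\<beta> ` N) (\<beta> x)"
    by (rule tree_imp_glued_bags[OF T x])
  moreover have "\<Union>(\<beta> ` N) = verts G" using 1 2 by blast
  ultimately show "\<exists>C B. glued_bags (verts G) C B \<and> (\<forall>c\<in>C. card c \<le> k + 1) \<and>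
       (\<forall>e\<in>edges G. \<exists>c\<in>C. {v. (e, v) \<in> inc G} \<subseteq> c)"
    using 3 5 by (intro exI[of _ "\<beta> ` N"] exI[of _ "\<beta> x"]) auto
next
  assume "\<exists>C B. glued_bags (verts G) C B \<and> (\<forall>c\<in>C. card c \<le> k + 1) \<and>
       (\<forall>e\<in>edges G. \<exists>c\<in>C. {v. (e, v) \<in> inc G} \<subseteq> c)"
  then obtain C B where C: "glued_bags (verts G) C B" "\<forall>c\<in>C. card c \<le> k + 1"
    "\<forall>e\<in>edges G. \<exists>c\<in>C. {v. (e, v) \<in> inc G} \<subseteq> c" by blast
  from glued_bags_imp_tree[OF C(1) finite.emptyI] obtain N F \<beta> where
    N: "tree N F" "\<beta> ` N = C"
    "\<forall>v. \<forall>a\<in>N. \<forall>b\<in>N. v \<in> \<beta> a \<and> v \<in> \<beta> b \<longrightarrow> (a, b) \<in> (Restr F {z\<in>N. v \<in> \<beta> z})\<^sup>*" by blast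
  have "verts G = \<Union>(\<beta> ` N)" using glued_bags_Union[OF C(1)] N(2) by simp
  then have "tree_decomposition G N F \<beta>"
    unfolding tree_decomposition_def using N(1)
  proof (intro conjI)
    show "\<forall>e\<in>edges G. \<exists>x\<in>N. {v. (e, v) \<in> inc G} \<subseteq> \<beta> x" using C(3) N(2) by blast
    show "\<forall>v\<in>verts G. \<forall>x\<in>N. \<forall>y\<in>N. v \<in> \<beta> x \<and> v \<in> \<beta> y \<longrightarrow>
        (x, y) \<in> (Restr F {z\<in>N. v \<in> \<beta> z})\<^sup>*" using N(3) by simp
  qed blast+
  then show "treewidth_at_most k G"
    unfolding treewidth_at_most_def using C(2) N(2) by (intro exI conjI) auto
qed

section \<open>Graphs of instructive tree decompositions\<close>

lemma fresh_notin: "finite A \<Longrightarrow> fresh A \<notin> A"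
  unfolding fresh_def by (metis LeastI ex_new_if_finite infinite_UNIV_nat)

text \<open>Distinct labels name distinct vertices. This makes the gluing map injective and keeps
  the two ends of a new edge distinct.\<close>

definition wf_labelled :: "mgraph \<Rightarrow> (nat \<rightharpoonup> nat) \<Rightarrow> bool" where
  "wf_labelled G \<theta> \<longleftrightarrow> graph G \<and> inj_on \<theta> (dom \<theta>) \<and> ran \<theta> \<subseteq> verts G"

text \<open>The local function \<open>h\<close> of \<open>glue\<close>, given a name so that lemmas
  can speak about it.\<close>

definition glue_vertex :: "(nat \<rightharpoonup> nat) \<Rightarrow> (nat \<rightharpoonup> nat) \<Rightarrow> nat \<Rightarrow> nat" where
  "glue_vertex \<theta> \<eta> x = (if x \<in> ran \<eta> then 2 * the (\<theta> (THE u. \<eta> u = Some x)) else 2 * x + 1)"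

lemma glue_eq:
  "glue (G, \<theta>) (H, \<eta>) =
     (\<lparr>verts = (\<lambda>n. 2 * n) ` verts G \<union> glue_vertex \<theta> \<eta> ` verts H,
       edges = (\<lambda>n. 2 * n) ` edges G \<union> (\<lambda>n. 2 * n + 1) ` edges H,
       inc = map_prod (\<lambda>n. 2 * n) (\<lambda>n. 2 * n) ` inc G \<union>
             map_prod (\<lambda>n. 2 * n + 1) (glue_vertex \<theta> \<eta>) ` inc H\<rparr>,
      map_option (\<lambda>n. 2 * n) \<circ> \<theta>)"
  unfolding glue_def Let_def glue_vertex_def[abs_def] prod.case ..

lemma parity_neq: "2 * a \<noteq> Suc (2 * b)" "Suc (2 * b) \<noteq> 2 * a" for a b :: nat
  by presburger+

lemma inj_on_dom_SomeD: "inj_on \<eta> (dom \<eta>) \<Longrightarrow> \<eta> u = Some x \<Longrightarrow> \<eta> v = Some x \<Longrightarrow> u = v"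
  by (rule inj_onD[of \<eta> "dom \<eta>"]) auto

lemma glue_vertex_label:
  assumes "inj_on \<eta> (dom \<eta>)" "\<eta> u = Some x"
  shows "glue_vertex \<theta> \<eta> x = 2 * the (\<theta> u)"
proof -
  have "(THE u. \<eta> u = Some x) = u"
    by (rule the_equality) (auto intro: assms(2) inj_on_dom_SomeD[OF assms(1) _ assms(2)])
  then show ?thesis using assms(2) by (auto simp: glue_vertex_def ranI)
qed

text \<open>Parity separates labelled from unlabelled vertices. Among the labelled ones, an even
  value determines the label because \<theta> is injective, and the label determines the
  vertex.\<close>

lemma inj_glue_vertex:
  assumes "inj_on \<theta> (dom \<theta>)" "inj_on \<eta> (dom \<eta>)" "dom \<theta> = dom \<eta>"
  shows "inj (glue_vertex \<theta> \<eta>)"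
proof (rule injI)
  fix x y assume eq: "glue_vertex \<theta> \<eta> x = glue_vertex \<theta> \<eta> y"
  have form: "(\<exists>u a. \<eta> u = Some z \<and> \<theta> u = Some a \<and> glue_vertex \<theta> \<eta> z = 2 * a) \<or>
      glue_vertex \<theta> \<eta> z = 2 * z + 1" for z
  proof (cases "z \<in> ran \<eta>")
    case True
    then obtain u where u: "\<eta> u = Some z" by (auto simp: ran_def)
    then obtain a where "\<theta> u = Some a" using assms(3) by blast
    then show ?thesis using glue_vertex_label[OF assms(2) u, of \<theta>] u by auto
  qed (simp add: glue_vertex_def)
  from form[of x] form[of y] consider
      u a v b where "\<eta> u = Some x" "\<theta> u = Some a" "glue_vertex \<theta> \<eta> x = 2 * a"
        "\<eta> v = Some y" "\<theta> v = Some b" "glue_vertex \<theta> \<eta> y = 2 * b"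
    | a b where "glue_vertex \<theta> \<eta> x = 2 * a" "glue_vertex \<theta> \<eta> y = 2 * b + 1"
    | a b where "glue_vertex \<theta> \<eta> x = 2 * a + 1" "glue_vertex \<theta> \<eta> y = 2 * b"
    | "glue_vertex \<theta> \<eta> x = 2 * x + 1" "glue_vertex \<theta> \<eta> y = 2 * y + 1"
    by metis
  then show "x = y"
  proof cases
    case (1 u a v b)
    then have "a = b" using eq by simp
    then have "u = v" using 1 inj_on_dom_SomeD[OF assms(1)] by blast
    then show ?thesis using 1 by simp
  next
    case (2 a b)
    then show ?thesis using eq parity_neq(1)[of a b] by simp
  next
    case (3 a b)
    then show ?thesis using eq parity_neq(2)[of a b] by simp
  next
    case 4
    then show ?thesis using eq by linarith
  qed
qed

text \<open>The copies of the two operands overlap exactly in the labelled vertices: every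
  unlabelled vertex of the right operand is sent to an odd number. This supplies the intersection
  condition for merging trees of bags and the injectivity of the renaming at a join.\<close>

lemma even_glue_vertex_Int:
  assumes "inj_on \<eta> (dom \<eta>)" "dom \<theta> = dom \<eta>" "ran \<theta> \<subseteq> A" "ran \<eta> \<subseteq> B"
  shows "(\<lambda>n. 2 * n) ` A \<inter> glue_vertex \<theta> \<eta> ` B = (\<lambda>n. 2 * n) ` ran \<theta>"
    and "glue_vertex \<theta> \<eta> ` ran \<eta> = (\<lambda>n. 2 * n) ` ran \<theta>"
proof -
  show *: "glue_vertex \<theta> \<eta> ` ran \<eta> = (\<lambda>n. 2 * n) ` ran \<theta>"
  proof (intro equalityI subsetI)
    fix z assume "z \<in> glue_vertex \<theta> \<eta> ` ran \<eta>"
    then obtain u x where ux: "\<eta> u = Some x" "z = glue_vertex \<theta> \<eta> x" by (auto simp: ran_def)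
    moreover obtain a where "\<theta> u = Some a" using ux assms(2) by blast
    ultimately show "z \<in> (\<lambda>n. 2 * n) ` ran \<theta>"
      using glue_vertex_label[OF assms(1) ux(1), of \<theta>] by (auto intro: ranI)
  next
    fix z assume "z \<in> (\<lambda>n. 2 * n) ` ran \<theta>"
    then obtain u a where ua: "\<theta> u = Some a" "z = 2 * a" by (auto simp: ran_def)
    moreover obtain x where x: "\<eta> u = Some x" using ua assms(2) by blast
    ultimately have "z = glue_vertex \<theta> \<eta> x" using glue_vertex_label[OF assms(1) x, of \<theta>] by simp
    then show "z \<in> glue_vertex \<theta> \<eta> ` ran \<eta>" using x by (auto intro: ranI)
  qed
  have "z \<in> (\<lambda>n. 2 * n) ` ran \<theta>" if "z = 2 * a" "z = glue_vertex \<theta> \<eta> b" for z a b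
  proof -
    have "b \<in> ran \<eta>"
    proof (rule ccontr)
      assume "b \<notin> ran \<eta>"
      then have "2 * a = Suc (2 * b)" using that by (simp add: glue_vertex_def)
      then show False by presburger
    qed
    then show ?thesis using * that by blast
  qed
  then show "(\<lambda>n. 2 * n) ` A \<inter> glue_vertex \<theta> \<eta> ` B = (\<lambda>n. 2 * n) ` ran \<theta>"
    using * assms(3,4) by (intro equalityI subsetI) blast+
qed

lemma incident_map_prod:
  "inj g \<Longrightarrow> {v. (g e, v) \<in> map_prod g f ` I} = f ` {v. (e, v) \<in> I}"
  by (auto simp: inj_def image_iff Bex_def)

lemma bag_subset_labels: "legal k \<tau> \<Longrightarrow> bag \<tau> \<subseteq> labels k"
  by (induction \<tau>) auto

lemma finite_labels [simp]: "finite (labels k)"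
  by (simp add: labels_def)

text \<open>The parity of an edge tells its operand, so its set of ends is the image of the old one
  under an injective map and still has two elements.\<close>

lemma wf_labelled_glue:
  assumes G: "wf_labelled G \<theta>" and H: "wf_labelled H \<eta>" and dom: "dom \<theta> = dom \<eta>"
    and eq: "glue (G, \<theta>) (H, \<eta>) = (K, \<kappa>)"
  shows "wf_labelled K \<kappa>" "dom \<kappa> = dom \<theta>"
proof -
  note eq = eq[unfolded glue_eq, symmetric, simplified]
  let ?h = "glue_vertex \<theta> \<eta>"
  have inj: "inj_on \<theta> (dom \<theta>)" "inj_on \<eta> (dom \<eta>)" using G H by (auto simp: wf_labelled_def)
  have injh: "inj ?h" by (rule inj_glue_vertex[OF inj dom])
  have inje: "inj (\<lambda>n::nat. 2 * n)" "inj (\<lambda>n::nat. Suc (2 * n))" by (auto simp: inj_def)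
  show "dom \<kappa> = dom \<theta>" using eq by auto
  have gG: "graph G" and gH: "graph H" using G H by (auto simp: wf_labelled_def)
  have "card {v. (e, v) \<in> inc K} = 2" if e: "e \<in> edges K" for e
  proof -
    consider e' where "e' \<in> edges G" "e = 2 * e'" | e' where "e' \<in> edges H" "e = Suc (2 * e')"
      using e eq by auto
    then show ?thesis
    proof cases
      case 1
      have "{v. (e, v) \<in> inc K} = {v. (2 * e', v) \<in> map_prod (\<lambda>n. 2 * n) (\<lambda>n. 2 * n) ` inc G}"
        using 1 eq parity_neq by auto
      also have "\<dots> = (\<lambda>n. 2 * n) ` {v. (e', v) \<in> inc G}" by (rule incident_map_prod[OF inje(1)])
      finally show ?thesis
        using 1 gG inje(1) by (simp add: graph_def card_image inj_on_subset)
    next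
      case 2
      have "{v. (e, v) \<in> inc K} = {v. (Suc (2 * e'), v) \<in> map_prod (\<lambda>n. Suc (2 * n)) ?h ` inc H}"
        using 2 eq parity_neq by auto
      also have "\<dots> = ?h ` {v. (e', v) \<in> inc H}" by (rule incident_map_prod[OF inje(2)])
      finally show ?thesis
        using 2 gH injh by (simp add: graph_def card_image inj_on_subset)
    qed
  qed
  moreover have "inc K \<subseteq> edges K \<times> verts K" using eq gG gH by (auto simp: graph_def)
  moreover have "finite (verts K)" "finite (edges K)" using eq gG gH by (auto simp: graph_def)
  ultimately have "graph K" by (simp add: graph_def)
  moreover have "inj_on \<kappa> (dom \<kappa>)"
    using eq inj_on_dom_SomeD[OF inj(1)] by (auto simp: inj_on_def)
  moreover have "ran \<kappa> \<subseteq> verts K" using eq G by (auto simp: wf_labelled_def ran_def)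
  ultimately show "wf_labelled K \<kappa>" by (simp add: wf_labelled_def)
qed

lemma wf_labelled_graph:
  "legal k \<tau> \<Longrightarrow> labelled_graph \<tau> = (G, \<theta>) \<Longrightarrow> wf_labelled G \<theta> \<and> dom \<theta> = bag \<tau>"
proof (induction \<tau> arbitrary: G \<theta>)
  case Leaf
  then show ?case by (auto simp: wf_labelled_def graph_def)
next
  case (IntroVertex u \<tau>)
  obtain H \<eta> where H: "labelled_graph \<tau> = (H, \<eta>)" by fastforce
  have IH: "wf_labelled H \<eta>" "dom \<eta> = bag \<tau>" using IntroVertex H by auto
  let ?x = "fresh (verts H)"
  have x: "?x \<notin> verts H" using IH by (intro fresh_notin) (simp add: wf_labelled_def graph_def)
  have G: "G = H\<lparr>verts := insert ?x (verts H)\<rparr>" "\<theta> = \<eta>(u \<mapsto> ?x)"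
    using IntroVertex.prems H by (auto simp: Let_def)
  have "graph G" using IH by (auto simp: wf_labelled_def graph_def G)
  moreover have u: "u \<notin> dom \<eta>" using IntroVertex.prems IH by simp
  have "inj_on \<theta> (dom \<theta>)"
    using IH x u unfolding G wf_labelled_def
    by (auto simp: inj_on_def dom_def ran_def split: if_splits)
  moreover have "ran \<theta> \<subseteq> verts G" using IH u by (auto simp: G wf_labelled_def ran_def split: if_splits)
  moreover have "dom \<theta> = insert u (bag \<tau>)" using IH by (simp add: G)
  ultimately show ?case by (simp add: wf_labelled_def)
next
  case (ForgetVertex u \<tau>)
  obtain H \<eta> where H: "labelled_graph \<tau> = (H, \<eta>)" by fastforce
  then have IH: "wf_labelled H \<eta>" "dom \<eta> = bag \<tau>" using ForgetVertex by auto
  have G: "G = H" "\<theta> = \<eta>(u := None)" using ForgetVertex.prems H by (auto simp: Let_def)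
  show ?case using IH unfolding G wf_labelled_def
    by (auto simp: inj_on_def ran_def dom_def split: if_splits)
next
  case (IntroEdge u v \<tau>)
  obtain H \<eta> where H: "labelled_graph \<tau> = (H, \<eta>)" by fastforce
  then have IH: "wf_labelled H \<eta>" "dom \<eta> = bag \<tau>" using IntroEdge by auto
  let ?e = "fresh (edges H)"
  have e: "?e \<notin> edges H" using IH by (intro fresh_notin) (simp add: wf_labelled_def graph_def)
  have "u \<in> dom \<eta>" "v \<in> dom \<eta>" using IntroEdge.prems IH(2) by auto
  then obtain a b where ab: "\<eta> u = Some a" "\<eta> v = Some b" by blast
  have "a \<noteq> b" using ab IH IntroEdge.prems inj_on_dom_SomeD[of \<eta> u a v] by (auto simp: wf_labelled_def)
  have abv: "a \<in> verts H" "b \<in> verts H" using IH ab by (auto simp: wf_labelled_def ran_def)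
  have G: "G = H\<lparr>edges := insert ?e (edges H), inc := inc H \<union> {(?e, a), (?e, b)}\<rparr>" "\<theta> = \<eta>"
    using IntroEdge.prems H ab by (auto simp: Let_def)
  have g: "graph H" using IH by (simp add: wf_labelled_def)
  have "{w. (?e, w) \<in> inc G} = {a, b}" using e g by (auto simp: G graph_def)
  moreover have "{w. (e', w) \<in> inc G} = {w. (e', w) \<in> inc H}" if "e' \<in> edges H" for e'
    using that e by (auto simp: G)
  ultimately have "graph G" using g \<open>a \<noteq> b\<close> abv by (auto simp: graph_def G)
  then show ?case using IH by (simp add: wf_labelled_def G)
next
  case (Join \<sigma> \<tau>)
  obtain G1 \<theta>1 G2 \<theta>2 where l: "labelled_graph \<sigma> = (G1, \<theta>1)" "labelled_graph \<tau> = (G2, \<theta>2)"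
    by fastforce
  then have IH: "wf_labelled G1 \<theta>1" "dom \<theta>1 = bag \<sigma>" "wf_labelled G2 \<theta>2" "dom \<theta>2 = bag \<tau>"
    using Join by auto
  then show ?case using wf_labelled_glue[OF IH(1,3)] Join.prems l by simp
qed

lemma graph_graph_of: "legal k \<tau> \<Longrightarrow> graph (graph_of \<tau>)"
  using wf_labelled_graph[of k \<tau>] unfolding graph_of_def wf_labelled_def
  by (metis prod.collapse)

section \<open>Graphs of subterms embed into the graph of the term\<close>

text \<open>The identity embeds. As embeddings also reflect incidence, a new edge must not reuse an
  old identifier; legality gives a finite edge set and hence freshness.\<close>

lemma embeds_unary:
  "embeds (graph_of \<tau>) (graph_of (IntroVertex u \<tau>))"
  "embeds (graph_of \<tau>) (graph_of (ForgetVertex u \<tau>))"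
  "legal k \<tau> \<Longrightarrow> embeds (graph_of \<tau>) (graph_of (IntroEdge u v \<tau>))"
proof -
  obtain H \<eta> where H: "labelled_graph \<tau> = (H, \<eta>)" by fastforce
  show "embeds (graph_of \<tau>) (graph_of (IntroVertex u \<tau>))"
    "embeds (graph_of \<tau>) (graph_of (ForgetVertex u \<tau>))"
    unfolding embeds_def graph_of_def using H
    by (auto simp: Let_def intro!: exI[of _ id])
  assume "legal k \<tau>"
  then have "fresh (edges H) \<notin> edges H"
    using wf_labelled_graph[OF _ H] by (intro fresh_notin) (auto simp: wf_labelled_def graph_def)
  then show "embeds (graph_of \<tau>) (graph_of (IntroEdge u v \<tau>))"
    unfolding embeds_def graph_of_def using H
    by (intro exI[of _ id]) (auto simp: Let_def)
qed

text \<open>Edges of the two operands differ in parity, so an edge of one copy acquires no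
  incidences from the other, even at identified vertices.\<close>

lemma embeds_Join:
  assumes "legal k (Join \<sigma> \<tau>)"
  shows "embeds (graph_of \<sigma>) (graph_of (Join \<sigma> \<tau>))" "embeds (graph_of \<tau>) (graph_of (Join \<sigma> \<tau>))"
proof -
  obtain G \<theta> H \<eta> where l: "labelled_graph \<sigma> = (G, \<theta>)" "labelled_graph \<tau> = (H, \<eta>)"
    by fastforce
  have "legal k \<sigma>" "legal k \<tau>" "bag \<sigma> = bag \<tau>" using assms by simp_all
  then have wf: "wf_labelled G \<theta>" "wf_labelled H \<eta>" "dom \<theta> = dom \<eta>"
    using wf_labelled_graph[OF _ l(1)] wf_labelled_graph[OF _ l(2)] by metis+
  have injh: "inj (glue_vertex \<theta> \<eta>)" using wf by (intro inj_glue_vertex) (auto simp: wf_labelled_def)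
  show "embeds (graph_of \<sigma>) (graph_of (Join \<sigma> \<tau>))"
    unfolding embeds_def graph_of_def
    by (intro exI[of _ "\<lambda>n. 2 * n"]) (auto simp: l glue_eq inj_on_def parity_neq)
  show "embeds (graph_of \<tau>) (graph_of (Join \<sigma> \<tau>))"
    unfolding embeds_def graph_of_def
    by (rule exI[of _ "glue_vertex \<theta> \<eta>"], rule exI[of _ "\<lambda>n. 2 * n + 1"])
      (use parity_neq in \<open>auto simp: l glue_eq inj_on_def inj_eq[OF injh]\<close>)
qed

section \<open>The graph of a term has bounded treewidth\<close>

lemma ran_eq_image_dom: "ran f = (the \<circ> f) ` dom f"
  by (force simp: ran_def image_iff)

lemma card_ran_le:
  assumes "dom \<theta> \<subseteq> labels k"
  shows "card (ran \<theta>) \<le> k + 1"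
proof -
  have "card (ran \<theta>) \<le> card (dom \<theta>)"
    unfolding ran_eq_image_dom using finite_subset[OF assms] by (simp add: card_image_le)
  also have "\<dots> \<le> card (labels k)" using assms by (simp add: card_mono)
  finally show ?thesis by (simp add: labels_def)
qed

text \<open>Keeping the labelled vertices as root bag makes every operation local: introducing or
  forgetting a vertex puts one new bag on top, a new edge has both ends in the root bag already, and
  a join merges two trees whose root bags coincide after gluing.\<close>

lemma labelled_graph_glued_bags:
  assumes "legal k \<tau>" "labelled_graph \<tau> = (G, \<theta>)"
  shows "\<exists>C. glued_bags (verts G) C (ran \<theta>) \<and> (\<forall>c\<in>C. card c \<le> k + 1) \<and>
    (\<forall>e\<in>edges G. \<exists>c\<in>C. {v. (e, v) \<in> inc G} \<subseteq> c)"
  using assms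
proof (induction \<tau> arbitrary: G \<theta>)
  case Leaf
  then show ?case using glued_bags.single[of "{}"] by fastforce
next
  case (IntroVertex u \<tau>)
  obtain H \<eta> where H: "labelled_graph \<tau> = (H, \<eta>)" by fastforce
  let ?x = "fresh (verts H)"
  have G: "G = H\<lparr>verts := insert ?x (verts H)\<rparr>" "\<theta> = \<eta>(u \<mapsto> ?x)"
    using IntroVertex.prems H by (auto simp: Let_def)
  from IntroVertex H obtain C where C: "glued_bags (verts H) C (ran \<eta>)" "\<forall>c\<in>C. card c \<le> k + 1"
    "\<forall>e\<in>edges H. \<exists>c\<in>C. {v. (e, v) \<in> inc H} \<subseteq> c" by fastforce
  have wf: "wf_labelled H \<eta>" "dom \<eta> = bag \<tau>" using wf_labelled_graph[OF _ H] IntroVertex.prems by auto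
  have x: "?x \<notin> verts H" using wf by (intro fresh_notin) (simp add: wf_labelled_def graph_def)
  have u: "u \<notin> dom \<eta>" using wf IntroVertex.prems by simp
  have ran: "ran \<theta> = insert ?x (ran \<eta>)" using u by (auto simp: G)
  have "ran \<theta> \<inter> verts H = ran \<theta> \<inter> ran \<eta>" using x wf by (auto simp: ran wf_labelled_def)
  from glued_bags.merge[OF glued_bags.single C(1) this]
  have "glued_bags (verts G) ({ran \<theta>} \<union> C) (ran \<theta>)"
    using glued_bags_Union[OF C(1)] by (simp add: G(1)) (simp add: ran insert_absorb Un_absorb1 Union_upper)
  moreover have "card (ran \<theta>) \<le> k + 1"
    using IntroVertex.prems wf bag_subset_labels[of k \<tau>] by (intro card_ran_le) (auto simp: G)
  ultimately show ?case using C by (intro exI[of _ "{ran \<theta>} \<union> C"]) (auto simp: G(1))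
next
  case (ForgetVertex u \<tau>)
  obtain H \<eta> where H: "labelled_graph \<tau> = (H, \<eta>)" by fastforce
  have G: "G = H" "\<theta> = \<eta>(u := None)" using ForgetVertex.prems H by (auto simp: Let_def)
  from ForgetVertex H obtain C where C: "glued_bags (verts H) C (ran \<eta>)" "\<forall>c\<in>C. card c \<le> k + 1"
    "\<forall>e\<in>edges H. \<exists>c\<in>C. {v. (e, v) \<in> inc H} \<subseteq> c" by fastforce
  have sub: "ran \<theta> \<subseteq> ran \<eta>" by (auto simp: G ran_def)
  have subV: "ran \<eta> \<subseteq> verts H" using glued_bags_Union[OF C(1)] by blast
  have "ran \<theta> \<inter> verts H = ran \<theta> \<inter> ran \<eta>" using sub subV by blast
  from glued_bags.merge[OF glued_bags.single C(1) this]
  have "glued_bags (verts G) ({ran \<theta>} \<union> C) (ran \<theta>)"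
    using sub subV by (simp add: G(1) Un_absorb1)
  moreover have "dom \<eta> = bag \<tau>" using wf_labelled_graph[OF _ H] ForgetVertex.prems by auto
  then have "card (ran \<theta>) \<le> k + 1"
    using ForgetVertex.prems bag_subset_labels[of k \<tau>] by (intro card_ran_le) (auto simp: G)
  ultimately show ?case using C by (intro exI[of _ "{ran \<theta>} \<union> C"]) (auto simp: G(1))
next
  case (IntroEdge u v \<tau>)
  obtain H \<eta> where H: "labelled_graph \<tau> = (H, \<eta>)" by fastforce
  let ?e = "fresh (edges H)"
  have G: "G = H\<lparr>edges := insert ?e (edges H), inc := inc H \<union> {(?e, the (\<eta> u)), (?e, the (\<eta> v))}\<rparr>"
    "\<theta> = \<eta>"
    using IntroEdge.prems H by (auto simp: Let_def)
  from IntroEdge H obtain C where C: "glued_bags (verts H) C (ran \<eta>)" "\<forall>c\<in>C. card c \<le> k + 1"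
    "\<forall>e\<in>edges H. \<exists>c\<in>C. {v. (e, v) \<in> inc H} \<subseteq> c" by fastforce
  have wf: "wf_labelled H \<eta>" "dom \<eta> = bag \<tau>" using wf_labelled_graph[OF _ H] IntroEdge.prems by auto
  have e: "?e \<notin> edges H" using wf by (intro fresh_notin) (simp add: wf_labelled_def graph_def)
  have "u \<in> dom \<eta>" "v \<in> dom \<eta>" using IntroEdge.prems wf(2) by auto
  then have "the (\<eta> u) \<in> ran \<eta>" "the (\<eta> v) \<in> ran \<eta>" by (auto intro: ranI)
  moreover have "{w. (?e, w) \<in> inc G} = {the (\<eta> u), the (\<eta> v)}"
    using e wf by (auto simp: G graph_def wf_labelled_def)
  ultimately have "{w. (?e, w) \<in> inc G} \<subseteq> ran \<eta>" by simp
  moreover have "ran \<eta> \<in> C" using glued_bags_Union[OF C(1)] by blast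
  moreover have "{w. (e', w) \<in> inc G} = {w. (e', w) \<in> inc H}" if "e' \<in> edges H" for e'
    using that e by (auto simp: G)
  ultimately have "\<forall>e\<in>edges G. \<exists>c\<in>C. {v. (e, v) \<in> inc G} \<subseteq> c"
    using C(3) by (auto simp: G(1))
  then show ?case using C by (auto simp: G intro!: exI[of _ C])
next
  case (Join \<sigma> \<tau>)
  obtain G1 \<theta>1 G2 \<theta>2 where l: "labelled_graph \<sigma> = (G1, \<theta>1)" "labelled_graph \<tau> = (G2, \<theta>2)"
    by fastforce
  have "legal k \<sigma>" "legal k \<tau>" "bag \<sigma> = bag \<tau>" using Join.prems by simp_all
  then have wf: "wf_labelled G1 \<theta>1" "wf_labelled G2 \<theta>2" "dom \<theta>1 = dom \<theta>2"
    using wf_labelled_graph[OF _ l(1)] wf_labelled_graph[OF _ l(2)] by metis+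
  from Join l obtain C1 where C1: "glued_bags (verts G1) C1 (ran \<theta>1)" "\<forall>c\<in>C1. card c \<le> k + 1"
    "\<forall>e\<in>edges G1. \<exists>c\<in>C1. {v. (e, v) \<in> inc G1} \<subseteq> c" by fastforce
  from Join l obtain C2 where C2: "glued_bags (verts G2) C2 (ran \<theta>2)" "\<forall>c\<in>C2. card c \<le> k + 1"
    "\<forall>e\<in>edges G2. \<exists>c\<in>C2. {v. (e, v) \<in> inc G2} \<subseteq> c" by fastforce
  have eq: "G = \<lparr>verts = (\<lambda>n. 2 * n) ` verts G1 \<union> glue_vertex \<theta>1 \<theta>2 ` verts G2,
       edges = (\<lambda>n. 2 * n) ` edges G1 \<union> (\<lambda>n. 2 * n + 1) ` edges G2,
       inc = map_prod (\<lambda>n. 2 * n) (\<lambda>n. 2 * n) ` inc G1 \<union>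
             map_prod (\<lambda>n. 2 * n + 1) (glue_vertex \<theta>1 \<theta>2) ` inc G2\<rparr>"
    "\<theta> = map_option (\<lambda>n. 2 * n) \<circ> \<theta>1"
    using Join.prems l by (simp_all add: glue_eq)
  let ?h = "glue_vertex \<theta>1 \<theta>2" and ?d = "\<lambda>n::nat. 2 * n"
  have injh: "inj ?h" using wf by (intro inj_glue_vertex) (auto simp: wf_labelled_def)
  have injd: "inj ?d" "inj (\<lambda>n::nat. 2 * n + 1)" by (auto simp: inj_def)
  have Int: "?d ` verts G1 \<inter> ?h ` verts G2 = ?d ` ran \<theta>1" and ran: "?h ` ran \<theta>2 = ?d ` ran \<theta>1"
    using even_glue_vertex_Int[of \<theta>2 \<theta>1 "verts G1" "verts G2"] wf unfolding wf_labelled_def by blast+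
  have "glued_bags (?d ` verts G1) ((`) ?d ` C1) (?d ` ran \<theta>1)"
    using glued_bags_image[OF C1(1)] injd(1) inj_on_subset by blast
  moreover have "glued_bags (?h ` verts G2) ((`) ?h ` C2) (?d ` ran \<theta>1)"
    using glued_bags_image[OF C2(1), of ?h] injh inj_on_subset unfolding ran by blast
  ultimately have "glued_bags (verts G) ((`) ?d ` C1 \<union> (`) ?h ` C2) (?d ` ran \<theta>1)"
    using glued_bags.merge Int by (simp add: eq)
  moreover have "ran \<theta> = ?d ` ran \<theta>1" by (auto simp: eq ran_def)
  moreover have "\<forall>c\<in>(`) ?d ` C1 \<union> (`) ?h ` C2. card c \<le> k + 1"
    using C1(2) C2(2) injd(1) injh by (auto simp: card_image inj_on_subset)
  moreover have "\<exists>c\<in>(`) ?d ` C1 \<union> (`) ?h ` C2. {v. (e, v) \<in> inc G} \<subseteq> c" if e: "e \<in> edges G" for e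
  proof -
    consider e' where "e' \<in> edges G1" "e = ?d e'" | e' where "e' \<in> edges G2" "e = 2 * e' + 1"
      using e eq by auto
    then show ?thesis
    proof cases
      case 1
      have "{v. (e, v) \<in> inc G} = {v. (?d e', v) \<in> map_prod ?d ?d ` inc G1}"
        using 1 eq parity_neq by auto
      also have "\<dots> = ?d ` {v. (e', v) \<in> inc G1}" by (rule incident_map_prod[OF injd(1)])
      finally have inc: "{v. (e, v) \<in> inc G} = ?d ` {v. (e', v) \<in> inc G1}" .
      obtain c where "c \<in> C1" "{v. (e', v) \<in> inc G1} \<subseteq> c" using 1 C1(3) by blast
      then show ?thesis unfolding inc by (intro bexI[of _ "?d ` c"]) (auto simp: image_mono)
    next
      case 2
      have "{v. (e, v) \<in> inc G} = {v. (2 * e' + 1, v) \<in> map_prod (\<lambda>n. 2 * n + 1) ?h ` inc G2}"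
        using 2 eq parity_neq by auto
      also have "\<dots> = ?h ` {v. (e', v) \<in> inc G2}" by (rule incident_map_prod[OF injd(2)])
      finally have inc: "{v. (e, v) \<in> inc G} = ?h ` {v. (e', v) \<in> inc G2}" .
      obtain c where "c \<in> C2" "{v. (e', v) \<in> inc G2} \<subseteq> c" using 2 C2(3) by blast
      then show ?thesis unfolding inc by (intro bexI[of _ "?h ` c"]) (auto simp: image_mono)
    qed
  qed
  ultimately show ?case by (intro exI[of _ "(`) ?d ` C1 \<union> (`) ?h ` C2"]) simp
qed

lemma treewidth_graph_of:
  assumes "legal k \<tau>"
  shows "treewidth_at_most k (graph_of \<tau>)"
proof -
  obtain G \<theta> where l: "labelled_graph \<tau> = (G, \<theta>)" by fastforce
  then have "graph_of \<tau> = G" by (simp add: graph_of_def)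
  then show ?thesis
    unfolding treewidth_at_most_iff_glued_bags
    using labelled_graph_glued_bags[OF assms l] by auto
qed

section \<open>Graphs of bounded treewidth have instructive tree decompositions\<close>

text \<open>The vertices and edges of \<open>G\<close> keep their own names while the graph of the
  term is a renamed copy, so that different parts of one fixed graph can be compared directly. The
  equation for \<open>inc H\<close> describes the copy completely and is easy to maintain when
  \<open>f\<close> and \<open>g\<close> are updated.\<close>

definition realizable :: "nat \<Rightarrow> mgraph \<Rightarrow> (nat \<rightharpoonup> nat) \<Rightarrow> bool" where
  "realizable k G \<theta> \<longleftrightarrow> inc G \<subseteq> edges G \<times> verts G \<and> ran \<theta> \<subseteq> verts G \<and>
     (\<exists>\<tau> H f g. legal k \<tau> \<and> labelled_graph \<tau> = (H, map_option f \<circ> \<theta>) \<and>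
        bij_betw f (verts G) (verts H) \<and> bij_betw g (edges G) (edges H) \<and>
        inc H = map_prod g f ` inc G)"

lemma realizable_empty: "realizable k \<lparr>verts = {}, edges = {}, inc = {}\<rparr> Map.empty"
  unfolding realizable_def
  by (auto intro!: exI[of _ Leaf] simp: fun_eq_iff bij_betw_def)

section \<open>Realizability is preserved by the operations on terms\<close>

lemma realizableE:
  assumes "realizable k G \<theta>"
  obtains \<tau> H f g where "inc G \<subseteq> edges G \<times> verts G" "ran \<theta> \<subseteq> verts G" "legal k \<tau>"
    "labelled_graph \<tau> = (H, map_option f \<circ> \<theta>)" "dom \<theta> = bag \<tau>"
    "bij_betw f (verts G) (verts H)" "bij_betw g (edges G) (edges H)"
    "inc H = map_prod g f ` inc G" "wf_labelled H (map_option f \<circ> \<theta>)"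
proof -
  from assms obtain \<tau> H f g where r: "inc G \<subseteq> edges G \<times> verts G" "ran \<theta> \<subseteq> verts G" "legal k \<tau>"
    and l: "labelled_graph \<tau> = (H, map_option f \<circ> \<theta>)" and b: "bij_betw f (verts G) (verts H)"
    "bij_betw g (edges G) (edges H)" "inc H = map_prod g f ` inc G"
    unfolding realizable_def by (elim conjE exE) (rule that, assumption+)
  from wf_labelled_graph[OF r(3) l] have wf: "wf_labelled H (map_option f \<circ> \<theta>)" "dom (map_option f \<circ> \<theta>) = bag \<tau>"
    by blast+
  then have "dom \<theta> = bag \<tau>" by (auto simp: dom_def)
  then show thesis using r l b wf(1) by (intro that)
qed

lemma map_prod_image_cong:
  assumes "I \<subseteq> E \<times> V" "\<And>e. e \<in> E \<Longrightarrow> g e = g' e" "\<And>v. v \<in> V \<Longrightarrow> f v = f' v"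
  shows "map_prod g f ` I = map_prod g' f' ` I"
  using assms by (intro image_cong) auto

lemma realizable_intro_vertex:
  assumes "realizable k G \<theta>" and u: "u \<in> labels k" "u \<notin> dom \<theta>" and x: "x \<notin> verts G"
  shows "realizable k (G\<lparr>verts := insert x (verts G)\<rparr>) (\<theta>(u \<mapsto> x))"
proof -
  from assms(1) obtain \<tau> H f g where r: "inc G \<subseteq> edges G \<times> verts G" "ran \<theta> \<subseteq> verts G" "legal k \<tau>"
    "labelled_graph \<tau> = (H, map_option f \<circ> \<theta>)" "dom \<theta> = bag \<tau>"
    "bij_betw f (verts G) (verts H)" "bij_betw g (edges G) (edges H)"
    "inc H = map_prod g f ` inc G" "wf_labelled H (map_option f \<circ> \<theta>)" by (rule realizableE)
  let ?y = "fresh (verts H)"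
  have y: "?y \<notin> verts H" using r(9) by (intro fresh_notin) (simp add: wf_labelled_def graph_def)
  let ?f = "f(x := ?y)"
  have "map_option ?f (\<theta> w) = map_option f (\<theta> w)" for w
    using r(2) x by (cases "\<theta> w") (auto simp: ran_def)
  then have "(map_option f \<circ> \<theta>)(u \<mapsto> ?y) = map_option ?f \<circ> \<theta>(u \<mapsto> x)" by (auto simp: fun_eq_iff)
  then have "labelled_graph (IntroVertex u \<tau>) =
      (H\<lparr>verts := insert ?y (verts H)\<rparr>, map_option ?f \<circ> \<theta>(u \<mapsto> x))"
    by (simp add: r(4) Let_def)
  moreover have "bij_betw ?f (insert x (verts G)) (insert ?y (verts H))"
  proof -
    have "bij_betw ?f (verts G) (verts H)"
      using r(6) x by (subst bij_betw_cong[of _ _ f]) auto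
    then show ?thesis
      using bij_betw_combine[of ?f "verts G" "verts H" "{x}" "{?y}"] x y by (simp add: bij_betw_def)
  qed
  moreover have "inc H = map_prod g ?f ` inc G"
    unfolding r(8) using x by (intro map_prod_image_cong[OF r(1)]) auto
  moreover have "legal k (IntroVertex u \<tau>)" using r(3,5) u by simp
  moreover have "ran (\<theta>(u \<mapsto> x)) \<subseteq> insert x (verts G)" using r(2) by (auto simp: ran_def)
  ultimately show ?thesis
    unfolding realizable_def using r(1,7)
    by (intro conjI exI[of _ "IntroVertex u \<tau>"] exI[of _ "H\<lparr>verts := insert ?y (verts H)\<rparr>"]
        exI[of _ ?f] exI[of _ g]) auto
qed

lemma realizable_forget_vertex:
  assumes "realizable k G \<theta>" and u: "u \<in> dom \<theta>"
  shows "realizable k G (\<theta>(u := None))"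
proof -
  from assms(1) obtain \<tau> H f g where r: "inc G \<subseteq> edges G \<times> verts G" "ran \<theta> \<subseteq> verts G" "legal k \<tau>"
    "labelled_graph \<tau> = (H, map_option f \<circ> \<theta>)" "dom \<theta> = bag \<tau>"
    "bij_betw f (verts G) (verts H)" "bij_betw g (edges G) (edges H)"
    "inc H = map_prod g f ` inc G" "wf_labelled H (map_option f \<circ> \<theta>)" by (rule realizableE)
  have "(map_option f \<circ> \<theta>)(u := None) = map_option f \<circ> \<theta>(u := None)" by (auto simp: fun_eq_iff)
  then have "labelled_graph (ForgetVertex u \<tau>) = (H, map_option f \<circ> \<theta>(u := None))"
    by (simp add: r(4))
  moreover have "legal k (ForgetVertex u \<tau>)" using r(3,5) u bag_subset_labels[OF r(3)] by auto
  moreover have "ran (\<theta>(u := None)) \<subseteq> verts G" using r(2) by (auto simp: ran_def)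
  ultimately show ?thesis
    unfolding realizable_def using r(1,6-8) by blast
qed

lemma realizable_intro_edge:
  assumes "realizable k G \<theta>" and e: "e \<notin> edges G" and ab: "a \<in> ran \<theta>" "b \<in> ran \<theta>" "a \<noteq> b"
  shows "realizable k (G\<lparr>edges := insert e (edges G), inc := inc G \<union> {(e, a), (e, b)}\<rparr>) \<theta>"
proof -
  from assms(1) obtain \<tau> H f g where r: "inc G \<subseteq> edges G \<times> verts G" "ran \<theta> \<subseteq> verts G" "legal k \<tau>"
    "labelled_graph \<tau> = (H, map_option f \<circ> \<theta>)" "dom \<theta> = bag \<tau>"
    "bij_betw f (verts G) (verts H)" "bij_betw g (edges G) (edges H)"
    "inc H = map_prod g f ` inc G" "wf_labelled H (map_option f \<circ> \<theta>)" by (rule realizableE)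
  obtain u v where uv: "\<theta> u = Some a" "\<theta> v = Some b" using ab by (auto simp: ran_def)
  then have "u \<noteq> v" "u \<in> bag \<tau>" "v \<in> bag \<tau>" using ab(3) r(5) by auto
  then have leg: "legal k (IntroEdge u v \<tau>)" using r(3) bag_subset_labels[OF r(3)] by auto
  let ?d = "fresh (edges H)"
  have d: "?d \<notin> edges H" using r(9) by (intro fresh_notin) (simp add: wf_labelled_def graph_def)
  let ?g = "g(e := ?d)"
  let ?H = "H\<lparr>edges := insert ?d (edges H), inc := inc H \<union> {(?d, f a), (?d, f b)}\<rparr>"
  have l: "labelled_graph (IntroEdge u v \<tau>) = (?H, map_option f \<circ> \<theta>)"
    by (simp add: r(4) Let_def uv)
  have bij: "bij_betw ?g (insert e (edges G)) (insert ?d (edges H))"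
  proof -
    have "bij_betw ?g (edges G) (edges H)"
      using r(7) e by (subst bij_betw_cong[of _ _ g]) auto
    then show ?thesis
      using bij_betw_combine[of ?g "edges G" "edges H" "{e}" "{?d}"] e d by (simp add: bij_betw_def)
  qed
  have "inc H = map_prod ?g f ` inc G"
    unfolding r(8) using e by (intro map_prod_image_cong[OF r(1)]) auto
  then have "inc ?H = map_prod ?g f ` (inc G \<union> {(e, a), (e, b)})" by (auto simp: image_Un)
  moreover have "a \<in> verts G" "b \<in> verts G" using ab r(2) by auto
  ultimately show ?thesis
    unfolding realizable_def using r(1,2,6) leg l bij
    by (intro conjI exI[of _ "IntroEdge u v \<tau>"] exI[of _ ?H] exI[of _ f] exI[of _ ?g]) auto
qed

text \<open>The hypothesis that the parts share exactly the labelled vertices matches what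
  \<open>glue\<close> identifies. Edges are never identified, so the edge sets must be
  disjoint.\<close>

lemma realizable_join:
  assumes G: "realizable k G \<theta>" and H: "realizable k H \<theta>"
    and V: "verts G \<inter> verts H = ran \<theta>" and E: "edges G \<inter> edges H = {}"
  shows "realizable k \<lparr>verts = verts G \<union> verts H, edges = edges G \<union> edges H, inc = inc G \<union> inc H\<rparr> \<theta>"
proof -
  from G obtain \<sigma> G' f g where r: "inc G \<subseteq> edges G \<times> verts G" "ran \<theta> \<subseteq> verts G" "legal k \<sigma>"
    "labelled_graph \<sigma> = (G', map_option f \<circ> \<theta>)" "dom \<theta> = bag \<sigma>"
    "bij_betw f (verts G) (verts G')" "bij_betw g (edges G) (edges G')"
    "inc G' = map_prod g f ` inc G" "wf_labelled G' (map_option f \<circ> \<theta>)" by (rule realizableE)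
  from H obtain \<tau> H' f' g' where s: "inc H \<subseteq> edges H \<times> verts H" "ran \<theta> \<subseteq> verts H" "legal k \<tau>"
    "labelled_graph \<tau> = (H', map_option f' \<circ> \<theta>)" "dom \<theta> = bag \<tau>"
    "bij_betw f' (verts H) (verts H')" "bij_betw g' (edges H) (edges H')"
    "inc H' = map_prod g' f' ` inc H" "wf_labelled H' (map_option f' \<circ> \<theta>)" by (rule realizableE)
  let ?\<theta> = "map_option f \<circ> \<theta>" and ?\<eta> = "map_option f' \<circ> \<theta>"
  define h where "h = glue_vertex ?\<theta> ?\<eta>"
  \<comment> \<open>On a shared vertex both formulas apply. They agree there because such a vertex
    carries a label, which is what \<open>FH\<close> shows.\<close>
  define F where "F = (\<lambda>v. if v \<in> verts G then 2 * f v else h (f' v))"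
  define K where "K = (\<lambda>e. if e \<in> edges G then 2 * g e else 2 * g' e + 1)"
  have inj: "inj_on ?\<theta> (dom ?\<theta>)" "inj_on ?\<eta> (dom ?\<eta>)"
    using r(9) s(9) by (simp_all add: wf_labelled_def)
  have dom: "dom ?\<theta> = dom ?\<eta>" by (auto simp: dom_def)
  have injh: "inj h" unfolding h_def by (rule inj_glue_vertex[OF inj dom])
  have FG: "F v = 2 * f v" if "v \<in> verts G" for v using that by (simp add: F_def)
  have FH: "F v = h (f' v)" if v: "v \<in> verts H" for v
  proof (cases "v \<in> verts G")
    case True
    then obtain u where u: "\<theta> u = Some v" using V v by (auto simp: ran_def)
    then have "h (f' v) = 2 * f v"
      unfolding h_def using glue_vertex_label[OF inj(2), of u "f' v" ?\<theta>] by simp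
    then show ?thesis using True by (simp add: F_def)
  qed (simp add: F_def)
  have KG: "K e = 2 * g e" if "e \<in> edges G" for e using that by (simp add: K_def)
  have KH: "K e = 2 * g' e + 1" if "e \<in> edges H" for e using that E by (auto simp: K_def)
  have imf: "f ` verts G = verts G'" "f' ` verts H = verts H'" "g ` edges G = edges G'" "g' ` edges H = edges H'"
    using r s by (simp_all add: bij_betw_imp_surj_on)
  have injs: "inj_on f (verts G)" "inj_on f' (verts H)" "inj_on g (edges G)" "inj_on g' (edges H)"
    using r s by (simp_all add: bij_betw_imp_inj_on)
  have FGi: "F ` verts G = (\<lambda>n. 2 * n) ` verts G'"
    unfolding imf[symmetric] image_image by (rule image_cong) (simp_all add: FG)
  have FHi: "F ` verts H = h ` verts H'"
    unfolding imf[symmetric] image_image by (rule image_cong) (simp_all add: FH)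
  have KGi: "K ` edges G = (\<lambda>n. 2 * n) ` edges G'"
    unfolding imf[symmetric] image_image by (rule image_cong) (simp_all add: KG)
  have KHi: "K ` edges H = (\<lambda>n. 2 * n + 1) ` edges H'"
    unfolding imf[symmetric] image_image by (rule image_cong) (simp_all add: KH)
  have l: "labelled_graph (Join \<sigma> \<tau>) =
      (\<lparr>verts = F ` (verts G \<union> verts H), edges = K ` (edges G \<union> edges H),
        inc = map_prod K F ` (inc G \<union> inc H)\<rparr>, map_option F \<circ> \<theta>)"
  proof -
    have "map_prod (\<lambda>n. 2 * n) (\<lambda>n. 2 * n) ` inc G' = map_prod K F ` inc G"
      unfolding r(8) image_image map_prod.compositionality comp_def
      by (rule map_prod_image_cong[OF r(1)]) (simp_all add: FG KG)
    moreover have "map_prod (\<lambda>n. 2 * n + 1) h ` inc H' = map_prod K F ` inc H"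
      unfolding s(8) image_image map_prod.compositionality comp_def
      by (rule map_prod_image_cong[OF s(1)]) (simp_all add: FH KH)
    moreover have "map_option (\<lambda>n. 2 * n) (map_option f (\<theta> u)) = map_option F (\<theta> u)" for u
      using r(2) by (cases "\<theta> u") (auto simp: FG ran_def)
    then have "map_option (\<lambda>n. 2 * n) \<circ> ?\<theta> = map_option F \<circ> \<theta>" by (simp add: fun_eq_iff)
    ultimately show ?thesis
      by (simp only: labelled_graph.simps r(4) s(4) glue_eq image_Un FGi FHi KGi KHi h_def[symmetric])
  qed
  have "inj_on F (verts G \<union> verts H)"
  proof (rule inj_onI)
    \<comment> \<open>A common value of both sides lies in the overlap of the two copies and hence
      comes from a labelled vertex \<open>w\<close>, with which \<open>x\<close> and
      \<open>y\<close> both coincide.\<close>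
    have cross: "x = y" if "x \<in> verts G" "y \<in> verts H" "F x = F y" for x y
    proof -
      have "F x \<in> (\<lambda>n. 2 * n) ` verts G' \<inter> h ` verts H'" using that FGi FHi by (metis IntI imageI)
      also have "\<dots> = h ` ran ?\<eta>"
        unfolding h_def
        using even_glue_vertex_Int[OF inj(2) dom, of "verts G'" "verts H'"] r(9) s(9)
        by (simp add: wf_labelled_def)
      finally obtain z where "z \<in> ran ?\<eta>" "F x = h z" by blast
      then obtain w where w: "w \<in> ran \<theta>" "F x = h (f' w)" by (auto simp: ran_def)
      then have wV: "w \<in> verts G" "w \<in> verts H" using V by blast+
      have "f' y = f' w" using that w FH injh by (metis injD)
      then have "y = w" using wV that injs by (meson inj_onD)
      moreover have "F x = F w" using w FH wV by simp
      then have "x = w" using FG wV that injs(1) by (simp add: inj_on_eq_iff)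
      ultimately show ?thesis by simp
    qed
    fix x y assume *: "x \<in> verts G \<union> verts H" "y \<in> verts G \<union> verts H" "F x = F y"
    then consider "x \<in> verts G" "y \<in> verts G" | "x \<in> verts H" "y \<in> verts H"
      | "x \<in> verts G" "y \<in> verts H" | "x \<in> verts H" "y \<in> verts G" by blast
    then show "x = y"
    proof cases
      case 1
      then show ?thesis using * FG injs(1) by (simp add: inj_on_eq_iff)
    next
      case 2
      then show ?thesis using * FH injs(2) injh by (simp add: inj_on_eq_iff inj_eq)
    next
      case 3
      then show ?thesis using cross * by blast
    next
      case 4
      then show ?thesis using cross[of y x] * by simp
    qed
  qed
  moreover have "inj_on K (edges G \<union> edges H)"
  proof (rule inj_onI)
    fix x y assume *: "x \<in> edges G \<union> edges H" "y \<in> edges G \<union> edges H" "K x = K y"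
    then consider "x \<in> edges G" "y \<in> edges G" | "x \<in> edges H" "y \<in> edges H"
      | "x \<in> edges G" "y \<in> edges H" | "x \<in> edges H" "y \<in> edges G" by blast
    then show "x = y"
    proof cases
      case 1
      then show ?thesis using * KG injs(3) by (simp add: inj_on_eq_iff)
    next
      case 2
      then show ?thesis using * KH injs(4) by (simp add: inj_on_eq_iff)
    next
      case 3
      then show ?thesis using * KG KH parity_neq(1)[of "g x" "g' y"] by simp
    next
      case 4
      then show ?thesis using * KG KH parity_neq(2)[of "g' x" "g y"] by simp
    qed
  qed
  moreover have "legal k (Join \<sigma> \<tau>)" using r(3,5) s(3,5) by simp
  moreover have "inc G \<union> inc H \<subseteq> (edges G \<union> edges H) \<times> (verts G \<union> verts H)" using r(1) s(1) by blast
  moreover have "ran \<theta> \<subseteq> verts G \<union> verts H" using r(2) by blast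
  ultimately show ?thesis
    unfolding realizable_def using l
    by (intro conjI exI[of _ "Join \<sigma> \<tau>"] exI[of _ F] exI[of _ K] exI) (auto simp: bij_betw_def)
qed

section \<open>Building a term along glued bags\<close>

text \<open>The edge set is prescribed instead of induced: an edge that fits into bags of several
  parts must be introduced in only one of them.\<close>

definition subgraph_on :: "mgraph \<Rightarrow> nat set \<Rightarrow> nat set \<Rightarrow> mgraph" where
  "subgraph_on G V E = \<lparr>verts = V, edges = E, inc = {(e, v) \<in> inc G. e \<in> E}\<rparr>"

text \<open>\<open>IntroVertex\<close> labels only fresh vertices. The condition on
  \<open>V \<inter> ran \<theta>'\<close> therefore says that each vertex that still needs a label
  is new; the missing ones are added one by one.\<close>

lemma realizable_extend_labels:
  assumes "realizable k (subgraph_on G V E) \<theta>" "\<theta> \<subseteq>\<^sub>m \<theta>'" "dom \<theta>' \<subseteq> labels k"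
    "inj_on \<theta>' (dom \<theta>')" "V \<inter> ran \<theta>' = ran \<theta>"
  shows "realizable k (subgraph_on G (V \<union> ran \<theta>') E) \<theta>'"
  using assms
proof (induction "card (dom \<theta>' - dom \<theta>)" arbitrary: V \<theta>)
  case 0
  have "finite (dom \<theta>')" using 0(4) by (rule finite_subset) simp
  then have "dom \<theta>' \<subseteq> dom \<theta>" using 0(1) by simp
  then have "\<theta> = \<theta>'" using 0(3)
    by (metis domIff map_le_antisym map_le_def subsetD)
  then have "V \<union> ran \<theta>' = V" using 0(6) by blast
  then show ?case using 0(2) \<open>\<theta> = \<theta>'\<close> by simp
next
  case (Suc n)
  have fin: "finite (dom \<theta>')" using Suc.prems(3) by (rule finite_subset) simp
  obtain u x where u: "u \<notin> dom \<theta>" "\<theta>' u = Some x"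
    using Suc.hyps(2) by (metis DiffE card.empty domD equals0I nat.distinct(1))
  have x: "x \<notin> ran \<theta>"
  proof
    assume "x \<in> ran \<theta>"
    then obtain v where v: "\<theta> v = Some x" by (auto simp: ran_def)
    then have "\<theta>' v = Some x" using Suc.prems(2) by (metis domI map_le_def)
    then have "v = u" using u inj_on_dom_SomeD[OF Suc.prems(4)] by blast
    then show False using u v by auto
  qed
  have xr: "x \<in> ran \<theta>'" using u by (auto intro: ranI)
  then have xV: "x \<notin> V" using x Suc.prems(5) by blast
  have "realizable k (subgraph_on G (insert x V) E) (\<theta>(u \<mapsto> x))"
    using realizable_intro_vertex[OF Suc.prems(1), of u x] u xV Suc.prems(3)
    by (auto simp: subgraph_on_def)
  moreover have "n = card (dom \<theta>' - dom (\<theta>(u \<mapsto> x)))"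
  proof -
    have "dom \<theta>' - dom (\<theta>(u \<mapsto> x)) = (dom \<theta>' - dom \<theta>) - {u}" by auto
    moreover have "u \<in> dom \<theta>' - dom \<theta>" using u by blast
    ultimately show ?thesis using Suc.hyps(2) by (simp add: card_Diff_singleton)
  qed
  moreover have "\<theta>(u \<mapsto> x) \<subseteq>\<^sub>m \<theta>'" using Suc.prems(2) u by (auto simp: map_le_def)
  moreover have "ran (\<theta>(u \<mapsto> x)) = insert x (ran \<theta>)" using u by auto
  then have "insert x V \<inter> ran \<theta>' = ran (\<theta>(u \<mapsto> x))" using xr Suc.prems(5) by auto
  ultimately have "realizable k (subgraph_on G (insert x V \<union> ran \<theta>') E) \<theta>'"
    using Suc.hyps(1) Suc.prems(3,4) by blast
  moreover have "insert x V \<union> ran \<theta>' = V \<union> ran \<theta>'" using xr by blast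
  ultimately show ?case by simp
qed

lemma realizable_restrict_labels:
  assumes "realizable k G \<theta>'" "\<theta> \<subseteq>\<^sub>m \<theta>'" "finite (dom \<theta>')"
  shows "realizable k G \<theta>"
  using assms
proof (induction "card (dom \<theta>' - dom \<theta>)" arbitrary: \<theta>')
  case 0
  then have "dom \<theta>' \<subseteq> dom \<theta>" by simp
  then have "\<theta> = \<theta>'" using 0(3) by (metis domIff map_le_antisym map_le_def subsetD)
  then show ?case using 0 by simp
next
  case (Suc n)
  obtain u where u: "u \<notin> dom \<theta>" "u \<in> dom \<theta>'"
    using Suc.hyps(2) by (metis DiffE card.empty equals0I nat.distinct(1))
  have "realizable k G (\<theta>'(u := None))" using realizable_forget_vertex[OF Suc.prems(1) u(2)] .
  moreover have "\<theta> \<subseteq>\<^sub>m \<theta>'(u := None)" using Suc.prems(2) u by (auto simp: map_le_def)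
  moreover have "n = card (dom (\<theta>'(u := None)) - dom \<theta>)"
  proof -
    have "dom (\<theta>'(u := None)) - dom \<theta> = (dom \<theta>' - dom \<theta>) - {u}" by auto
    moreover have "u \<in> dom \<theta>' - dom \<theta>" using u by blast
    ultimately show ?thesis using Suc.hyps(2) by (simp add: card_Diff_singleton)
  qed
  moreover have "finite (dom (\<theta>'(u := None)))" using Suc.prems(3) by simp
  ultimately show ?case using Suc.hyps(1) by blast
qed

lemma realizable_add_edges:
  assumes "graph G" "finite E'" "realizable k (subgraph_on G V E) \<theta>" "E' \<subseteq> edges G" "E \<inter> E' = {}"
    "\<forall>e\<in>E'. {v. (e, v) \<in> inc G} \<subseteq> ran \<theta>"
  shows "realizable k (subgraph_on G V (E \<union> E')) \<theta>"
  using assms(2-)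
proof (induction E')
  case empty
  then show ?case by simp
next
  case (insert e E')
  have "card {v. (e, v) \<in> inc G} = 2" using assms(1) insert.prems by (auto simp: graph_def)
  then obtain a b where ab: "{v. (e, v) \<in> inc G} = {a, b}" "a \<noteq> b" by (auto simp: card_2_iff)
  have IH: "realizable k (subgraph_on G V (E \<union> E')) \<theta>" using insert by auto
  have "realizable k ((subgraph_on G V (E \<union> E'))\<lparr>edges := insert e (edges (subgraph_on G V (E \<union> E'))),
      inc := inc (subgraph_on G V (E \<union> E')) \<union> {(e, a), (e, b)}\<rparr>) \<theta>"
    using insert.hyps insert.prems ab
    by (intro realizable_intro_edge[OF IH]) (auto simp: subgraph_on_def)
  moreover have "{(d, v) \<in> inc G. d \<in> E \<union> E'} \<union> {(e, a), (e, b)} = {(d, v) \<in> inc G. d \<in> E \<union> insert e E'}"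
    using ab(1) by auto
  ultimately show ?case by (simp add: subgraph_on_def)
qed

text \<open>Counting: while some vertex of \<open>B\<close> has no label, fewer than
  \<open>card B\<close> labels are in use, which is at most the k + 1 available ones, so a label is
  free.\<close>

lemma ex_labelling_extension:
  assumes "inj_on \<theta> (dom \<theta>)" "dom \<theta> \<subseteq> labels k" "ran \<theta> \<subseteq> B" "finite B" "card B \<le> k + 1"
  obtains \<theta>' where "\<theta> \<subseteq>\<^sub>m \<theta>'" "inj_on \<theta>' (dom \<theta>')" "dom \<theta>' \<subseteq> labels k" "ran \<theta>' = B"
proof -
  have "\<exists>\<theta>'. \<theta> \<subseteq>\<^sub>m \<theta>' \<and> inj_on \<theta>' (dom \<theta>') \<and> dom \<theta>' \<subseteq> labels k \<and> ran \<theta>' = B"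
    using assms
  proof (induction "card (B - ran \<theta>)" arbitrary: \<theta>)
    case 0
    then have "ran \<theta> = B" by auto
    then show ?case using 0 by (intro exI[of _ \<theta>]) auto
  next
    case (Suc n)
    obtain x where x: "x \<in> B" "x \<notin> ran \<theta>"
      using Suc.hyps(2) by (metis DiffE card.empty equals0I nat.distinct(1))
    have injt: "inj_on (the \<circ> \<theta>) (dom \<theta>)" using inj_on_dom_SomeD[OF Suc.prems(1)] by (auto intro!: inj_onI)
    have "card (dom \<theta>) = card (ran \<theta>)" unfolding ran_eq_image_dom by (rule card_image[OF injt, symmetric])
    also have "\<dots> < card B" using x Suc.prems(3,4) by (intro psubset_card_mono) auto
    finally have "card (dom \<theta>) < card (labels k)" using Suc.prems(5) by (simp add: labels_def)
    then obtain u where u: "u \<in> labels k" "u \<notin> dom \<theta>"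
      using Suc.prems(2) by (metis nat_neq_iff subset_antisym subsetI)
    have ran': "ran (\<theta>(u \<mapsto> x)) = insert x (ran \<theta>)" using u by auto
    have "n = card (B - ran (\<theta>(u \<mapsto> x)))"
    proof -
      have "B - ran (\<theta>(u \<mapsto> x)) = (B - ran \<theta>) - {x}" using ran' by auto
      then show ?thesis using Suc.hyps(2) x Suc.prems(4) by simp
    qed
    moreover have "inj_on (\<theta>(u \<mapsto> x)) (dom (\<theta>(u \<mapsto> x)))"
      using Suc.prems(1) u x by (auto simp: inj_on_def dom_def ran_def split: if_splits)
    ultimately obtain \<theta>' where \<theta>': "\<theta>(u \<mapsto> x) \<subseteq>\<^sub>m \<theta>'" "inj_on \<theta>' (dom \<theta>')" "dom \<theta>' \<subseteq> labels k"
      "ran \<theta>' = B"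
      using Suc.hyps(1)[of "\<theta>(u \<mapsto> x)"] Suc.prems ran' x u by auto
    have "\<theta> \<subseteq>\<^sub>m \<theta>(u \<mapsto> x)" using u by (auto simp: map_le_def)
    then show ?case using \<theta>' map_le_trans by blast
  qed
  then show thesis using that by blast
qed

text \<open>Both the labelling and the edge set are arbitrary in the induction. At a merge, the
  labelling of the second root bag is chosen to agree with \<theta> on the common vertices, and the
  edges are divided between the two parts.\<close>

lemma glued_bags_realizable:
  assumes "glued_bags V C B" "graph G" "V \<subseteq> verts G" "\<forall>c\<in>C. card c \<le> k + 1"
    "E \<subseteq> edges G" "\<forall>e\<in>E. \<exists>c\<in>C. {v. (e, v) \<in> inc G} \<subseteq> c"
    "inj_on \<theta> (dom \<theta>)" "dom \<theta> \<subseteq> labels k" "ran \<theta> = B"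
  shows "realizable k (subgraph_on G V E) \<theta>"
  using assms
proof (induction arbitrary: E \<theta> rule: glued_bags.induct)
  case (single B)
  have "realizable k (subgraph_on G {} {}) Map.empty"
    using realizable_empty by (simp add: subgraph_on_def)
  then have "realizable k (subgraph_on G ({} \<union> ran \<theta>) {}) \<theta>"
    using single.prems by (intro realizable_extend_labels) auto
  then have "realizable k (subgraph_on G B ({} \<union> E)) \<theta>"
    using single.prems finite_subset[of E "edges G"]
    by (intro realizable_add_edges) (auto simp: graph_def)
  then show ?case by simp
next
  case (merge V1 C1 B1 V2 C2 B2)
  \<comment> \<open>An edge that fits into a bag of either part is assigned to the first, so that
    the join does not duplicate it.\<close>
  define E1 where "E1 = {e\<in>E. \<exists>c\<in>C1. {v. (e, v) \<in> inc G} \<subseteq> c}"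
  define E2 where "E2 = E - E1"
  have sub: "B1 \<subseteq> V1" "B1 \<in> C1" "B2 \<subseteq> V2" "B2 \<in> C2" using glued_bags_Union merge.hyps by blast+
  have V2: "V2 \<subseteq> verts G" using merge.prems by simp
  have finB2: "finite B2" using sub(3) V2 merge.prems(1) finite_subset by (metis graph_def)
  \<comment> \<open>The part of \<theta> on \<open>B1 \<inter> B2\<close>, the labels on which the
    two sides have to agree.\<close>
  define \<theta>0 where "\<theta>0 = \<theta> |` {u. \<exists>x\<in>B2. \<theta> u = Some x}"
  have \<theta>0: "\<theta>0 \<subseteq>\<^sub>m \<theta>" "ran \<theta>0 = B1 \<inter> B2" "inj_on \<theta>0 (dom \<theta>0)" "dom \<theta>0 \<subseteq> labels k"
  proof -
    show le: "\<theta>0 \<subseteq>\<^sub>m \<theta>" unfolding \<theta>0_def by (auto simp: map_le_def restrict_map_def)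
    show "ran \<theta>0 = B1 \<inter> B2"
      unfolding \<theta>0_def merge.prems(8)[symmetric] by (auto simp: ran_def restrict_map_def)
    show "dom \<theta>0 \<subseteq> labels k" using map_le_implies_dom_le[OF le] merge.prems(7) by blast
    show "inj_on \<theta>0 (dom \<theta>0)"
      using merge.prems(6) unfolding \<theta>0_def by (auto simp: inj_on_def restrict_map_def split: if_splits)
  qed
  obtain \<theta>2 where \<theta>2: "\<theta>0 \<subseteq>\<^sub>m \<theta>2" "inj_on \<theta>2 (dom \<theta>2)" "dom \<theta>2 \<subseteq> labels k" "ran \<theta>2 = B2"
    using ex_labelling_extension[OF \<theta>0(3,4), of B2] \<theta>0(2) finB2 merge.prems(3) sub(4) by auto
  have "\<forall>e\<in>E2. \<exists>c\<in>C2. {v. (e, v) \<in> inc G} \<subseteq> c"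
    using merge.prems(5) unfolding E2_def E1_def by blast
  then have "realizable k (subgraph_on G V2 E2) \<theta>2"
    using merge.prems(1,3,4) \<theta>2 V2 by (intro merge.IH(2)) (simp_all add: E2_def subset_iff)
  then have "realizable k (subgraph_on G V2 E2) \<theta>0"
    using realizable_restrict_labels \<theta>2(1,3) finite_subset[OF _ finite_labels] by blast
  \<comment> \<open>From root bag \<open>B2\<close>, everything outside \<open>B1\<close> has been
    forgotten; now the rest of \<open>B1\<close> is introduced, with the labels of \<theta>. Both
    operands then carry the labelling \<theta>, as a join requires.\<close>
  then have 2: "realizable k (subgraph_on G (V2 \<union> ran \<theta>) E2) \<theta>"
  proof (rule realizable_extend_labels[OF _ \<theta>0(1)])
    have "B1 \<inter> V2 = B1 \<inter> B2" using merge.hyps(3) sub by blast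
    then show "V2 \<inter> ran \<theta> = ran \<theta>0" using \<theta>0(2) merge.prems(8) by (simp add: Int_commute)
  qed (use merge.prems in auto)
  have "\<forall>e\<in>E1. \<exists>c\<in>C1. {v. (e, v) \<in> inc G} \<subseteq> c" unfolding E1_def by blast
  then have 1: "realizable k (subgraph_on G V1 E1) \<theta>"
    using merge.prems(1-4,6-8) by (intro merge.IH(1)) (simp_all add: E1_def subset_iff)
  have "V1 \<inter> (V2 \<union> ran \<theta>) = ran \<theta>" using merge.hyps(3) merge.prems(8) sub by blast
  then have "realizable k \<lparr>verts = V1 \<union> (V2 \<union> ran \<theta>), edges = E1 \<union> E2,
      inc = {(e, v) \<in> inc G. e \<in> E1} \<union> {(e, v) \<in> inc G. e \<in> E2}\<rparr> \<theta>"
    using realizable_join[OF 1 2] by (auto simp: subgraph_on_def E2_def)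
  moreover have "V1 \<union> (V2 \<union> ran \<theta>) = V1 \<union> V2" using merge.prems(8) sub(1) by blast
  moreover have "E1 \<union> E2 = E" by (auto simp: E1_def E2_def)
  moreover have "{(e, v) \<in> inc G. e \<in> E1} \<union> {(e, v) \<in> inc G. e \<in> E2} = {(e, v) \<in> inc G. e \<in> E}"
    by (auto simp: E1_def E2_def)
  ultimately show ?case by (simp add: subgraph_on_def)
qed

lemma treewidth_imp_graph_of:
  assumes G: "graph G" and tw: "treewidth_at_most k G"
  shows "\<exists>\<tau>. legal k \<tau> \<and> isomorphic G (graph_of \<tau>)"
proof -
  obtain C B where C: "glued_bags (verts G) C B" "\<forall>c\<in>C. card c \<le> k + 1"
    "\<forall>e\<in>edges G. \<exists>c\<in>C. {v. (e, v) \<in> inc G} \<subseteq> c"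
    using tw unfolding treewidth_at_most_iff_glued_bags by auto
  have B: "B \<subseteq> verts G" "B \<in> C" using glued_bags_Union[OF C(1)] by blast+
  then have "finite B" "card B \<le> k + 1" using G C(2) finite_subset by (auto simp: graph_def)
  then obtain \<theta> where \<theta>: "inj_on \<theta> (dom \<theta>)" "dom \<theta> \<subseteq> labels k" "ran \<theta> = B"
    using ex_labelling_extension[of Map.empty k B] by auto
  have "subgraph_on G (verts G) (edges G) = G"
    using G by (cases G) (auto simp: subgraph_on_def graph_def)
  then have "realizable k G \<theta>"
    using glued_bags_realizable[OF C(1) G _ C(2) _ C(3) \<theta>] by simp
  then obtain \<tau> H f g where r: "inc G \<subseteq> edges G \<times> verts G" "legal k \<tau>"
    "labelled_graph \<tau> = (H, map_option f \<circ> \<theta>)"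
    "bij_betw f (verts G) (verts H)" "bij_betw g (edges G) (edges H)"
    "inc H = map_prod g f ` inc G" by (rule realizableE)
  have "(e, v) \<in> inc G \<longleftrightarrow> (g e, f v) \<in> inc H" if "e \<in> edges G" "v \<in> verts G" for e v
  proof
    assume "(g e, f v) \<in> inc H"
    then obtain e' v' where ev: "(e', v') \<in> inc G" "g e = g e'" "f v = f v'" using r(6) by auto
    then have "e' \<in> edges G" "v' \<in> verts G" using r(1) by blast+
    then have "e = e'" "v = v'"
      using ev(2,3) that inj_onD[OF bij_betw_imp_inj_on[OF r(4)]] inj_onD[OF bij_betw_imp_inj_on[OF r(5)]]
      by blast+
    then show "(e, v) \<in> inc G" using ev by simp
  qed (auto simp: r(6))
  then have "isomorphic G H" unfolding isomorphic_def using r(4,5) by blast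
  then show ?thesis using r(2,3) by (auto simp: graph_of_def)
qed

section \<open>Isomorphism is an equivalence relation\<close>

lemma isomorphic_sym:
  assumes "isomorphic G H"
  shows "isomorphic H G"
proof -
  from assms obtain f g where fg: "bij_betw f (verts G) (verts H)" "bij_betw g (edges G) (edges H)"
    "\<And>e v. e \<in> edges G \<Longrightarrow> v \<in> verts G \<Longrightarrow> (e, v) \<in> inc G \<longleftrightarrow> (g e, f v) \<in> inc H"
    unfolding isomorphic_def by blast
  let ?f = "inv_into (verts G) f" and ?g = "inv_into (edges G) g"
  have "(e, v) \<in> inc H \<longleftrightarrow> (?g e, ?f v) \<in> inc G" if "e \<in> edges H" "v \<in> verts H" for e v
    using fg(3)[of "?g e" "?f v"] that bij_betw_inv_into_right[OF fg(1)] bij_betw_inv_into_right[OF fg(2)]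
      bij_betwE[OF bij_betw_inv_into[OF fg(1)]] bij_betwE[OF bij_betw_inv_into[OF fg(2)]] by simp
  then show ?thesis
    unfolding isomorphic_def using bij_betw_inv_into[OF fg(1)] bij_betw_inv_into[OF fg(2)] by blast
qed

lemma isomorphic_trans:
  assumes "isomorphic G H" "isomorphic H K"
  shows "isomorphic G K"
proof -
  from assms(1) obtain f g where fg: "bij_betw f (verts G) (verts H)" "bij_betw g (edges G) (edges H)"
    "\<And>e v. e \<in> edges G \<Longrightarrow> v \<in> verts G \<Longrightarrow> (e, v) \<in> inc G \<longleftrightarrow> (g e, f v) \<in> inc H"
    unfolding isomorphic_def by blast
  from assms(2) obtain f' g' where fg': "bij_betw f' (verts H) (verts K)" "bij_betw g' (edges H) (edges K)"
    "\<And>e v. e \<in> edges H \<Longrightarrow> v \<in> verts H \<Longrightarrow> (e, v) \<in> inc H \<longleftrightarrow> (g' e, f' v) \<in> inc K"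
    unfolding isomorphic_def by blast
  have "(e, v) \<in> inc G \<longleftrightarrow> ((g' \<circ> g) e, (f' \<circ> f) v) \<in> inc K" if "e \<in> edges G" "v \<in> verts G" for e v
    using fg(3)[OF that] fg'(3)[of "g e" "f v"] bij_betwE[OF fg(1)] bij_betwE[OF fg(2)] that by simp
  then show ?thesis
    unfolding isomorphic_def using bij_betw_trans[OF fg(1) fg'(1)] bij_betw_trans[OF fg(2) fg'(2)] by blast
qed

lemma isomorphic_refl: "isomorphic G G"
  unfolding isomorphic_def by (intro exI[of _ id]) auto

section \<open>Relabelling\<close>

primrec relabel :: "(nat \<Rightarrow> nat) \<Rightarrow> itd \<Rightarrow> itd" where
  "relabel p Leaf = Leaf"
| "relabel p (IntroVertex u \<tau>) = IntroVertex (p u) (relabel p \<tau>)"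
| "relabel p (ForgetVertex u \<tau>) = ForgetVertex (p u) (relabel p \<tau>)"
| "relabel p (IntroEdge u v \<tau>) = IntroEdge (p u) (p v) (relabel p \<tau>)"
| "relabel p (Join \<sigma> \<tau>) = Join (relabel p \<sigma>) (relabel p \<tau>)"

lemma relabel_relabel: "relabel p (relabel q \<tau>) = relabel (p \<circ> q) \<tau>"
  by (induction \<tau>) auto

lemma bag_relabel: "inj p \<Longrightarrow> bag (relabel p \<tau>) = p ` bag \<tau>"
  by (induction \<tau>) (auto simp: image_set_diff)

lemma legal_relabel:
  assumes "p permutes labels k" "legal k \<tau>"
  shows "legal k (relabel p \<tau>)"
proof -
  have inj: "inj p" using assms(1) by (rule permutes_inj)
  show ?thesis using assms(2)
    by (induction \<tau>)
      (auto simp: bag_relabel[OF inj] permutes_in_image[OF assms(1)] inj_image_mem_iff[OF inj] inj_eq[OF inj])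
qed

section \<open>Permutations of the labels as relabellings\<close>

definition perm_map :: "nat \<Rightarrow> (nat \<Rightarrow> nat) \<Rightarrow> (nat \<rightharpoonup> nat)" where
  "perm_map k p = (\<lambda>u. if u \<in> labels k then Some (p u) else None)"

lemma dom_perm_map [simp]: "dom (perm_map k p) = labels k"
  by (auto simp: perm_map_def dom_def)

lemma perm_map_relabeling:
  assumes "p permutes labels k"
  shows "perm_map k p \<in> relabelings k"
  using permutes_inj[OF assms] permutes_in_image[OF assms]
  by (auto simp: relabelings_def perm_map_def inj_on_def dom_def ran_def inj_def split: if_splits)

lemma restrict_perm_map_relabeling:
  assumes "p permutes labels k"
  shows "perm_map k p |` b \<in> relabelings k"
  using permutes_inj[OF assms] permutes_in_image[OF assms]
  by (auto simp: relabelings_def perm_map_def restrict_map_def inj_on_def dom_def ran_def inj_def split: if_splits)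

text \<open>The domain and the image of \<open>f\<close> have equally many labels, so their
  complements do too, and any bijection between the complements completes \<open>f\<close>. The
  extension is needed to rename labels that a term has forgotten.\<close>

lemma relabeling_extends:
  assumes "f \<in> relabelings k"
  obtains p where "p permutes labels k" "f \<subseteq>\<^sub>m perm_map k p"
proof -
  let ?b = "dom f" and ?g = "the \<circ> f" and ?L = "labels k"
  have b: "?b \<subseteq> ?L" using assms by (simp add: relabelings_def)
  have inj: "inj_on ?g ?b"
    using assms inj_on_dom_SomeD[of f] by (auto simp: relabelings_def intro!: inj_onI)
  have gb: "?g ` ?b \<subseteq> ?L" using assms by (auto simp: relabelings_def ran_def)
  have "card (?L - ?b) = card (?L - ?g ` ?b)"
    using b gb finite_subset[OF b] by (simp add: card_Diff_subset card_image[OF inj] del: image_comp comp_apply)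
  then obtain h where h: "bij_betw h (?L - ?b) (?L - ?g ` ?b)"
    using finite_same_card_bij[of "?L - ?b" "?L - ?g ` ?b"] by auto
  define p where "p = (\<lambda>x. if x \<in> ?b then ?g x else if x \<in> ?L then h x else x)"
  have "bij_betw p ?b (?g ` ?b)"
    using inj by (subst bij_betw_cong[of _ _ ?g]) (auto simp: p_def bij_betw_def)
  moreover have "bij_betw p (?L - ?b) (?L - ?g ` ?b)"
    using h by (subst bij_betw_cong[of _ _ h]) (auto simp: p_def)
  ultimately have "bij_betw p (?b \<union> (?L - ?b)) (?g ` ?b \<union> (?L - ?g ` ?b))"
    by (rule bij_betw_combine) blast
  moreover have "?b \<union> (?L - ?b) = ?L" "?g ` ?b \<union> (?L - ?g ` ?b) = ?L" using b gb by blast+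
  ultimately have "bij_betw p ?L ?L" by simp
  then have "p permutes ?L" by (rule bij_imp_permutes) (use b in \<open>auto simp: p_def\<close>)
  moreover have "f \<subseteq>\<^sub>m perm_map k p" using b by (auto simp: map_le_def perm_map_def p_def)
  ultimately show thesis by (rule that)
qed

lemma image_dom_perm_map:
  assumes "f \<subseteq>\<^sub>m perm_map k p" "b \<subseteq> dom f"
  shows "(the \<circ> f) ` b = p ` b"
proof (rule image_cong[OF refl])
  fix u assume "u \<in> b"
  then have "u \<in> dom f" using assms(2) by blast
  then have "f u = perm_map k p u" using assms(1) by (auto simp: map_le_def)
  then show "(the \<circ> f) u = p u" using \<open>u \<in> dom f\<close> by (auto simp: perm_map_def split: if_splits)
qed

section \<open>The action on dynamizations\<close>

locale symmetric_core =
  fixes D :: "nat \<Rightarrow> sym_level" and k :: nat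
  assumes dp_core: "dp_core D" and finite_core: "finite_core D"
    and interface: "interface_respecting D" and cleaning: "identity_cleaning D"
    and action: "witness_action k (D k)"
begin

abbreviation A where "A \<equiv> D k"

lemma finite_wit: "finite (wit A)"
  using finite_core by (simp add: finite_core_def)

lemma fin_sub_wit [simp]: "fin_sub S (wit A) \<longleftrightarrow> S \<subseteq> wit A"
  using finite_wit finite_subset by (auto simp: fin_sub_def)

lemma clean_id: "S \<subseteq> wit A \<Longrightarrow> clean A S = S"
  using cleaning by (simp add: identity_cleaning_def)

lemma core_k:
  "leaf A \<subseteq> wit A"
  "u \<in> labels k \<Longrightarrow> w \<in> wit A \<Longrightarrow> intro_vertex A u w \<subseteq> wit A"
  "u \<in> labels k \<Longrightarrow> w \<in> wit A \<Longrightarrow> forget_vertex A u w \<subseteq> wit A"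
  "u \<in> labels k \<Longrightarrow> v \<in> labels k \<Longrightarrow> u \<noteq> v \<Longrightarrow> w \<in> wit A \<Longrightarrow> intro_edge A u v w \<subseteq> wit A"
  "w \<in> wit A \<Longrightarrow> w' \<in> wit A \<Longrightarrow> join A w w' \<subseteq> wit A"
  using dp_core[unfolded dp_core_def, rule_format, of k] by (simp_all add: Let_def)

lemma transitions_wit:
  "u \<in> labels k \<Longrightarrow> S \<subseteq> wit A \<Longrightarrow> intro_vertex_set A u S \<subseteq> wit A"
  "u \<in> labels k \<Longrightarrow> S \<subseteq> wit A \<Longrightarrow> forget_vertex_set A u S \<subseteq> wit A"
  "u \<in> labels k \<Longrightarrow> v \<in> labels k \<Longrightarrow> u \<noteq> v \<Longrightarrow> S \<subseteq> wit A \<Longrightarrow> intro_edge_set A u v S \<subseteq> wit A"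
  "S \<subseteq> wit A \<Longrightarrow> S' \<subseteq> wit A \<Longrightarrow> join_set A S S' \<subseteq> wit A"
  unfolding intro_vertex_set_def forget_vertex_set_def intro_edge_set_def join_set_def
  using core_k by (blast, blast, blast, blast)

lemmas interface_k = interface[unfolded interface_respecting_def Let_def, THEN spec, of k]

lemma lbl_leaf: "lbl_set A (leaf A) = {}"
  using interface_k by (elim conjE)

lemma lbl_wit: "w \<in> wit A \<Longrightarrow> lbl A w \<subseteq> labels k"
  using interface_k by (elim conjE) (rule bspec)

lemma transitions_lbl:
  assumes "b \<subseteq> labels k" "S \<subseteq> wit A" "S' \<subseteq> wit A" "lbl_set A S \<subseteq> b" "lbl_set A S' \<subseteq> b"
  shows "u \<in> labels k - b \<Longrightarrow> lbl_set A (intro_vertex_set A u S) \<subseteq> insert u b"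
    "u \<in> b \<Longrightarrow> lbl_set A (forget_vertex_set A u S) \<subseteq> b - {u}"
    "u \<in> b \<Longrightarrow> v \<in> b \<Longrightarrow> u \<noteq> v \<Longrightarrow> lbl_set A (intro_edge_set A u v S) \<subseteq> b"
    "lbl_set A (join_set A S S') \<subseteq> b"
proof -
  have "(\<forall>u\<in>labels k - b. lbl_set A (intro_vertex_set A u S) \<subseteq> b \<union> {u}) \<and>
       (\<forall>u\<in>b. lbl_set A (forget_vertex_set A u S) \<subseteq> b - {u}) \<and>
       (\<forall>u\<in>b. \<forall>v\<in>b. u \<noteq> v \<longrightarrow> lbl_set A (intro_edge_set A u v S) \<subseteq> b) \<and>
       lbl_set A (join_set A S S') \<subseteq> b"
    using interface_k[THEN conjunct2, THEN conjunct2, rule_format, of b S S'] assms by simp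
  then show "u \<in> labels k - b \<Longrightarrow> lbl_set A (intro_vertex_set A u S) \<subseteq> insert u b"
    "u \<in> b \<Longrightarrow> lbl_set A (forget_vertex_set A u S) \<subseteq> b - {u}"
    "u \<in> b \<Longrightarrow> v \<in> b \<Longrightarrow> u \<noteq> v \<Longrightarrow> lbl_set A (intro_edge_set A u v S) \<subseteq> b"
    "lbl_set A (join_set A S S') \<subseteq> b" by auto
qed

lemma dyn_wit: "legal k \<tau> \<Longrightarrow> dyn A \<tau> \<subseteq> wit A"
  by (induction \<tau>) (auto simp: core_k(1)[THEN subsetD] clean_id transitions_wit transitions_wit[THEN subsetD])

text \<open>The search applies no cleaning to successors. With identity cleaning, its transitions
  compute exactly the dynamizations.\<close>

lemma dyn_simps:
  "legal k (IntroVertex u \<tau>) \<Longrightarrow> dyn A (IntroVertex u \<tau>) = intro_vertex_set A u (dyn A \<tau>)"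
  "legal k (ForgetVertex u \<tau>) \<Longrightarrow> dyn A (ForgetVertex u \<tau>) = forget_vertex_set A u (dyn A \<tau>)"
  "legal k (IntroEdge u v \<tau>) \<Longrightarrow> dyn A (IntroEdge u v \<tau>) = intro_edge_set A u v (dyn A \<tau>)"
  "legal k (Join \<sigma> \<tau>) \<Longrightarrow> dyn A (Join \<sigma> \<tau>) = join_set A (dyn A \<sigma>) (dyn A \<tau>)"
  by (simp_all add: clean_id transitions_wit dyn_wit)

text \<open>Ensures that a relabelling defined on the bag already acts on every witness of the
  dynamization.\<close>

lemma dyn_lbl: "legal k \<tau> \<Longrightarrow> lbl_set A (dyn A \<tau>) \<subseteq> bag \<tau>"
proof (induction \<tau>)
  case Leaf
  then show ?case by (simp add: lbl_leaf)
next
  case (IntroVertex u \<tau>)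
  then show ?case
    using transitions_lbl(1)[OF bag_subset_labels dyn_wit dyn_wit, of \<tau> \<tau> \<tau> u] by (simp add: dyn_simps del: dyn.simps)
next
  case (ForgetVertex u \<tau>)
  then show ?case
    using transitions_lbl(2)[OF bag_subset_labels dyn_wit dyn_wit, of \<tau> \<tau> \<tau> u] by (simp add: dyn_simps del: dyn.simps)
next
  case (IntroEdge u v \<tau>)
  then show ?case
    using transitions_lbl(3)[OF bag_subset_labels dyn_wit dyn_wit, of \<tau> \<tau> \<tau> u v] by (simp add: dyn_simps del: dyn.simps)
next
  case (Join \<sigma> \<tau>)
  then show ?case
    using transitions_lbl(4)[OF bag_subset_labels dyn_wit dyn_wit, of \<sigma> \<sigma> \<tau>]
    by (simp add: dyn_simps del: dyn.simps)
qed

lemmas action_parts =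
  action[unfolded witness_action_def, THEN conjunct1]
  action[unfolded witness_action_def, THEN conjunct2, THEN conjunct1]
  action[unfolded witness_action_def, THEN conjunct2, THEN conjunct2, THEN conjunct1]
  action[unfolded witness_action_def, THEN conjunct2, THEN conjunct2, THEN conjunct2, THEN conjunct1]

lemmas action_transitions =
  action[unfolded witness_action_def, THEN conjunct2, THEN conjunct2, THEN conjunct2, THEN conjunct2]

lemma act_defined:
  "f \<in> relabelings k \<Longrightarrow> w \<in> wit A \<Longrightarrow> lbl A w \<subseteq> dom f \<Longrightarrow> \<exists>w'. act A f w = Some w'"
  using action_parts(1) by blast

lemma act_final:
  "f \<in> relabelings k \<Longrightarrow> w \<in> wit A \<Longrightarrow> act A f w = Some w' \<Longrightarrow> w' \<in> final A \<longleftrightarrow> w \<in> final A"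
  using action_parts(2) by blast

lemma act_inv:
  "f \<in> relabelings k \<Longrightarrow> w \<in> wit A \<Longrightarrow> act A f w = Some w' \<Longrightarrow> act A (map_inv f) w' = Some w"
  using action_parts(2) by blast

lemma act_comp:
  "f \<in> relabelings k \<Longrightarrow> f' \<in> relabelings k \<Longrightarrow> w \<in> wit A \<Longrightarrow>
    act A (f \<circ>\<^sub>m f') w = Option.bind (act A f' w) (act A f)"
  using action_parts(3) by blast

lemma act_extends:
  "f \<in> relabelings k \<Longrightarrow> f' \<in> relabelings k \<Longrightarrow> w \<in> wit A \<Longrightarrow> f \<subseteq>\<^sub>m f' \<Longrightarrow> lbl A w \<subseteq> dom f \<Longrightarrow>
    act A f' w = act A f w"
  using action_parts(4) by blast

text \<open>For a relabelling with all labels in its domain, every definedness condition in the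
  equations for the transitions holds.\<close>

lemma act_transitions:
  assumes f: "f \<in> relabelings k" "dom f = labels k" and w: "w \<in> wit A"
  shows "u \<in> labels k \<Longrightarrow>
      act_set A f (intro_vertex A u w) = intro_vertex A (the (f u)) (the (act A f w))"
    "u \<in> labels k \<Longrightarrow>
      act_set A f (forget_vertex A u w) = forget_vertex A (the (f u)) (the (act A f w))"
    "u \<in> labels k \<Longrightarrow> v \<in> labels k \<Longrightarrow> u \<noteq> v \<Longrightarrow>
      act_set A f (intro_edge A u v w) = intro_edge A (the (f u)) (the (f v)) (the (act A f w))"
    "w' \<in> wit A \<Longrightarrow> act_set A f (join A w w') = join A (the (act A f w)) (the (act A f w'))"
proof -
  have lbl: "lbl_set A S \<subseteq> dom f" if "S \<subseteq> wit A" for S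
    using lbl_wit that f(2) by (auto simp: lbl_set_def)
  note l = lbl_wit[OF w, folded f(2)]
  note a = action_transitions
  show "act_set A f (intro_vertex A u w) = intro_vertex A (the (f u)) (the (act A f w))"
    if u: "u \<in> labels k"
    using a[THEN conjunct1, rule_format, OF f(1) w] u l lbl[OF core_k(2)[OF u w]] f(2) by simp
  show "act_set A f (forget_vertex A u w) = forget_vertex A (the (f u)) (the (act A f w))"
    if u: "u \<in> labels k"
    using a[THEN conjunct2, THEN conjunct1, rule_format, OF f(1) w] u l lbl[OF core_k(3)[OF u w]] f(2)
    by simp
  show "act_set A f (intro_edge A u v w) = intro_edge A (the (f u)) (the (f v)) (the (act A f w))"
    if uv: "u \<in> labels k" "v \<in> labels k" "u \<noteq> v"
    using a[THEN conjunct2, THEN conjunct2, THEN conjunct1, rule_format, OF f(1) w] uv l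
      lbl[OF core_k(4)[OF uv w]] f(2) by simp
  show "act_set A f (join A w w') = join A (the (act A f w)) (the (act A f w'))"
    if w': "w' \<in> wit A"
    using a[THEN conjunct2, THEN conjunct2, THEN conjunct2, rule_format, OF f(1) w w'] l
      lbl_wit[OF w'] lbl[OF core_k(5)[OF w w']] f(2) by simp
qed

text \<open>The empty map is its own inverse and its own square. If it sends \<open>w\<close> to
  \<open>w'\<close>, the inverse law sends \<open>w'\<close> to \<open>w\<close>, while the
  composition law gives both the same image; hence \<open>w' = w\<close>.\<close>

lemma act_empty:
  assumes "w \<in> wit A" "lbl A w = {}"
  shows "act A Map.empty w = Some w"
proof -
  have e: "Map.empty \<in> relabelings k" by (simp add: relabelings_def)
  obtain w' where w': "act A Map.empty w = Some w'" using act_defined[OF e assms(1)] assms(2) by auto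
  have "map_inv Map.empty = Map.empty" by (simp add: map_inv_def)
  then have "act A Map.empty w' = Some w" using act_inv[OF e assms(1) w'] by simp
  moreover have "Map.empty \<circ>\<^sub>m Map.empty = (Map.empty :: nat \<rightharpoonup> nat)" by (simp add: map_comp_def)
  then have "act A Map.empty w = act A Map.empty w'" using act_comp[OF e e assms(1)] w' by simp
  ultimately show ?thesis by simp
qed

lemma act_set_image:
  assumes "p permutes labels k" "S \<subseteq> wit A"
  shows "act_set A (perm_map k p) S = (\<lambda>w. the (act A (perm_map k p) w)) ` S"
proof -
  have "\<exists>w'. act A (perm_map k p) w = Some w'" if "w \<in> S" for w
    using act_defined[OF perm_map_relabeling[OF assms(1)]] that assms(2) lbl_wit by auto
  then show ?thesis unfolding act_set_def by force
qed

lemma dyn_relabel_perm: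
  assumes p: "p permutes labels k" and "legal k \<tau>"
  shows "dyn A (relabel p \<tau>) = act_set A (perm_map k p) (dyn A \<tau>)"
  using assms(2)
proof (induction \<tau>)
  case Leaf
  \<comment> \<open>Witnesses of a leaf carry no labels, so the permutation acts on them like its
    restriction to the empty domain, that is, trivially.\<close>
  have "act A (perm_map k p) w = Some w" if w: "w \<in> leaf A" for w
  proof -
    have "lbl A w = {}" using lbl_leaf w by (auto simp: lbl_set_def)
    moreover have wA: "w \<in> wit A" using w core_k(1) by blast
    ultimately show ?thesis
      using act_extends[of Map.empty "perm_map k p" w] perm_map_relabeling[OF p] act_empty
      by (simp add: relabelings_def)
  qed
  then show ?case by (auto simp: act_set_def)
next
  case (IntroVertex u \<tau>)
  note f = perm_map_relabeling[OF p] dom_perm_map[of k p]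
  note leg = legal_relabel[OF p IntroVertex.prems]
  have u: "u \<in> labels k" "legal k \<tau>" "the (perm_map k p u) = p u"
    using IntroVertex.prems by (auto simp: perm_map_def)
  have "act_set A (perm_map k p) (\<Union>w\<in>dyn A \<tau>. intro_vertex A u w) =
      (\<Union>w\<in>dyn A \<tau>. act_set A (perm_map k p) (intro_vertex A u w))"
    by (auto simp: act_set_def)
  also have "\<dots> = (\<Union>w\<in>dyn A \<tau>. intro_vertex A (p u) (the (act A (perm_map k p) w)))"
    using act_transitions(1)[OF f] dyn_wit[OF u(2)] u by (auto simp: subset_iff)
  finally show ?case
    using IntroVertex.IH[OF u(2)] leg IntroVertex.prems act_set_image[OF p dyn_wit[OF u(2)]]
    by (simp add: dyn_simps intro_vertex_set_def del: dyn.simps legal.simps)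
next
  case (ForgetVertex u \<tau>)
  note f = perm_map_relabeling[OF p] dom_perm_map[of k p]
  note leg = legal_relabel[OF p ForgetVertex.prems]
  have u: "u \<in> labels k" "legal k \<tau>" "the (perm_map k p u) = p u"
    using ForgetVertex.prems by (auto simp: perm_map_def)
  have "act_set A (perm_map k p) (\<Union>w\<in>dyn A \<tau>. forget_vertex A u w) =
      (\<Union>w\<in>dyn A \<tau>. act_set A (perm_map k p) (forget_vertex A u w))"
    by (auto simp: act_set_def)
  also have "\<dots> = (\<Union>w\<in>dyn A \<tau>. forget_vertex A (p u) (the (act A (perm_map k p) w)))"
    using act_transitions(2)[OF f] dyn_wit[OF u(2)] u by (auto simp: subset_iff)
  finally show ?case
    using ForgetVertex.IH[OF u(2)] leg ForgetVertex.prems act_set_image[OF p dyn_wit[OF u(2)]]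
    by (simp add: dyn_simps forget_vertex_set_def del: dyn.simps legal.simps)
next
  case (IntroEdge u v \<tau>)
  note f = perm_map_relabeling[OF p] dom_perm_map[of k p]
  note leg = legal_relabel[OF p IntroEdge.prems]
  have u: "u \<in> labels k" "v \<in> labels k" "u \<noteq> v" "the (perm_map k p u) = p u" "the (perm_map k p v) = p v"
    and leg': "legal k \<tau>"
    using IntroEdge.prems by (auto simp: perm_map_def)
  have "act_set A (perm_map k p) (\<Union>w\<in>dyn A \<tau>. intro_edge A u v w) =
      (\<Union>w\<in>dyn A \<tau>. act_set A (perm_map k p) (intro_edge A u v w))"
    by (auto simp: act_set_def)
  also have "\<dots> = (\<Union>w\<in>dyn A \<tau>. intro_edge A (p u) (p v) (the (act A (perm_map k p) w)))"
    using act_transitions(3)[OF f] dyn_wit[OF leg'] u by (auto simp: subset_iff)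
  finally show ?case
    using IntroEdge.IH[OF leg'] leg IntroEdge.prems act_set_image[OF p dyn_wit[OF leg']]
    by (simp add: dyn_simps intro_edge_set_def del: dyn.simps legal.simps)
next
  case (Join \<sigma> \<tau>)
  note f = perm_map_relabeling[OF p] dom_perm_map[of k p]
  note leg = legal_relabel[OF p Join.prems]
  have l: "legal k \<sigma>" "legal k \<tau>" using Join.prems by auto
  let ?a = "\<lambda>w. the (act A (perm_map k p) w)"
  have "act_set A (perm_map k p) (\<Union>w\<in>dyn A \<sigma>. \<Union>w'\<in>dyn A \<tau>. join A w w') =
      (\<Union>w\<in>dyn A \<sigma>. \<Union>w'\<in>dyn A \<tau>. act_set A (perm_map k p) (join A w w'))"
    by (auto simp: act_set_def)
  also have "\<dots> = (\<Union>w\<in>dyn A \<sigma>. \<Union>w'\<in>dyn A \<tau>. join A (?a w) (?a w'))"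
    using act_transitions(4)[OF f] dyn_wit[OF l(1)] dyn_wit[OF l(2)] by (auto simp: subset_iff)
  finally show ?case
    using Join.IH l leg Join.prems act_set_image[OF p dyn_wit[OF l(1)]] act_set_image[OF p dyn_wit[OF l(2)]]
    by (simp add: dyn_simps join_set_def del: dyn.simps legal.simps)
qed

text \<open>Passes from permutations back to partial relabellings: the witnesses have their labels
  in the bag, hence in the domain of \<open>f\<close>, so \<open>f\<close> and its extension act
  alike.\<close>

lemma act_set_dyn:
  assumes f: "f \<in> relabelings k" and p: "p permutes labels k" and le: "f \<subseteq>\<^sub>m perm_map k p"
    and \<tau>: "legal k \<tau>" "bag \<tau> \<subseteq> dom f"
  shows "act_set A f (dyn A \<tau>) = dyn A (relabel p \<tau>)"
proof -
  have "act A (perm_map k p) w = act A f w" if w: "w \<in> dyn A \<tau>" for w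
  proof -
    have "w \<in> wit A" using w dyn_wit[OF \<tau>(1)] by blast
    moreover have "lbl A w \<subseteq> dom f" using w dyn_lbl[OF \<tau>(1)] \<tau>(2) unfolding lbl_set_def by blast
    ultimately show ?thesis by (rule act_extends[OF f perm_map_relabeling[OF p] _ le])
  qed
  then have "act_set A f (dyn A \<tau>) = act_set A (perm_map k p) (dyn A \<tau>)"
    by (auto simp: act_set_def)
  then show ?thesis using dyn_relabel_perm[OF p \<tau>(1)] by simp
qed

lemma accepts_relabel:
  assumes p: "p permutes labels k" and \<tau>: "legal k \<tau>"
  shows "accepts A (relabel p \<tau>) \<longleftrightarrow> accepts A \<tau>"
proof -
  have "the (act A (perm_map k p) w) \<in> final A \<longleftrightarrow> w \<in> final A" if "w \<in> dyn A \<tau>" for w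
  proof -
    have w: "w \<in> wit A" using that dyn_wit[OF \<tau>] by blast
    then obtain w' where "act A (perm_map k p) w = Some w'"
      using act_defined[OF perm_map_relabeling[OF p] w] lbl_wit[OF w] by auto
    then show ?thesis using act_final[OF perm_map_relabeling[OF p] w] by simp
  qed
  then show ?thesis
    unfolding accepts_def has_final_def dyn_relabel_perm[OF assms] act_set_image[OF p dyn_wit[OF \<tau>]]
    by blast
qed

end

section \<open>Canonical triples\<close>

lemma sorted_wrt_set_unique:
  assumes "antisym r" "sorted_wrt (\<lambda>x y. (x, y) \<in> r) xs" "sorted_wrt (\<lambda>x y. (x, y) \<in> r) ys"
    "distinct xs" "distinct ys" "set xs = set ys"
  shows "xs = ys"
  using assms(2-)
proof (induction xs arbitrary: ys)
  case Nil
  then show ?case by simp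
next
  case (Cons a xs)
  then obtain b ys' where ys: "ys = b # ys'" by (cases ys) auto
  have "a = b"
  proof (rule ccontr)
    assume "a \<noteq> b"
    then have "a \<in> set ys'" "b \<in> set xs" using Cons.prems(5) ys by auto
    then have "(b, a) \<in> r" "(a, b) \<in> r" using Cons.prems ys by auto
    then show False using assms(1) \<open>a \<noteq> b\<close> by (auto simp: antisym_def)
  qed
  moreover have "set xs = set ys'" using Cons.prems ys calculation by auto
  ultimately show ?case using Cons.IH[of ys'] Cons.prems ys by simp
qed

lemma linear_order_on_ex_enum:
  assumes "linear_order_on W r" "finite S" "S \<subseteq> W"
  shows "\<exists>xs. set xs = S \<and> distinct xs \<and> sorted_wrt (\<lambda>x y. (x, y) \<in> r) xs"
  using assms(2,3)
proof (induction S)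
  case empty
  then show ?case by simp
next
  case (insert x S)
  then obtain xs where xs: "set xs = S" "distinct xs" "sorted_wrt (\<lambda>x y. (x, y) \<in> r) xs" by auto
  have tr: "trans r" and tot: "total_on W r"
    using assms(1) by (auto simp: linear_order_on_def partial_order_on_def preorder_on_def)
  let ?l = "filter (\<lambda>y. (y, x) \<in> r) xs" and ?g = "filter (\<lambda>y. (y, x) \<notin> r) xs"
  have g: "(x, y) \<in> r" if "y \<in> set ?g" for y
  proof -
    have "y \<noteq> x" "y \<in> W" "x \<in> W" using that xs(1) insert by auto
    then show ?thesis using tot that by (auto simp: total_on_def)
  qed
  have "set (?l @ x # ?g) = insert x S" using xs(1) by auto
  moreover have "distinct (?l @ x # ?g)" using xs insert.hyps by auto
  moreover have "sorted_wrt (\<lambda>x y. (x, y) \<in> r) (?l @ x # ?g)"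
    using xs(3) g tr by (auto simp: sorted_wrt_append sorted_wrt_filter intro: transD)
  ultimately show ?case by blast
qed

text \<open>The definite description in \<open>enum_by\<close> is proper, and a set can be recovered
  from its enumeration. Distinct triples thus have distinct enumerations, which makes the order on
  them total.\<close>

lemma set_enum_by:
  assumes "linear_order_on W r" "finite S" "S \<subseteq> W"
  shows "set (enum_by r S) = S"
proof -
  have "antisym r" using assms(1) by (simp add: linear_order_on_def partial_order_on_def)
  then have "\<exists>!xs. set xs = S \<and> distinct xs \<and> sorted_wrt (\<lambda>x y. (x, y) \<in> r) xs"
    using linear_order_on_ex_enum[OF assms] sorted_wrt_set_unique[of r] by metis
  from theI'[OF this] show ?thesis unfolding enum_by_def by blast
qed

lemma lexord_total_on:
  assumes "\<And>a b. a \<in> W \<Longrightarrow> b \<in> W \<Longrightarrow> a \<noteq> b \<Longrightarrow> (a, b) \<in> r \<or> (b, a) \<in> r"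
    "set xs \<subseteq> W" "set ys \<subseteq> W" "xs \<noteq> ys"
  shows "(xs, ys) \<in> lexord r \<or> (ys, xs) \<in> lexord r"
  using assms(2-)
proof (induction xs arbitrary: ys)
  case Nil
  then show ?case by (cases ys) auto
next
  case (Cons a xs)
  show ?case
  proof (cases ys)
    case (Cons b zs)
    then show ?thesis using Cons.IH[of zs] Cons.prems assms(1)[of a b] by auto
  qed simp
qed

lemma ex1_least:
  assumes "finite T" "T \<noteq> {}" "trans R" "\<And>x. (x, x) \<notin> R" "total_on T R"
  shows "\<exists>!x. x \<in> T \<and> (\<forall>y\<in>T. x = y \<or> (x, y) \<in> R)"
proof (rule ex_ex1I)
  show "\<exists>x. x \<in> T \<and> (\<forall>y\<in>T. x = y \<or> (x, y) \<in> R)"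
    using assms(1,2,5)
  proof (induction rule: finite_ne_induct)
    case (insert a T)
    then obtain x where x: "x \<in> T" "\<forall>y\<in>T. x = y \<or> (x, y) \<in> R" by (auto simp: total_on_def)
    have "a \<noteq> x" using x insert.hyps by blast
    then have "(a, x) \<in> R \<or> (x, a) \<in> R" using insert.prems x(1) by (auto simp: total_on_def)
    then show ?case
    proof
      assume "(a, x) \<in> R"
      then have "\<forall>y\<in>insert a T. a = y \<or> (a, y) \<in> R" using x assms(3) by (auto dest: transD)
      then show ?thesis by blast
    next
      assume "(x, a) \<in> R"
      then show ?thesis using x by blast
    qed
  qed auto
next
  fix x y assume xy: "x \<in> T \<and> (\<forall>z\<in>T. x = z \<or> (x, z) \<in> R)" "y \<in> T \<and> (\<forall>z\<in>T. y = z \<or> (y, z) \<in> R)"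
  show "x = y"
  proof (rule ccontr)
    assume "x \<noteq> y"
    then have "(x, y) \<in> R" "(y, x) \<in> R" using xy by auto
    then show False using transD[OF assms(3)] assms(4) by blast
  qed
qed

text \<open>Describes the effect by sets only, so the order in which successors are listed does not
  influence the invariant of the search.\<close>

lemma foldl_enqueue:
  assumes "foldl (enqueue c) (Y, S) Xs = (Y', S')"
  shows "S' = S \<union> c ` set Xs \<and> (\<exists>Z. Y' = Y @ Z \<and> distinct Z \<and> set Z = S' - S)"
  using assms
proof (induction Xs arbitrary: Y S)
  case (Cons x Xs)
  show ?case
  proof (cases "c x \<in> S")
    case True
    then have "foldl (enqueue c) (Y, S) Xs = (Y', S')" using Cons.prems by (simp add: enqueue_def)
    from Cons.IH[OF this] show ?thesis using True by auto
  next
    case False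
    then have "foldl (enqueue c) (Y @ [c x], insert (c x) S) Xs = (Y', S')"
      using Cons.prems by (simp add: enqueue_def)
    note IH = Cons.IH[OF this]
    note S' = conjunct1[OF IH]
    obtain Z where Z: "Y' = (Y @ [c x]) @ Z" "distinct Z" "set Z = S' - insert (c x) S"
      using conjunct2[OF IH] by blast
    have "c x \<in> S'" unfolding S' by blast
    then have "set (c x # Z) = S' - S" unfolding list.set Z(3) using False by blast
    moreover have "distinct (c x # Z)" using Z(2,3) by simp
    moreover have "Y' = Y @ (c x # Z)" using Z(1) by simp
    moreover have "S' = S \<union> c ` set (x # Xs)" unfolding S' by simp
    ultimately show ?thesis by blast
  qed
qed simp

section \<open>Triples of terms and their canonical forms\<close>

locale two_cores =
  C1: symmetric_core D1 k + C2: symmetric_core D2 k for D1 D2 :: "nat \<Rightarrow> sym_level" and k :: nat +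
  fixes r1 r2 :: "witness rel"
  assumes order1: "linear_order_on (wit (D1 k)) r1" and order2: "linear_order_on (wit (D2 k)) r2"
begin

abbreviation A1 where "A1 \<equiv> D1 k"
abbreviation A2 where "A2 \<equiv> D2 k"
abbreviation canon where "canon \<equiv> can k A1 A2 r1 r2"
abbreviation less where "less \<equiv> triple_less r1 r2"

definition triple_of :: "itd \<Rightarrow> triple" where
  "triple_of \<tau> = (bag \<tau>, dyn A1 \<tau>, dyn A2 \<tau>)"

lemma fst_triple_of [simp]: "fst (triple_of \<tau>) = bag \<tau>"
  by (simp add: triple_of_def)

lemma well_formed_triple_of: "legal k \<tau> \<Longrightarrow> well_formed k A1 A2 (triple_of \<tau>)"
  by (simp add: well_formed_def triple_of_def bag_subset_labels C1.dyn_wit C2.dyn_wit C1.dyn_lbl C2.dyn_lbl)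

lemma finite_well_formed: "finite {t. well_formed k A1 A2 t}"
proof (rule finite_subset)
  show "{t. well_formed k A1 A2 t} \<subseteq> Pow (labels k) \<times> Pow (wit A1) \<times> Pow (wit A2)"
    by (auto simp: well_formed_def)
  show "finite (Pow (labels k) \<times> Pow (wit A1) \<times> Pow (wit A2))"
    using C1.finite_wit C2.finite_wit by simp
qed

lemma sat_premise_triple_of: "sat_premise A1 (triple_of \<tau>) \<longleftrightarrow> accepts A1 \<tau>"
  by (simp add: sat_premise_def triple_of_def accepts_def)

lemma inconsistent_triple_of:
  "inconsistent A1 A2 (triple_of \<tau>) \<longleftrightarrow> accepts A1 \<tau> \<and> \<not> accepts A2 \<tau>"
  by (simp add: inconsistent_def triple_of_def accepts_def)

lemma act_triple_triple_of:
  assumes "f \<in> relabelings k" "p permutes labels k" "f \<subseteq>\<^sub>m perm_map k p" "legal k \<tau>" "dom f = bag \<tau>"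
  shows "act_triple A1 A2 f (triple_of \<tau>) = triple_of (relabel p \<tau>)"
  using C1.act_set_dyn[OF assms(1-4)] C2.act_set_dyn[OF assms(1-4)]
    image_dom_perm_map[OF assms(3), of "bag \<tau>"] bag_relabel[OF permutes_inj[OF assms(2)]] assms(5)
  by (simp add: act_triple_def triple_of_def)

text \<open>Every relabelling of the bag extends to a permutation of the labels, and every
  permutation restricts to the bag. The minimum in \<open>can\<close> may therefore be taken over
  permutations, which form a group.\<close>

lemma orbit_triple_of:
  assumes "legal k \<tau>"
  shows "{act_triple A1 A2 f (triple_of \<tau>) | f. f \<in> relabelings k \<and> dom f = fst (triple_of \<tau>)} =
    {triple_of (relabel p \<tau>) | p. p permutes labels k}" (is "?L = ?R")
proof
  show "?L \<subseteq> ?R"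
  proof
    fix t assume "t \<in> ?L"
    then obtain f where f: "f \<in> relabelings k" "dom f = bag \<tau>" "t = act_triple A1 A2 f (triple_of \<tau>)" by auto
    obtain p where "p permutes labels k" "f \<subseteq>\<^sub>m perm_map k p" using relabeling_extends[OF f(1)] .
    then show "t \<in> ?R" using act_triple_triple_of f assms by blast
  qed
  show "?R \<subseteq> ?L"
  proof
    fix t assume "t \<in> ?R"
    then obtain p where p: "p permutes labels k" "t = triple_of (relabel p \<tau>)" by auto
    let ?f = "perm_map k p |` bag \<tau>"
    have "dom ?f = bag \<tau>" using bag_subset_labels[OF assms] by auto
    moreover have "?f \<in> relabelings k" by (rule restrict_perm_map_relabeling[OF p(1)])
    moreover have "?f \<subseteq>\<^sub>m perm_map k p" by (simp add: map_le_def)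
    ultimately have "t = act_triple A1 A2 ?f (triple_of \<tau>) \<and> ?f \<in> relabelings k \<and>
        dom ?f = fst (triple_of \<tau>)"
      using act_triple_triple_of[of ?f p \<tau>] p assms by simp
    then show "t \<in> ?L" by blast
  qed
qed

lemma trans_less: "trans less"
proof -
  have "trans (r1 - Id)" "trans (r2 - Id)"
    using order1 order2 trans_diff_Id
    by (auto simp: linear_order_on_def partial_order_on_def preorder_on_def)
  moreover have "trans {(x, y :: nat). x < y}" by (auto simp: trans_def)
  ultimately show ?thesis
    unfolding triple_less_def by (intro trans_inv_image trans_lex_prod lexord_transI)
qed

lemma irrefl_less: "(t, t) \<notin> less"
  unfolding triple_less_def by (auto simp: lexord_irreflexive split: prod.splits)

lemma total_less: "total_on {t. well_formed k A1 A2 t} less"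
proof (rule total_onI)
  fix s t assume "s \<in> {t. well_formed k A1 A2 t}" "t \<in> {t. well_formed k A1 A2 t}" "s \<noteq> t"
  moreover obtain b S1 S2 where s: "s = (b, S1, S2)" by (cases s)
  moreover obtain b' S1' S2' where t: "t = (b', S1', S2')" by (cases t)
  ultimately have wf: "b \<subseteq> labels k" "b' \<subseteq> labels k" "S1 \<subseteq> wit A1" "S1' \<subseteq> wit A1" "S2 \<subseteq> wit A2" "S2' \<subseteq> wit A2"
    and ne: "b \<noteq> b' \<or> S1 \<noteq> S1' \<or> S2 \<noteq> S2'" by (auto simp: well_formed_def)
  note fb = finite_subset[OF wf(1) finite_labels] finite_subset[OF wf(2) finite_labels]
  have tot: "\<And>x y. x \<in> wit A1 \<Longrightarrow> y \<in> wit A1 \<Longrightarrow> x \<noteq> y \<Longrightarrow> (x, y) \<in> r1 - Id \<or> (y, x) \<in> r1 - Id"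
    "\<And>x y. x \<in> wit A2 \<Longrightarrow> y \<in> wit A2 \<Longrightarrow> x \<noteq> y \<Longrightarrow> (x, y) \<in> r2 - Id \<or> (y, x) \<in> r2 - Id"
    using order1 order2 by (auto simp: linear_order_on_def total_on_def)
  have e1: "set (enum_by r1 S) = S" if "S \<subseteq> wit A1" for S
    using set_enum_by[OF order1 finite_subset[OF that C1.finite_wit] that] .
  have e2: "set (enum_by r2 S) = S" if "S \<subseteq> wit A2" for S
    using set_enum_by[OF order2 finite_subset[OF that C2.finite_wit] that] .
  have c0: "b \<noteq> b' \<Longrightarrow> (sorted_list_of_set b, sorted_list_of_set b') \<in> lexord {(x, y). x < y} \<or>
      (sorted_list_of_set b', sorted_list_of_set b) \<in> lexord {(x, y). x < y}"
    using sorted_list_of_set_inject[OF _ fb] by (intro lexord_total_on[of UNIV]) auto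
  have c1: "S1 \<noteq> S1' \<Longrightarrow> (enum_by r1 S1, enum_by r1 S1') \<in> lexord (r1 - Id) \<or>
      (enum_by r1 S1', enum_by r1 S1) \<in> lexord (r1 - Id)"
    using lexord_total_on[OF tot(1), where xs = "enum_by r1 S1" and ys = "enum_by r1 S1'"] e1[OF wf(3)] e1[OF wf(4)] wf(3,4)
    by metis
  have c2: "S2 \<noteq> S2' \<Longrightarrow> (enum_by r2 S2, enum_by r2 S2') \<in> lexord (r2 - Id) \<or>
      (enum_by r2 S2', enum_by r2 S2) \<in> lexord (r2 - Id)"
    using lexord_total_on[OF tot(2), where xs = "enum_by r2 S2" and ys = "enum_by r2 S2'"] e2[OF wf(5)] e2[OF wf(6)] wf(5,6)
    by metis
  show "(s, t) \<in> less \<or> (t, s) \<in> less"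
    unfolding triple_less_def s t using ne c0 c1 c2 by auto
qed

text \<open>The orbit is a non-empty finite set of well-formed triples, on which the order is total,
  so the definite description in \<open>can\<close> denotes its minimum.\<close>

lemma canon_least:
  assumes "legal k \<tau>"
  obtains p where "p permutes labels k" "canon (triple_of \<tau>) = triple_of (relabel p \<tau>)"
    "\<And>q. q permutes labels k \<Longrightarrow> canon (triple_of \<tau>) = triple_of (relabel q \<tau>) \<or>
      (canon (triple_of \<tau>), triple_of (relabel q \<tau>)) \<in> less"
proof -
  let ?T = "{triple_of (relabel p \<tau>) | p. p permutes labels k}"
  have sub: "?T \<subseteq> {t. well_formed k A1 A2 t}"
    using well_formed_triple_of legal_relabel assms by auto
  have "triple_of (relabel id \<tau>) \<in> ?T" using permutes_id by blast
  then have "?T \<noteq> {}" by blast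
  then have "\<exists>!x. x \<in> ?T \<and> (\<forall>y\<in>?T. x = y \<or> (x, y) \<in> less)"
    using finite_subset[OF sub finite_well_formed] trans_less irrefl_less total_on_subset[OF total_less sub]
    by (intro ex1_least)
  from theI'[OF this] have "canon (triple_of \<tau>) \<in> ?T \<and>
      (\<forall>y\<in>?T. canon (triple_of \<tau>) = y \<or> (canon (triple_of \<tau>), y) \<in> less)"
    unfolding can_def orbit_triple_of[OF assms] Let_def .
  then show thesis using that by blast
qed

text \<open>Both terms have the same orbit: a permutation \<open>q\<close> of the one corresponds to
  \<open>q \<circ> inv p\<close> of the other.\<close>

lemma canon_relabel:
  assumes p: "p permutes labels k" and "legal k \<tau>"
  shows "canon (triple_of (relabel p \<tau>)) = canon (triple_of \<tau>)"
proof -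
  have "{triple_of (relabel q (relabel p \<tau>)) | q. q permutes labels k} =
      {triple_of (relabel q \<tau>) | q. q permutes labels k}" (is "?L = ?R")
  proof
    show "?L \<subseteq> ?R" using permutes_compose[OF p] by (auto simp: relabel_relabel)
    show "?R \<subseteq> ?L"
    proof
      fix t assume "t \<in> ?R"
      then obtain q where q: "q permutes labels k" "t = triple_of (relabel q \<tau>)" by auto
      have "q \<circ> inv p permutes labels k" using permutes_compose[OF permutes_inv[OF p] q(1)] .
      moreover have "(q \<circ> inv p) \<circ> p = q" by (simp add: o_assoc[symmetric] permutes_inv_o(2)[OF p])
      ultimately show "t \<in> ?L" using q(2) relabel_relabel[of "q \<circ> inv p" p \<tau>] by force
    qed
  qed
  then show ?thesis
    unfolding can_def orbit_triple_of[OF assms(2)] orbit_triple_of[OF legal_relabel[OF assms]] by simp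
qed

text \<open>
  The bag is compared first, so canonical triples whose bags have equal size share the least bag.
\<close>

lemma canon_bag_eq:
  assumes \<sigma>: "legal k \<sigma>" and \<tau>: "legal k \<tau>" and bag: "bag \<sigma> = bag \<tau>"
  shows "fst (canon (triple_of \<sigma>)) = fst (canon (triple_of \<tau>))"
proof -
  let ?R = "lexord {(x, y :: nat). x < y}"
  have tr: "trans ?R" by (rule lexord_transI) (auto simp: trans_def)
  have irr: "(x, x) \<notin> ?R" for x by (rule lexord_irreflexive) simp
  have fin: "finite (bag \<rho>)" if "legal k \<rho>" for \<rho>
    using finite_subset[OF bag_subset_labels[OF that]] by simp
  have less_bag: "bag \<rho> = bag \<rho>' \<or> (sorted_list_of_set (bag \<rho>), sorted_list_of_set (bag \<rho>')) \<in> ?R"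
    if "triple_of \<rho> = triple_of \<rho>' \<or> (triple_of \<rho>, triple_of \<rho>') \<in> less" "legal k \<rho>" "legal k \<rho>'" for \<rho> \<rho>'
    using that(1) sorted_list_of_set_inject[OF _ fin[OF that(2)] fin[OF that(3)]]
    by (auto simp: triple_less_def triple_of_def)
  obtain p where p: "p permutes labels k" "canon (triple_of \<sigma>) = triple_of (relabel p \<sigma>)"
    and minp: "\<And>q. q permutes labels k \<Longrightarrow> canon (triple_of \<sigma>) = triple_of (relabel q \<sigma>) \<or>
      (canon (triple_of \<sigma>), triple_of (relabel q \<sigma>)) \<in> less" using canon_least[OF \<sigma>] by blast
  obtain q where q: "q permutes labels k" "canon (triple_of \<tau>) = triple_of (relabel q \<tau>)"
    and minq: "\<And>p. p permutes labels k \<Longrightarrow> canon (triple_of \<tau>) = triple_of (relabel p \<tau>) \<or>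
      (canon (triple_of \<tau>), triple_of (relabel p \<tau>)) \<in> less" using canon_least[OF \<tau>] by blast
  have b: "bag (relabel p \<sigma>) = p ` bag \<tau>" "bag (relabel q \<sigma>) = q ` bag \<tau>"
    "bag (relabel p \<tau>) = p ` bag \<tau>" "bag (relabel q \<tau>) = q ` bag \<tau>"
    using bag_relabel permutes_inj p(1) q(1) bag by metis+
  \<comment> \<open>Each minimum is compared with the image of its own term under the permutation
    chosen for the other term. As the bags agree, the two comparisons are opposite to each
    other.\<close>
  have "p ` bag \<tau> = q ` bag \<tau> \<or> (sorted_list_of_set (p ` bag \<tau>), sorted_list_of_set (q ` bag \<tau>)) \<in> ?R"
    using less_bag[OF minp[OF q(1), unfolded p(2)]] legal_relabel p(1) q(1) \<sigma> b by metis
  moreover have "q ` bag \<tau> = p ` bag \<tau> \<or> (sorted_list_of_set (q ` bag \<tau>), sorted_list_of_set (p ` bag \<tau>)) \<in> ?R"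
    using less_bag[OF minq[OF p(1), unfolded q(2)]] legal_relabel p(1) q(1) \<tau> b by metis
  ultimately have "p ` bag \<tau> = q ` bag \<tau>" using transD[OF tr] irr by metis
  then show ?thesis using p(2) q(2) b by simp
qed

lemma unary_successors_triple_of:
  assumes \<tau>: "legal k \<tau>"
  shows "unary_successors k A1 A2 (triple_of \<tau>) =
    {triple_of (IntroVertex u \<tau>) | u. legal k (IntroVertex u \<tau>)} \<union>
    {triple_of (ForgetVertex u \<tau>) | u. legal k (ForgetVertex u \<tau>)} \<union>
    {triple_of (IntroEdge u v \<tau>) | u v. legal k (IntroEdge u v \<tau>)}"
proof -
  have b: "u \<in> bag \<tau> \<Longrightarrow> u \<in> labels k" for u using bag_subset_labels[OF \<tau>] by blast
  have 1: "{triple_of (IntroVertex u \<tau>) | u. legal k (IntroVertex u \<tau>)} =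
      {(bag \<tau> \<union> {u}, intro_vertex_set A1 u (dyn A1 \<tau>), intro_vertex_set A2 u (dyn A2 \<tau>)) | u. u \<in> labels k - bag \<tau>}"
    using C1.dyn_simps(1) C2.dyn_simps(1) \<tau>
    by (intro Collect_cong ex_cong) (auto simp: triple_of_def simp del: dyn.simps)
  have 2: "{triple_of (ForgetVertex u \<tau>) | u. legal k (ForgetVertex u \<tau>)} =
      {(bag \<tau> - {u}, forget_vertex_set A1 u (dyn A1 \<tau>), forget_vertex_set A2 u (dyn A2 \<tau>)) | u. u \<in> bag \<tau>}"
    using C1.dyn_simps(2) C2.dyn_simps(2) \<tau> b
    by (intro Collect_cong ex_cong) (auto simp: triple_of_def simp del: dyn.simps)
  have 3: "{triple_of (IntroEdge u v \<tau>) | u v. legal k (IntroEdge u v \<tau>)} =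
      {(bag \<tau>, intro_edge_set A1 u v (dyn A1 \<tau>), intro_edge_set A2 u v (dyn A2 \<tau>)) | u v.
        u \<in> bag \<tau> \<and> v \<in> bag \<tau> \<and> u \<noteq> v}"
    using C1.dyn_simps(3) C2.dyn_simps(3) \<tau> b
    by (intro Collect_cong ex_cong1) (auto simp: triple_of_def simp del: dyn.simps)
  show ?thesis unfolding 1 2 3 by (simp add: unary_successors_def triple_of_def)
qed

text \<open>Because \<pi> permutes the bag, its extension \<open>p\<close> maps the bag to itself,
  and the relabelled operand can legally be joined.\<close>

lemma join_triples_triple_of:
  assumes \<sigma>: "legal k \<sigma>" and \<tau>: "legal k \<tau>" and bag: "bag \<sigma> = bag \<tau>"
    and \<pi>: "\<pi> \<in> relabelings k" "dom \<pi> = bag \<sigma>" "ran \<pi> = bag \<sigma>"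
    and p: "p permutes labels k" "\<pi> \<subseteq>\<^sub>m perm_map k p"
  shows "legal k (Join \<sigma> (relabel p \<tau>))"
    and "join_triples A1 A2 \<pi> (triple_of \<sigma>) (triple_of \<tau>) = triple_of (Join \<sigma> (relabel p \<tau>))"
proof -
  have "p ` bag \<tau> = bag \<sigma>"
    using image_dom_perm_map[OF p(2), of "bag \<tau>"] \<pi> bag by (simp add: ran_eq_image_dom)
  then show leg: "legal k (Join \<sigma> (relabel p \<tau>))"
    using \<sigma> legal_relabel[OF p(1) \<tau>] bag_relabel[OF permutes_inj[OF p(1)]] by simp
  show "join_triples A1 A2 \<pi> (triple_of \<sigma>) (triple_of \<tau>) = triple_of (Join \<sigma> (relabel p \<tau>))"
    using C1.act_set_dyn[OF \<pi>(1) p \<tau>] C2.act_set_dyn[OF \<pi>(1) p \<tau>] \<pi>(2) bag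
      C1.dyn_simps(4)[OF leg] C2.dyn_simps(4)[OF leg]
    by (simp add: join_triples_def triple_of_def del: dyn.simps)
qed

end

section \<open>The search\<close>

context two_cores
begin

abbreviation step where "step \<equiv> bfs_step k A1 A2 r1 r2"

text \<open>Speaks of terms and not of runs: it is an upper bound for what the search can find, and
  also covers triples that pruning cuts off.\<close>

definition reached :: "triple \<Rightarrow> bool" where
  "reached t \<longleftrightarrow> (\<exists>\<tau>. legal k \<tau> \<and> t = canon (triple_of \<tau>))"

lemma reachedE:
  assumes "reached t"
  obtains \<tau> where "legal k \<tau>" "t = triple_of \<tau>" "canon t = t"
proof -
  from assms obtain \<sigma> where \<sigma>: "legal k \<sigma>" "t = canon (triple_of \<sigma>)" by (auto simp: reached_def)
  obtain p where p: "p permutes labels k" "canon (triple_of \<sigma>) = triple_of (relabel p \<sigma>)"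
    using canon_least[OF \<sigma>(1)] by blast
  show thesis
  proof (rule that)
    show "legal k (relabel p \<sigma>)" using legal_relabel p(1) \<sigma>(1) .
    show "t = triple_of (relabel p \<sigma>)" using \<sigma>(2) p(2) by simp
    then show "canon t = t" using canon_relabel[OF p(1) \<sigma>(1)] \<sigma>(2) by simp
  qed
qed

lemma reached_canonical: "reached t \<Longrightarrow> canonical k A1 A2 r1 r2 t"
  by (auto simp: canonical_def well_formed_triple_of elim!: reachedE)

lemma finite_reached: "finite {t. reached t}"
  by (rule finite_subset[OF _ finite_well_formed]) (auto dest: reached_canonical simp: canonical_def)

definition successors :: "triple list \<Rightarrow> triple \<Rightarrow> triple set" where
  "successors R t = unary_successors k A1 A2 t \<union> join_successors k A1 A2 R t"

lemma successors_legal: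
  assumes R: "\<forall>t\<in>set R. reached t" and t: "reached t" and X: "X \<in> successors R t"
  shows "\<exists>\<tau>. legal k \<tau> \<and> X = triple_of \<tau>"
proof -
  obtain \<tau> where \<tau>: "legal k \<tau>" "t = triple_of \<tau>" using t by (rule reachedE)
  from X consider "X \<in> unary_successors k A1 A2 t"
    | t' \<pi> where "t' \<in> set R" "fst t' = fst t" "\<pi> \<in> relabelings k" "dom \<pi> = fst t" "ran \<pi> = fst t"
      "X = join_triples A1 A2 \<pi> t t' \<or> X = join_triples A1 A2 \<pi> t' t"
    by (auto simp: successors_def join_successors_def)
  then show ?thesis
  proof cases
    case 1
    then show ?thesis unfolding \<tau>(2) unary_successors_triple_of[OF \<tau>(1)] by blast
  next
    case 2
    obtain \<sigma> where \<sigma>: "legal k \<sigma>" "t' = triple_of \<sigma>" using R 2(1) by (blast elim: reachedE)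
    have bag: "bag \<sigma> = bag \<tau>" using 2(2) \<sigma> \<tau> by simp
    obtain p where p: "p permutes labels k" "\<pi> \<subseteq>\<^sub>m perm_map k p" using relabeling_extends[OF 2(3)] .
    have \<pi>: "dom \<pi> = bag \<tau>" "ran \<pi> = bag \<tau>" using 2(4,5) \<tau>(2) by simp_all
    show ?thesis
      using 2(6) join_triples_triple_of[OF \<tau>(1) \<sigma>(1) bag[symmetric] 2(3) \<pi> p]
        join_triples_triple_of[OF \<sigma>(1) \<tau>(1) bag 2(3) \<pi>[folded bag] p]
      unfolding \<tau>(2) \<sigma>(2) by blast
  qed
qed

lemma finite_successors:
  assumes "\<forall>t\<in>set R. reached t" "reached t"
  shows "finite (successors R t)"
  by (rule finite_subset[OF _ finite_well_formed])
    (auto dest!: successors_legal[OF assms] simp: well_formed_triple_of)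

text \<open>
  In the last clause both orders of the operands are covered: a join is generated when the later
  of its two operands is processed.
\<close>

definition run_inv :: "triple list \<Rightarrow> triple list \<Rightarrow> triple set \<Rightarrow> bool" where
  "run_inv R Y Seen \<longleftrightarrow>
     set R \<union> set Y = Seen \<and> distinct (R @ Y) \<and> (\<forall>t\<in>Seen. reached t) \<and>
     canon (triple_of Leaf) \<in> Seen \<and>
     (\<forall>t\<in>set R. \<not> inconsistent A1 A2 t) \<and>
     (\<forall>t\<in>set R. sat_premise A1 t \<longrightarrow> canon ` unary_successors k A1 A2 t \<subseteq> Seen) \<and>
     (\<forall>t\<in>set R. \<forall>t'\<in>set R. \<forall>\<pi>\<in>relabelings k.
        sat_premise A1 t \<and> sat_premise A1 t' \<and> fst t' = fst t \<and> dom \<pi> = fst t \<and> ran \<pi> = fst t \<longrightarrow>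
        canon (join_triples A1 A2 \<pi> t t') \<in> Seen)"

text \<open>A positive answer remembers a run with empty queue: all seen triples are processed, and
  \<open>R\<close> contains the canonical forms of the successors of its premise-satisfying
  members.\<close>

fun config_inv :: "config \<Rightarrow> bool" where
  "config_inv (Running R Y Seen) \<longleftrightarrow> run_inv R Y Seen"
| "config_inv (Returned Inclusion_Holds) \<longleftrightarrow> (\<exists>R. run_inv R [] (set R))"
| "config_inv (Returned (Trace R)) \<longleftrightarrow>
     R \<noteq> [] \<and> (\<forall>t\<in>set R. reached t) \<and> inconsistent A1 A2 (last R)"

lemma config_inv_init: "config_inv (bfs_init k A1 A2 r1 r2)"
proof -
  have "({}, leaf A1, leaf A2) = triple_of Leaf" by (simp add: triple_of_def)
  then show ?thesis
    by (auto simp: bfs_init_def Let_def run_inv_def reached_def intro: exI[of _ Leaf])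
qed

lemma run_inv_expand:
  assumes inv: "run_inv R (t # Y) Seen" and t: "sat_premise A1 t" "\<not> inconsistent A1 A2 t"
    and Xs: "set Xs = successors (R @ [t]) t"
    and fold: "foldl (enqueue canon) (Y, Seen) Xs = (Y', Seen')"
  shows "run_inv (R @ [t]) Y' Seen'"
proof -
  note i = inv[unfolded run_inv_def]
  have seen: "set R \<union> set (t # Y) = Seen" using i by (rule conjunct1)
  have dist: "distinct (R @ t # Y)" using i[THEN conjunct2] by (rule conjunct1)
  have reach: "\<forall>t\<in>Seen. reached t" and init: "canon (triple_of Leaf) \<in> Seen"
    and cons: "\<forall>t\<in>set R. \<not> inconsistent A1 A2 t"
    using i by simp_all
  have un: "\<forall>t\<in>set R. sat_premise A1 t \<longrightarrow> canon ` unary_successors k A1 A2 t \<subseteq> Seen"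
    using i by simp
  have jo: "\<And>s s' \<pi>. s \<in> set R \<Longrightarrow> s' \<in> set R \<Longrightarrow> \<pi> \<in> relabelings k \<Longrightarrow> sat_premise A1 s \<Longrightarrow>
      sat_premise A1 s' \<Longrightarrow> fst s' = fst s \<Longrightarrow> dom \<pi> = fst s \<Longrightarrow> ran \<pi> = fst s \<Longrightarrow>
      canon (join_triples A1 A2 \<pi> s s') \<in> Seen"
    using i by simp
  have rt: "\<forall>s\<in>set (R @ [t]). reached s" "reached t" using reach seen by auto
  note S' = conjunct1[OF foldl_enqueue[OF fold], unfolded Xs]
  obtain Z where Z: "Y' = Y @ Z" "distinct Z" "set Z = Seen' - Seen"
    using conjunct2[OF foldl_enqueue[OF fold]] by blast
  have sub: "Seen \<subseteq> Seen'" and suc: "canon ` successors (R @ [t]) t \<subseteq> Seen'" unfolding S' by blast+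
  have 1: "set (R @ [t]) \<union> set Y' = Seen'" using seen sub unfolding Z(1) set_append Z(3) by auto
  have "set Z \<inter> (set R \<union> set (t # Y)) = {}" unfolding Z(3) seen by blast
  then have 2: "distinct ((R @ [t]) @ Y')" using dist Z(2) unfolding Z(1) by auto
  have 3: "\<forall>s\<in>Seen'. reached s"
    using reach successors_legal[OF rt] unfolding S' reached_def by blast
  have 4: "\<forall>s\<in>set (R @ [t]). sat_premise A1 s \<longrightarrow> canon ` unary_successors k A1 A2 s \<subseteq> Seen'"
    using un sub suc unfolding successors_def by auto
  have 5: "canon (join_triples A1 A2 \<pi> s s') \<in> Seen'"
    if *: "s \<in> set (R @ [t])" "s' \<in> set (R @ [t])" "\<pi> \<in> relabelings k" "sat_premise A1 s"
      "sat_premise A1 s'" "fst s' = fst s" "dom \<pi> = fst s" "ran \<pi> = fst s" for s s' \<pi>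
  proof -
    consider "s \<in> set R" "s' \<in> set R" | "s = t" | "s' = t" using * by auto
    then show ?thesis
    proof cases
      case 1
      then show ?thesis using jo * sub by blast
    next
      case 2
      have "join_triples A1 A2 \<pi> s s' \<in> join_successors k A1 A2 (R @ [t]) t"
        unfolding join_successors_def using * 2 by blast
      then show ?thesis using suc unfolding successors_def by blast
    next
      case 3
      have "join_triples A1 A2 \<pi> s s' \<in> join_successors k A1 A2 (R @ [t]) t"
        unfolding join_successors_def using * 3 by (intro UN_I[of s] UN_I[of \<pi>]) auto
      then show ?thesis using suc unfolding successors_def by blast
    qed
  qed
  have 6: "\<forall>s\<in>set (R @ [t]). \<not> inconsistent A1 A2 s" using cons t(2) by simp
  show ?thesis unfolding run_inv_def using 1 2 3 4 5 6 init sub by blast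
qed

text \<open>An inconsistent triple satisfies the premise, and the closure conditions concern only
  premise-satisfying triples; so a pruned triple imposes no new obligation.\<close>

lemma run_inv_prune:
  assumes inv: "run_inv R (t # Y) Seen" and t: "\<not> sat_premise A1 t"
  shows "run_inv (R @ [t]) Y Seen"
proof -
  have "\<not> inconsistent A1 A2 t" using t by (auto simp: inconsistent_def sat_premise_def)
  then show ?thesis using inv t unfolding run_inv_def by simp
qed

lemma config_inv_step: "step c c' \<Longrightarrow> config_inv c \<Longrightarrow> config_inv c'"
proof (induction rule: bfs_step.induct)
  case (finish R Seen)
  then have "set R = Seen" by (simp add: run_inv_def)
  then show ?case using finish by auto
next
  case (stop t R Y Seen)
  then show ?case by (auto simp: run_inv_def)
next
  case (prune t R Y Seen)
  then show ?case using run_inv_prune by simp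
next
  case (expand t Xs R Y Seen Y' Seen')
  then show ?case using run_inv_expand unfolding successors_def by simp
qed

lemma config_inv_reachable: "step\<^sup>*\<^sup>* (bfs_init k A1 A2 r1 r2) c \<Longrightarrow> config_inv c"
  by (induction rule: rtranclp_induct) (auto intro: config_inv_init config_inv_step)

section \<open>Termination\<close>

text \<open>Expanding requires a list of all successors, which exists because there are only
  finitely many of them.\<close>

lemma running_progress:
  assumes "run_inv R Y Seen"
  shows "\<exists>c'. step (Running R Y Seen) c'"
proof (cases Y)
  case Nil
  then show ?thesis using bfs_step.finish by blast
next
  case (Cons t Y')
  have reach: "\<forall>s\<in>set (R @ [t]). reached s" using assms Cons unfolding run_inv_def by auto
  then obtain Xs where "set Xs = unary_successors k A1 A2 t \<union> join_successors k A1 A2 (R @ [t]) t"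
    using finite_list[OF finite_successors[of "R @ [t]" t]] unfolding successors_def by auto
  then show ?thesis
    unfolding Cons using bfs_step.stop bfs_step.prune bfs_step.expand by (metis surj_pair)
qed

lemma terminates: "bfs_terminates k A1 A2 r1 r2"
  unfolding bfs_terminates_def
proof (intro conjI notI allI impI)
  assume "\<exists>c. c 0 = bfs_init k A1 A2 r1 r2 \<and> (\<forall>i::nat. step (c i) (c (Suc i)))"
  then obtain c where c: "c 0 = bfs_init k A1 A2 r1 r2" "\<And>i::nat. step (c i) (c (Suc i))" by blast
  \<comment> \<open>Each step that does not return appends one triple to \<open>R\<close>, so the
    length of \<open>R\<close> counts the steps, while \<open>R\<close> stays a duplicate-free list
    over a finite set.\<close>
  have run: "\<exists>R Y S. c i = Running R Y S \<and> length R = i \<and> run_inv R Y S" for i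
  proof (induction i)
    case 0
    then show ?case using c(1) config_inv_init by (auto simp: bfs_init_def Let_def)
  next
    case (Suc i)
    then obtain R Y S where R: "c i = Running R Y S" "length R = i" "run_inv R Y S" by blast
    have inv: "config_inv (c (Suc i))" using config_inv_step[OF c(2)[of i]] R by simp
    \<comment> \<open>The following step of the infinite run excludes that this one
      returned.\<close>
    have "\<exists>R' Y' S'. c (Suc i) = Running R' Y' S' \<and> length R' = Suc (length R)"
      using c(2)[of i] c(2)[of "Suc i"] unfolding R(1)
      by (cases rule: bfs_step.cases) (auto elim: bfs_step.cases)
    then show ?case using R(2) inv by auto
  qed
  obtain R Y S where R: "length R = Suc (card {t. reached t})" "run_inv R Y S"
    using run[of "Suc (card {t. reached t})"] by blast
  then have "distinct R" "set R \<subseteq> {t. reached t}" unfolding run_inv_def by auto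
  then have "length R \<le> card {t. reached t}"
    using card_mono[OF finite_reached] distinct_card by metis
  then show False using R(1) by simp
next
  fix c assume "step\<^sup>*\<^sup>* (bfs_init k A1 A2 r1 r2) c \<and> \<not> (\<exists>c'. step c c')"
  then show "\<exists>out. c = Returned out"
    using config_inv_reachable[of c] running_progress by (cases c) auto
qed

section \<open>Completeness of the search\<close>

text \<open>The hypothesis on embeddings is the trace that subgraph-closure leaves on terms. It
  hands acceptance down to the operands, so that the induction hypotheses apply and the operands
  satisfy the premise.\<close>

lemma canon_in_closed:
  assumes inv: "run_inv R [] (set R)"
    and sub: "\<And>\<sigma> \<tau>. legal k \<sigma> \<Longrightarrow> legal k \<tau> \<Longrightarrow> embeds (graph_of \<sigma>) (graph_of \<tau>) \<Longrightarrow>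
      accepts A1 \<tau> \<Longrightarrow> accepts A1 \<sigma>"
  shows "legal k \<tau> \<Longrightarrow> accepts A1 \<tau> \<Longrightarrow> canon (triple_of \<tau>) \<in> set R"
proof (induction \<tau>)
  note i = inv[unfolded run_inv_def]
  have un: "canon X \<in> set R" if "t \<in> set R" "sat_premise A1 t" "X \<in> unary_successors k A1 A2 t" for t X
    using i that by (meson image_subset_iff)
  \<comment> \<open>The search knows \<tau> only through a relabelled copy with some permutation
    \<open>p\<close>, so the successor relation is required for all permutations. The result is
    again a copy of \<tau>' and has the same canonical form.\<close>
  have unary: "canon (triple_of \<tau>') \<in> set R"
    if IH: "canon (triple_of \<tau>) \<in> set R" and l: "legal k \<tau>" "legal k \<tau>'" "accepts A1 \<tau>"
      and succ: "\<And>p. p permutes labels k \<Longrightarrow>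
        triple_of (relabel p \<tau>') \<in> unary_successors k A1 A2 (triple_of (relabel p \<tau>))" for \<tau> \<tau>'
  proof -
    obtain p where p: "p permutes labels k" "canon (triple_of \<tau>) = triple_of (relabel p \<tau>)"
      using canon_least[OF l(1)] by blast
    have "sat_premise A1 (triple_of (relabel p \<tau>))"
      using C1.accepts_relabel[OF p(1) l(1)] l(3) by (simp add: sat_premise_triple_of)
    then have "canon (triple_of (relabel p \<tau>')) \<in> set R" using un IH p succ by metis
    then show ?thesis using canon_relabel[OF p(1) l(2)] by simp
  qed
  {
    case Leaf
    then show ?case using i by blast
  next
    case (IntroVertex u \<tau>)
    have l: "legal k \<tau>" using IntroVertex.prems by simp
    then have a: "accepts A1 \<tau>" using sub IntroVertex.prems embeds_unary(1) by blast
    show ?case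
    proof (rule unary[OF IntroVertex.IH[OF l a] l IntroVertex.prems(1) a])
      fix p assume p: "p permutes labels k"
      show "triple_of (relabel p (IntroVertex u \<tau>)) \<in> unary_successors k A1 A2 (triple_of (relabel p \<tau>))"
        using legal_relabel[OF p IntroVertex.prems(1)]
        unfolding unary_successors_triple_of[OF legal_relabel[OF p l]] relabel.simps by blast
    qed
  next
    case (ForgetVertex u \<tau>)
    have l: "legal k \<tau>" using ForgetVertex.prems by simp
    then have a: "accepts A1 \<tau>" using sub ForgetVertex.prems embeds_unary(2) by blast
    show ?case
    proof (rule unary[OF ForgetVertex.IH[OF l a] l ForgetVertex.prems(1) a])
      fix p assume p: "p permutes labels k"
      show "triple_of (relabel p (ForgetVertex u \<tau>)) \<in> unary_successors k A1 A2 (triple_of (relabel p \<tau>))"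
        using legal_relabel[OF p ForgetVertex.prems(1)]
        unfolding unary_successors_triple_of[OF legal_relabel[OF p l]] relabel.simps by blast
    qed
  next
    case (IntroEdge u v \<tau>)
    have l: "legal k \<tau>" using IntroEdge.prems by simp
    then have a: "accepts A1 \<tau>" using sub IntroEdge.prems embeds_unary(3) by blast
    show ?case
    proof (rule unary[OF IntroEdge.IH[OF l a] l IntroEdge.prems(1) a])
      fix p assume p: "p permutes labels k"
      show "triple_of (relabel p (IntroEdge u v \<tau>)) \<in> unary_successors k A1 A2 (triple_of (relabel p \<tau>))"
        using legal_relabel[OF p IntroEdge.prems(1)]
        unfolding unary_successors_triple_of[OF legal_relabel[OF p l]] relabel.simps by blast
    qed
  next
    case (Join \<sigma> \<tau>)
    have l: "legal k \<sigma>" "legal k \<tau>" and bag: "bag \<sigma> = bag \<tau>" using Join.prems by simp_all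
    have a: "accepts A1 \<sigma>" "accepts A1 \<tau>" using sub l Join.prems embeds_Join by blast+
    obtain p where p: "p permutes labels k" "canon (triple_of \<sigma>) = triple_of (relabel p \<sigma>)"
      using canon_least[OF l(1)] by blast
    obtain q where q: "q permutes labels k" "canon (triple_of \<tau>) = triple_of (relabel q \<tau>)"
      using canon_least[OF l(2)] by blast
    have bags: "bag (relabel p \<sigma>) = bag (relabel q \<tau>)"
      using canon_bag_eq[OF l bag] p(2) q(2) by simp
    have in_R: "triple_of (relabel p \<sigma>) \<in> set R" "triple_of (relabel q \<tau>) \<in> set R"
      using Join.IH(1)[OF l(1) a(1)] Join.IH(2)[OF l(2) a(2)] p(2) q(2) by simp_all
    have sat: "sat_premise A1 (triple_of (relabel p \<sigma>))" "sat_premise A1 (triple_of (relabel q \<tau>))"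
      using C1.accepts_relabel p(1) q(1) l a by (simp_all add: sat_premise_triple_of)
    \<comment> \<open>Relabelling by \<open>?m\<close> turns \<open>relabel q \<tau>\<close> into
      \<open>relabel p \<tau>\<close>, so the join produced by the search is the one of
      \<open>relabel p (Join \<sigma> \<tau>)\<close>.\<close>
    let ?m = "p \<circ> inv q" and ?b = "bag (relabel p \<sigma>)"
    let ?\<pi> = "perm_map k ?m |` ?b"
    have m: "?m permutes labels k" using permutes_compose[OF permutes_inv[OF q(1)] p(1)] .
    have mq: "?m \<circ> q = p" by (simp add: o_assoc[symmetric] permutes_inv_o(2)[OF q(1)])
    have \<pi>: "?\<pi> \<in> relabelings k" "?\<pi> \<subseteq>\<^sub>m perm_map k ?m"
      by (rule restrict_perm_map_relabeling[OF m]) (simp add: map_le_def)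
    have dom: "dom ?\<pi> = ?b" using bag_subset_labels[OF legal_relabel[OF p(1) l(1)]] by auto
    have "?m ` ?b = ?b"
    proof -
      have "?m ` ?b = ?m ` q ` bag \<tau>" unfolding bags by (simp add: bag_relabel[OF permutes_inj[OF q(1)]])
      also have "\<dots> = p ` bag \<tau>" using mq by (metis image_comp)
      finally show ?thesis using bag_relabel[OF permutes_inj[OF p(1)]] bag by simp
    qed
    then have ran: "ran ?\<pi> = ?b"
      unfolding ran_eq_image_dom dom using image_dom_perm_map[OF \<pi>(2) dom[THEN equalityD2]] by metis
    have "canon (join_triples A1 A2 ?\<pi> (triple_of (relabel p \<sigma>)) (triple_of (relabel q \<tau>))) \<in> set R"
      using i in_R sat \<pi>(1) dom ran bags by simp
    moreover have "join_triples A1 A2 ?\<pi> (triple_of (relabel p \<sigma>)) (triple_of (relabel q \<tau>)) =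
        triple_of (relabel p (Join \<sigma> \<tau>))"
      using join_triples_triple_of(2)[OF legal_relabel[OF p(1) l(1)] legal_relabel[OF q(1) l(2)]
          bags \<pi>(1) dom ran m \<pi>(2)] mq by (simp add: relabel_relabel)
    ultimately show ?case using canon_relabel[OF p(1) Join.prems(1)] by simp
  }
qed

end

section \<open>Correctness of the answers\<close>

text \<open>Membership may be witnessed by another term, even of another width; coherence carries
  acceptance over to the given one.\<close>

lemma graph_of_in_graph_property:
  assumes "coherent D" "legal k \<tau>"
  shows "graph_of \<tau> \<in> graph_property D \<longleftrightarrow> accepts (D k) \<tau>"
proof
  assume "graph_of \<tau> \<in> graph_property D"
  then obtain k' \<tau>' where "legal k' \<tau>'" "accepts (D k') \<tau>'" "isomorphic (graph_of \<tau>) (graph_of \<tau>')"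
    unfolding graph_property_def by blast
  then show "accepts (D k) \<tau>" using assms unfolding coherent_def by blast
next
  assume "accepts (D k) \<tau>"
  then show "graph_of \<tau> \<in> graph_property D"
    unfolding graph_property_def using assms(2) graph_graph_of isomorphic_refl by blast
qed

lemma graph_property_isomorphic:
  assumes "isomorphic G H" "graph G" "graph H"
  shows "G \<in> graph_property D \<longleftrightarrow> H \<in> graph_property D"
  using assms isomorphic_sym isomorphic_trans unfolding graph_property_def by blast

theorem theorem6:
  fixes k :: nat
    and D1 D2 :: "nat \<Rightarrow> sym_level"
    and r1 r2 :: "witness rel"
  assumes "dp_core D1" and "dp_core D2"
    and "finite_core D1" and "finite_core D2"
    and "coherent D1" and "coherent D2"
    and "interface_respecting D1" and "interface_respecting D2"
    and "identity_cleaning D1" and "identity_cleaning D2"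
    and "\<forall>j. witness_action j (D1 j)" and "\<forall>j. witness_action j (D2 j)"
    and "subgraph_closed (graph_property D1)"
    and "linear_order_on (wit (D1 k)) r1" and "linear_order_on (wit (D2 k)) r2"
  shows "bfs_terminates k (D1 k) (D2 k) r1 r2 \<and>
    (\<forall>out. bfs_returns k (D1 k) (D2 k) r1 r2 out \<longrightarrow>
       (out = Inclusion_Holds \<longleftrightarrow>
          \<not> (\<exists>G. graph G \<and> treewidth_at_most k G \<and>
                G \<in> graph_property D1 \<and> G \<notin> graph_property D2)) \<and>
       ((\<exists>G. graph G \<and> treewidth_at_most k G \<and>
             G \<in> graph_property D1 \<and> G \<notin> graph_property D2) \<longrightarrow>
          (\<exists>R. out = Trace R \<and> R \<noteq> [] \<and>
             (\<forall>t\<in>set R. canonical k (D1 k) (D2 k) r1 r2 t) \<and>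
             inconsistent (D1 k) (D2 k) (last R))))"
proof -
  interpret two_cores D1 D2 k r1 r2
    using assms by unfold_locales simp_all
  let ?cex = "\<lambda>G. graph G \<and> treewidth_at_most k G \<and> G \<in> graph_property D1 \<and> G \<notin> graph_property D2"
  have sub: "accepts (D1 k) \<sigma>"
    if "legal k \<sigma>" "legal k \<tau>" "embeds (graph_of \<sigma>) (graph_of \<tau>)" "accepts (D1 k) \<tau>" for \<sigma> \<tau>
    using that graph_of_in_graph_property[OF assms(5)] graph_graph_of assms(13)
    unfolding subgraph_closed_def by blast
  have trace: "\<exists>G. ?cex G" if inv: "config_inv (Returned (Trace R))" for R
  proof -
    have "reached (last R)" "inconsistent (D1 k) (D2 k) (last R)" using inv by simp_all
    then obtain \<tau> where \<tau>: "legal k \<tau>" "inconsistent (D1 k) (D2 k) (triple_of \<tau>)" by (auto elim: reachedE)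
    then have "?cex (graph_of \<tau>)"
      using graph_of_in_graph_property[OF assms(5) \<tau>(1)] graph_of_in_graph_property[OF assms(6) \<tau>(1)]
        graph_graph_of[OF \<tau>(1)] treewidth_graph_of[OF \<tau>(1)]
      by (simp add: inconsistent_triple_of)
    then show ?thesis by blast
  qed
  have holds: "\<not> ?cex G" if inv: "config_inv (Returned Inclusion_Holds)" for G
  proof
    assume G: "?cex G"
    from inv obtain R where R: "run_inv R [] (set R)" by auto
    obtain \<tau> where \<tau>: "legal k \<tau>" "isomorphic G (graph_of \<tau>)"
      using treewidth_imp_graph_of[of G k] G by blast
    have "accepts (D1 k) \<tau> \<and> \<not> accepts (D2 k) \<tau>"
      using G graph_property_isomorphic[OF \<tau>(2) _ graph_graph_of[OF \<tau>(1)]]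
        graph_of_in_graph_property[OF assms(5) \<tau>(1)] graph_of_in_graph_property[OF assms(6) \<tau>(1)]
      by blast
    \<comment> \<open>The search processes the canonical form instead of the triple of \<tau>. It is
      the triple of a relabelled term, and relabelling preserves acceptance by both cores, so it is
      inconsistent as well.\<close>
    moreover obtain p where p: "p permutes labels k" "canon (triple_of \<tau>) = triple_of (relabel p \<tau>)"
      using canon_least[OF \<tau>(1)] by blast
    ultimately have "inconsistent (D1 k) (D2 k) (canon (triple_of \<tau>))" "canon (triple_of \<tau>) \<in> set R"
      using canon_in_closed[OF R sub \<tau>(1)] C1.accepts_relabel[OF p(1) \<tau>(1)] C2.accepts_relabel[OF p(1) \<tau>(1)]
      by (simp_all add: inconsistent_triple_of)
    then show False using R by (simp add: run_inv_def)
  qed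
  have "(out = Inclusion_Holds \<longleftrightarrow> \<not> (\<exists>G. ?cex G)) \<and>
      ((\<exists>G. ?cex G) \<longrightarrow> (\<exists>R. out = Trace R \<and> R \<noteq> [] \<and>
        (\<forall>t\<in>set R. canonical k (D1 k) (D2 k) r1 r2 t) \<and> inconsistent (D1 k) (D2 k) (last R)))"
    if "bfs_returns k (D1 k) (D2 k) r1 r2 out" for out
  proof -
    have inv: "config_inv (Returned out)"
      using that config_inv_reachable by (simp add: bfs_returns_def)
    show ?thesis
    proof (cases out)
      case Inclusion_Holds
      then show ?thesis using holds inv by blast
    next
      case (Trace R)
      then show ?thesis using trace[of R] inv reached_canonical by auto
    qed
  qed
  then show ?thesis using terminates by blast
qed

end
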